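(* Let $K\in\mathcal{C}([0,T],\mathcal{L}_1(H))$ be the unique solution of $$K(t)=S(t)Q_\xi S(t)^*+\int_0^t \big(S(t-s)FK(s)S(t-s)^*+S(t-s)K(s)(S(t-s)F)^*\big)\,ds+\int_0^t S(t-s)B(S(t-s)B)^*\,ds,\quad t\in[0,T],$$ and for $t\in[0,T]$ let $$\tilde K(t)=\tilde S(t)Q_\xi\tilde S(t)^*+\int_0^t\big(\tilde S(t-s)F\hat K(s)\tilde S(t-s)^*+\tilde S(t-s)\hat K(s)(\tilde S(t-s)F)^*\big)\,ds+\int_0^t\tilde S(t-s)B(\tilde S(t-s)B)^*\,ds.$$ Then, with $\mathcal{O}^+(s)=S(s)+\tilde S(s)$ and $\mathcal{O}^-(s)=S(s)-\tilde S(s)$ for $s\in[0,t]$, for every $t\in[0,T]$ and $i\in\{1,2\}$, $$\begin{aligned}\|K(t)-\tilde K(t)\|_{\mathcal{L}_i(H)}\le{}&\|\mathcal{O}^-(t)Q_\xi\mathcal{O}^+(t)^*\|_{\mathcal{L}_i(H)}+2\int_0^t\|S(t-s)F(K(s)-\hat K(s))S(t-s)^*\|_{\mathcal{L}_i(H)}\,ds\\&+\int_0^t\|\mathcal{O}^-(t-s)F\hat K(s)(\mathcal{O}^+(t-s))^*\|_{\mathcal{L}_i(H)}\,ds+\int_0^t\|\mathcal{O}^+(t-s)F\hat K(s)(\mathcal{O}^-(t-s))^*\|_{\mathcal{L}_i(H)}\,ds\\&+\int_0^t\|\mathcal{O}^-(t-s)B(\mathcal{O}^+(t-s)B)^*\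|_{\mathcal{L}_i(H)}\,ds.\end{aligned}$$
   Context: $T<\infty$. $H$, $\hat H$, $U$ are real separable Hilbert spaces with $H\hookrightarrow\hat H$ continuously and densely. $\mathcal{L}$, $\mathcal{L}_1$, $\mathcal{L}_2$ denote bounded, trace class and Hilbert--Schmidt operators; $\Sigma(H)\subset\mathcal{L}(H)$ is the set of symmetric bounded operators and $\Sigma^+(H)$ its subset of positive semidefinite operators. $Q\in\Sigma^+(U)$ and $U_0=Q^{1/2}(U)$ with inner product $\langle Q^{-1/2}\cdot,Q^{-1/2}\cdot\rangle_U$ ($Q^{-1/2}$ the pseudoinverse of $Q^{1/2}$). $F\in\mathcal{L}(H,\hat H)$, $B\in\mathcal{L}_2(U_0,\hat H)$, $Q_\xi\in\mathcal{L}_1(H)\cap\Sigma^+(H)$. $S=(S(t))_{t\in[0,T]}$ and $\tilde S=(\tilde S(t))_{t\in[0,T]}$ are families of operators with $S(t),\tilde S(t)\in\mathcal{L}(\hat H,H)$ for $t\in(0,T]$ and $S(0),\tilde S(0)\in\mathcal{L}(H)$ (not assumed to be semigroups); on $H$ they are understood as their restrictions to $H$. For every $v\in H$: $t\mapsto S(t)v\in H$ is continuous on $[0,T]$, $t\mapsto S(t)Fv\in H$ and $t\mapsto S(t)B\in\mathcal{L}_2(U_0,H)$ are continuous on $(0,T]$; the maps $t\mapsto\tilde S(t)v\in H$, $t\mapsto\tilde S(t)Fv\in H$ and $t\mapsto\tilde S(t)B\in\mathcal{L}_2(U_0,H)$ are continuous almost everywhere on $[0,T]$. Both $R=S$ and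 $R=\tilde S$ satisfy the following: there are $C<\infty$, $a\in L^1([0,T],\mathbb{R})$, $b\in L^2([0,T],\mathbb{R})$ such that $\|R(t)\|_{\mathcal{L}(H)}\le C$ for all $t\in[0,T]$, and $\|R(t)F\|_{\mathcal{L}(H)}\le a(t)$, $\|R(t)B\|_{\mathcal{L}_2(U_0,H)}\le b(t)$ for all $t\in(0,T]$. $\hat K:[0,T]\to\mathcal{L}_1(H)\cap\Sigma(H)$ is continuous almost everywhere on $[0,T]$ (as an $\mathcal{L}_1(H)$-valued map), and the integrals defining $\tilde K(t)$ are understood to exist as Bochner integrals in $\mathcal{L}_1(H)$. Adjoints of $S(t)$, $S(t)F$ (and their $\tilde S$ analogues) are those of operators in $\mathcal{L}(H)$; those of $S(t)B$, $\tilde S(t)B$ are of operators $U_0\to H$. *)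

theory Defs
  imports "HOL-Analysis.Analysis"
begin

class separable_hilbert = real_inner + banach + second_countable_topology

instance euclidean_space \<subseteq> separable_hilbert ..

lemma hilbert_projection:
  fixes M :: "'a::{real_inner,banach} set"
  assumes "subspace M" "closed M"
  shows "\<exists>p\<in>M. \<forall>m\<in>M. inner (x - p) m = 0"
proof -
  define d where "d = (INF m\<in>M. (norm (x - m))\<^sup>2)"
  have ne: "M \<noteq> {}" using assms(1) subspace_0 by blast
  have bdd: "bdd_below ((\<lambda>m. (norm (x - m))\<^sup>2) ` M)" by (rule bdd_belowI[of _ 0]) auto
  have dle: "d \<le> (norm (x - m))\<^sup>2" if "m \<in> M" for m
    unfolding d_def by (rule cINF_lower[OF bdd that])
  have "\<exists>m\<in>M. (norm (x - m))\<^sup>2 < d + 1 / real (Suc n)" for n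
  proof -
    have "d < d + 1 / real (Suc n)" by simp
    then show ?thesis unfolding d_def using cINF_less_iff[OF ne bdd] by blast
  qed
  then obtain m where m: "\<And>n. m n \<in> M" "\<And>n. (norm (x - m n))\<^sup>2 < d + 1 / real (Suc n)"
    by metis
  have par: "(norm (m n - m k))\<^sup>2 \<le> 2 / real (Suc n) + 2 / real (Suc k)" for n k
  proof -
    have "(1/2) *\<^sub>R (m n + m k) \<in> M" using m(1) assms(1) by (intro subspace_scale subspace_add)
    then have 1: "d \<le> (norm (x - (1/2) *\<^sub>R (m n + m k)))\<^sup>2" by (rule dle)
    have "(norm (m n - m k))\<^sup>2 = 2 * (norm (x - m n))\<^sup>2 + 2 * (norm (x - m k))\<^sup>2
        - 4 * (norm (x - (1/2) *\<^sub>R (m n + m k)))\<^sup>2"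
      by (simp add: power2_norm_eq_inner inner_simps inner_commute algebra_simps)
    with 1 m(2)[of n] m(2)[of k] show ?thesis by (simp only: divide_inverse)
  qed
  have "Cauchy m"
  proof (rule metric_CauchyI)
    fix e :: real assume "0 < e"
    then have "0 < e\<^sup>2 / 4" by simp
    then obtain N where "1 / real (Suc N) < e\<^sup>2 / 4" by (rule nat_approx_posE)
    then have N: "4 / real (Suc N) < e\<^sup>2" by simp
    have "dist (m n) (m k) < e" if "n \<ge> N" "k \<ge> N" for n k
    proof -
      have "2 / real (Suc n) \<le> 2 / real (Suc N)" "2 / real (Suc k) \<le> 2 / real (Suc N)"
        using that by (auto intro!: divide_left_mono)
      then have "(norm (m n - m k))\<^sup>2 < e\<^sup>2" using par[of n k] N by simp
      then show ?thesis unfolding dist_norm using \<open>0 < e\<close> by (simp add: power_less_imp_less_base)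
    qed
    then show "\<exists>N. \<forall>n\<ge>N. \<forall>k\<ge>N. dist (m n) (m k) < e" by blast
  qed
  then obtain p where p: "m \<longlonglongrightarrow> p" using Cauchy_convergent convergent_def by blast
  have pM: "p \<in> M" using closed_sequentially[OF assms(2) _ p] m(1) by blast
  have "(\<lambda>n. (norm (x - m n))\<^sup>2) \<longlonglongrightarrow> (norm (x - p))\<^sup>2" by (intro tendsto_intros p)
  moreover have "(\<lambda>n. d + 1 / real (Suc n)) \<longlonglongrightarrow> d + 0"
    by (intro tendsto_intros LIMSEQ_Suc[OF lim_1_over_n])
  ultimately have "(norm (x - p))\<^sup>2 \<le> d + 0"
    by (rule LIMSEQ_le) (use m(2) less_imp_le in blast)
  then have pd: "(norm (x - p))\<^sup>2 \<le> d" by simp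
  have "inner (x - p) v = 0" if v: "v \<in> M" for v
  proof (cases "v = 0")
    case False
    define t where "t = inner (x - p) v / inner v v"
    have "p + t *\<^sub>R v \<in> M" using pM v assms(1) by (intro subspace_scale subspace_add)
    then have "d \<le> (norm (x - (p + t *\<^sub>R v)))\<^sup>2" by (rule dle)
    with pd have "(norm (x - p))\<^sup>2 \<le> (norm (x - (p + t *\<^sub>R v)))\<^sup>2" by linarith
    also have "\<dots> = (norm (x - p))\<^sup>2 - 2 * t * inner (x - p) v + t\<^sup>2 * inner v v"
      unfolding power2_norm_eq_inner
      by (simp add: inner_simps inner_commute algebra_simps power2_eq_square)
    also have "\<dots> = (norm (x - p))\<^sup>2 - (inner (x - p) v)\<^sup>2 / inner v v"
      using False by (simp add: t_def power2_eq_square)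
    finally have "(inner (x - p) v)\<^sup>2 / inner v v \<le> 0" by simp
    moreover have "0 < inner v v" using False by simp
    ultimately have "(inner (x - p) v)\<^sup>2 \<le> 0" by (simp add: pos_divide_le_eq del: inner_gt_zero_iff)
    then show ?thesis by simp
  qed simp
  with pM show ?thesis by blast
qed

lemma subspace_closure':
  fixes M :: "'a::real_normed_vector set"
  assumes "subspace M"
  shows "subspace (closure M)"
proof (rule subspaceI)
  show "0 \<in> closure M" using subspace_0[OF assms] closure_subset by blast
next
  fix x y assume "x \<in> closure M" "y \<in> closure M"
  then obtain f g where fg: "\<And>n. f n \<in> M" "f \<longlonglongrightarrow> x" "\<And>n. g n \<in> M" "g \<longlonglongrightarrow> y"
    unfolding closure_sequential by blast
  then have "(\<lambda>n. f n + g n) \<longlonglongrightarrow> x + y" "\<And>n. f n + g n \<in> M"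
    using assms by (auto intro: tendsto_add subspace_add)
  then show "x + y \<in> closure M" unfolding closure_sequential by (intro exI[of _ "\<lambda>n. f n + g n"]) blast
next
  fix x and r :: real assume "x \<in> closure M"
  then obtain f where f: "\<And>n. f n \<in> M" "f \<longlonglongrightarrow> x" unfolding closure_sequential by blast
  then have "(\<lambda>n. r *\<^sub>R f n) \<longlonglongrightarrow> r *\<^sub>R x" "\<And>n. r *\<^sub>R f n \<in> M"
    using assms by (auto intro: tendsto_intros subspace_scale)
  then show "r *\<^sub>R x \<in> closure M" unfolding closure_sequential by (intro exI[of _ "\<lambda>n. r *\<^sub>R f n"]) blast
qed

lemma riesz_representation:
  fixes f :: "'a::{real_inner,banach} \<Rightarrow> real"
  assumes "bounded_linear f"
  shows "\<exists>y. \<forall>x. f x = inner x y"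
proof (cases "\<forall>x. f x = 0")
  case True
  then show ?thesis by (intro exI[of _ 0]) simp
next
  case False
  interpret f: bounded_linear f by fact
  define M where "M = {x. f x = 0}"
  have "subspace M" unfolding M_def subspace_def by (simp add: f.add f.scaleR f.zero)
  moreover have "closed M" unfolding M_def
    by (intro closed_Collect_eq continuous_intros linear_continuous_on assms)
  moreover obtain x0 where x0: "f x0 \<noteq> 0" using False by blast
  ultimately obtain p where p: "p \<in> M" "\<And>m. m \<in> M \<Longrightarrow> inner (x0 - p) m = 0"
    using hilbert_projection by blast
  define z where "z = x0 - p"
  have fz: "f z = f x0" using p(1) by (simp add: z_def f.diff M_def)
  then have z0: "z \<noteq> 0" using x0 f.zero by auto
  have "f x = inner x ((f z / inner z z) *\<^sub>R z)" for x
  proof -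
    have "x - (f x / f z) *\<^sub>R z \<in> M" using fz x0 by (simp add: M_def f.diff f.scaleR)
    then have "inner z (x - (f x / f z) *\<^sub>R z) = 0" using p(2) z_def by blast
    then have "inner x z = (f x / f z) * inner z z" by (simp add: inner_simps inner_commute)
    then show ?thesis using z0 fz x0 by (simp add: inner_simps)
  qed
  then show ?thesis by blast
qed

definition adj :: "('a::real_inner \<Rightarrow>\<^sub>L 'b::real_inner) \<Rightarrow> ('b \<Rightarrow>\<^sub>L 'a)" where
  "adj A = Blinfun (adjoint (blinfun_apply A))"

lemma inner_adj:
  fixes A :: "'a::{real_inner,banach} \<Rightarrow>\<^sub>L 'b::real_inner"
  shows "inner (A x) y = inner x (adj A y)"
proof -
  have "\<exists>g. \<forall>x. inner (A x) y = inner x g" for y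
    by (rule riesz_representation)
      (intro bounded_linear_compose[OF bounded_linear_inner_left blinfun.bounded_linear_right])
  then have ex: "\<exists>f'. \<forall>x y. inner (A x) y = inner x (f' y)" by metis
  from someI_ex[OF ex] have ad: "\<And>x y. inner (A x) y = inner x (adjoint (blinfun_apply A) y)"
    unfolding adjoint_def by blast
  have "bounded_linear (adjoint (blinfun_apply A))"
  proof (rule bounded_linear_intro[where K = "norm A"])
    fix y z :: 'b and r :: real
    show "adjoint A (y + z) = adjoint A y + adjoint A z"
      by (rule vector_eq_ldot[THEN iffD1]) (simp add: inner_simps flip: ad)
    show "adjoint A (r *\<^sub>R y) = r *\<^sub>R adjoint A y"
      by (rule vector_eq_ldot[THEN iffD1]) (simp add: inner_simps flip: ad)
    have "(norm (adjoint A y))\<^sup>2 = inner (A (adjoint A y)) y"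
      by (simp add: ad power2_norm_eq_inner)
    also have "\<dots> \<le> norm (A (adjoint A y)) * norm y" by (rule norm_cauchy_schwarz)
    also have "\<dots> \<le> norm A * norm (adjoint A y) * norm y"
      by (intro mult_right_mono norm_blinfun) auto
    finally have "norm (adjoint A y) * norm (adjoint A y) \<le> (norm y * norm A) * norm (adjoint A y)"
      by (simp add: power2_eq_square mult_ac)
    then show "norm (adjoint A y) \<le> norm y * norm A"
      by (cases "norm (adjoint A y) = 0") (auto simp: zero_le_mult_iff dest: mult_right_le_imp_le)
  qed
  then show ?thesis by (simp add: adj_def bounded_linear_Blinfun_apply ad)
qed

lemma inner_adj':
  fixes A :: "'a::{real_inner,banach} \<Rightarrow>\<^sub>L 'b::real_inner"
  shows "inner (adj A y) x = inner y (A x)"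
  by (metis inner_adj inner_commute)

lemma blinfun_eqI_inner:
  fixes A B :: "'a::real_normed_vector \<Rightarrow>\<^sub>L 'b::real_inner"
  assumes "\<And>x y. inner (A x) y = inner (B x) y"
  shows "A = B"
  by (rule blinfun_eqI) (metis assms vector_eq_rdot)

lemma adj_adj: "adj (adj A) = A"
  for A :: "'a::{real_inner,banach} \<Rightarrow>\<^sub>L 'b::{real_inner,banach}"
  by (rule blinfun_eqI_inner) (simp add: inner_adj' inner_adj flip: inner_adj)

lemma adj_add: "adj (A + B) = adj A + adj B"
  for A :: "'a::{real_inner,banach} \<Rightarrow>\<^sub>L 'b::real_inner"
  by (rule blinfun_eqI_inner) (simp add: inner_adj' inner_simps plus_blinfun.rep_eq)

lemma adj_compose: "adj (A o\<^sub>L B) = adj B o\<^sub>L adj A"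
  for A :: "'b::{real_inner,banach} \<Rightarrow>\<^sub>L 'c::real_inner" and B :: "'a::{real_inner,banach} \<Rightarrow>\<^sub>L 'b"
  by (rule blinfun_eqI_inner) (simp add: inner_adj')

lemma norm_adj_le: "norm (adj A) \<le> norm A"
  for A :: "'a::{real_inner,banach} \<Rightarrow>\<^sub>L 'b::real_inner"
proof (rule norm_blinfun_bound)
  fix y
  have "(norm (adj A y))\<^sup>2 = inner (A (adj A y)) y"
    by (simp add: inner_adj power2_norm_eq_inner)
  also have "\<dots> \<le> norm (A (adj A y)) * norm y" by (rule norm_cauchy_schwarz)
  also have "\<dots> \<le> norm A * norm (adj A y) * norm y"
    by (intro mult_right_mono norm_blinfun) auto
  finally have "norm (adj A y) * norm (adj A y) \<le> (norm A * norm y) * norm (adj A y)"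
    by (simp add: power2_eq_square mult_ac)
  then show "norm (adj A y) \<le> norm A * norm y"
    by (cases "norm (adj A y) = 0") (auto simp: zero_le_mult_iff dest: mult_right_le_imp_le)
qed simp

lemma norm_adj: "norm (adj A) = norm A"
  for A :: "'a::{real_inner,banach} \<Rightarrow>\<^sub>L 'b::{real_inner,banach}"
  by (metis adj_adj norm_adj_le antisym)

text \<open>\<open>\<Sigma>(H)\<close> and \<open>\<Sigma>\<^sup>+(H)\<close>.\<close>

definition Sigma_sym :: "('a::real_inner \<Rightarrow>\<^sub>L 'a) set" where
  "Sigma_sym = {A. \<forall>x y. inner (blinfun_apply A x) y = inner x (blinfun_apply A y)}"

definition Sigma_pos :: "('a::real_inner \<Rightarrow>\<^sub>L 'a) set" where
  "Sigma_pos = {A \<in> Sigma_sym. \<forall>x. 0 \<le> inner (blinfun_apply A x) x}"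

lemma Sigma_symD: "A \<in> Sigma_sym \<Longrightarrow> inner (A x) y = inner x (A y)"
  by (simp add: Sigma_sym_def)

lemma Sigma_posD: "A \<in> Sigma_pos \<Longrightarrow> inner (A x) y = inner x (A y)" "A \<in> Sigma_pos \<Longrightarrow> 0 \<le> inner (A x) x"
  by (auto simp: Sigma_pos_def Sigma_sym_def)

lemma pos_cauchy_schwarz:
  assumes "A \<in> Sigma_pos"
  shows "(inner (A x) y)\<^sup>2 \<le> inner (A x) x * inner (A y) y"
proof -
  have q: "0 \<le> inner (A x) x + 2 * t * inner (A x) y + t\<^sup>2 * inner (A y) y" for t
  proof -
    have "0 \<le> inner (A (x + t *\<^sub>R y)) (x + t *\<^sub>R y)" by (rule Sigma_posD(2)[OF assms])
    also have "\<dots> = inner (A x) x + 2 * t * inner (A x) y + t\<^sup>2 * inner (A y) y"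
      by (simp add: blinfun.bilinear_simps inner_simps power2_eq_square Sigma_posD(1)[OF assms, of y x]
          inner_commute[of y] algebra_simps)
    finally show ?thesis .
  qed
  have p: "0 \<le> inner (A x) x" "0 \<le> inner (A y) y" using Sigma_posD(2)[OF assms] by auto
  define a where "a = inner (A x) x"
  define b where "b = inner (A x) y"
  define c where "c = inner (A y) y"
  note q = q[folded a_def b_def c_def] and p = p[folded a_def c_def]
  have "b\<^sup>2 \<le> a * c"
  proof (cases "c = 0")
    case True
    have "b = 0"
    proof (rule ccontr)
      assume "b \<noteq> 0"
      then have "a + 2 * (- (a + 1) / (2 * b)) * b = -1" by (simp add: field_simps)
      with q[of "- (a + 1) / (2 * b)"] True show False by simp
    qed
    then show ?thesis using True by simp
  next
    case False
    with p have "0 < c" by simp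
    with q[of "- b / c"] have "0 \<le> a - b\<^sup>2 / c" by (simp add: power2_eq_square field_simps)
    then show ?thesis using \<open>0 < c\<close> by (simp add: field_simps)
  qed
  then show ?thesis by (simp add: a_def b_def c_def)
qed

lemma pos_inner_eq_0:
  assumes "A \<in> Sigma_pos" "inner (A x) x = 0"
  shows "A x = 0"
  using pos_cauchy_schwarz[OF assms(1), of x "A x"] assms(2) by simp

lemma norm_le_one_pos:
  assumes "A \<in> Sigma_pos" "\<And>x. inner (A x) x \<le> (norm x)\<^sup>2"
  shows "norm A \<le> 1"
proof (rule norm_blinfun_bound)
  fix x
  have "((norm (A x))\<^sup>2)\<^sup>2 \<le> inner (A x) x * inner (A (A x)) (A x)"
    using pos_cauchy_schwarz[OF assms(1), of x "A x"] by (simp add: power2_norm_eq_inner)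
  also have "\<dots> \<le> (norm x)\<^sup>2 * (norm (A x))\<^sup>2"
    by (intro mult_mono assms Sigma_posD) auto
  finally have *: "(norm (A x))\<^sup>2 * (norm (A x))\<^sup>2 \<le> (norm x)\<^sup>2 * (norm (A x))\<^sup>2"
    by (simp add: power2_eq_square)
  have "(norm (A x))\<^sup>2 \<le> (norm x)\<^sup>2"
  proof (cases "norm (A x) = 0")
    case False
    then have "0 < (norm (A x))\<^sup>2" by simp
    with * show ?thesis by (rule mult_right_le_imp_le)
  qed simp
  then show "norm (A x) \<le> 1 * norm x" by simp
qed simp

text \<open>The positive semidefinite square root; it exists and is unique for \<open>A \<in> Sigma_pos\<close>.\<close>

definition sqrt_op :: "('a::real_inner \<Rightarrow>\<^sub>L 'a) \<Rightarrow> ('a \<Rightarrow>\<^sub>L 'a)" where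
  "sqrt_op A = (THE R. R \<in> Sigma_pos \<and> R o\<^sub>L R = A)"

lemma blinfun_compose_simps:
  "(A + B) o\<^sub>L C = (A o\<^sub>L C) + (B o\<^sub>L C)" "C' o\<^sub>L (A' + B') = (C' o\<^sub>L A') + (C' o\<^sub>L B')"
  "(A - B) o\<^sub>L C = (A o\<^sub>L C) - (B o\<^sub>L C)" "C' o\<^sub>L (A' - B') = (C' o\<^sub>L A') - (C' o\<^sub>L B')"
  "(r *\<^sub>R A) o\<^sub>L C = r *\<^sub>R (A o\<^sub>L C)" "C' o\<^sub>L (r *\<^sub>R A') = r *\<^sub>R (C' o\<^sub>L A')"
  by (rule blinfun_eqI; simp add: blinfun.bilinear_simps)+

lemma blinfun_compose_id: "A o\<^sub>L id_blinfun = A" "id_blinfun o\<^sub>L A = A"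
  by (rule blinfun_eqI; simp)+

lemma blinfun_compose_assoc': "(A o\<^sub>L B) o\<^sub>L C = A o\<^sub>L (B o\<^sub>L C)"
  by (rule blinfun_eqI) simp

lemma sqrt_exists_normalized:
  fixes X :: "'a::{real_inner,banach} \<Rightarrow>\<^sub>L 'a"
  assumes nX: "norm X \<le> 1" and sX: "X \<in> Sigma_sym"
  shows "\<exists>R\<in>Sigma_pos. R o\<^sub>L R = id_blinfun - X \<and> (\<forall>C. C o\<^sub>L X = X o\<^sub>L C \<longrightarrow> C o\<^sub>L R = R o\<^sub>L C)"
proof -
  define Y where "Y = rec_nat 0 (\<lambda>_ Z. (1/2) *\<^sub>R (X + (Z o\<^sub>L Z)))"
  define y where "y = rec_nat 0 (\<lambda>_ z. (1/2) * (1 + z * z :: real))"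
  have Y: "Y 0 = 0" "\<And>n. Y (Suc n) = (1/2) *\<^sub>R (X + (Y n o\<^sub>L Y n))" by (auto simp: Y_def)
  have y: "y 0 = 0" "\<And>n. y (Suc n) = (1/2) * (1 + y n * y n)" by (auto simp: y_def)
  have y01: "0 \<le> y n \<and> y n \<le> 1" for n
    by (induction n) (auto simp: y intro: mult_le_one order_trans[OF _ mult_nonneg_nonneg])
  have nY: "norm (Y n) \<le> y n" for n
  proof (induction n)
    case (Suc n)
    have "norm (Y n o\<^sub>L Y n) \<le> norm (Y n) * norm (Y n)" by (rule norm_blinfun_compose)
    also have "\<dots> \<le> y n * y n" using Suc y01 by (intro mult_mono) auto
    finally show ?case using norm_triangle_ineq[of X "Y n o\<^sub>L Y n"] nX by (simp add: Y y)
  qed (simp add: Y y)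
  have dY: "norm (Y (Suc n) - Y n) \<le> y (Suc n) - y n" for n
  proof (induction n)
    case 0
    then show ?case using nX by (simp add: Y y)
  next
    case (Suc n)
    let ?D = "Y (Suc n) - Y n"
    have "Y (Suc (Suc n)) - Y (Suc n) = (1/2) *\<^sub>R ((Y (Suc n) o\<^sub>L Y (Suc n)) - (Y n o\<^sub>L Y n))"
      by (simp only: Y(2)[of "Suc n"] Y(2)[of n]) (simp add: algebra_simps)
    also have "\<dots> = (1/2) *\<^sub>R ((?D o\<^sub>L Y (Suc n)) + (Y n o\<^sub>L ?D))"
      by (simp add: blinfun_compose_simps)
    finally have "norm (Y (Suc (Suc n)) - Y (Suc n)) = (1/2) * norm ((?D o\<^sub>L Y (Suc n)) + (Y n o\<^sub>L ?D))"
      by simp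
    also have "\<dots> \<le> (1/2) * (norm ?D * norm (Y (Suc n)) + norm (Y n) * norm ?D)"
      by (intro mult_left_mono norm_triangle_le add_mono norm_blinfun_compose) auto
    also have "\<dots> \<le> (1/2) * ((y (Suc n) - y n) * y (Suc n) + y n * (y (Suc n) - y n))"
      using Suc nY y01 order_trans[OF norm_ge_zero Suc] by (intro mult_left_mono add_mono mult_mono) auto
    also have "\<dots> = y (Suc (Suc n)) - y (Suc n)"
      by (simp only: y(2)[of "Suc n"] y(2)[of n]) (simp add: algebra_simps)
    finally show ?case .
  qed
  have "summable (\<lambda>n. y (Suc n) - y n)"
  proof (rule telescope_summable)
    have "incseq y" by (rule incseq_SucI) (use order_trans[OF norm_ge_zero dY] in simp)
    then show "y \<longlonglongrightarrow> lim y"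
      using incseq_convergent[of y 1] y01 by (metis convergent_LIMSEQ_iff convergentI)
  qed
  then have "summable (\<lambda>n. Y (Suc n) - Y n)"
    using dY by (intro summable_comparison_test'[of "\<lambda>n. y (Suc n) - y n" 0 "\<lambda>n. Y (Suc n) - Y n"]) auto
  then obtain W where "(\<lambda>n. \<Sum>i<n. Y (Suc i) - Y i) \<longlonglongrightarrow> W"
    unfolding summable_def sums_def by blast
  then have "Y \<longlonglongrightarrow> W" unfolding sum_lessThan_telescope by (simp add: Y(1))
  then obtain Z where Z: "Y \<longlonglongrightarrow> Z" by blast
  have inn: "(\<lambda>n. inner (Y n x) z) \<longlonglongrightarrow> inner (Z x) z" "(\<lambda>n. inner z (Y n x)) \<longlonglongrightarrow> inner z (Z x)" for x z
    by (intro tendsto_intros Z)+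
  have symY: "inner (Y n x) z = inner x (Y n z)" for n x z
    by (induction n arbitrary: x z)
      (simp_all add: Y blinfun.bilinear_simps inner_simps Sigma_symD[OF sX])
  have symZ: "inner (Z x) z = inner x (Z z)" for x z
    using LIMSEQ_unique[OF inn(1)[of x z]] inn(2)[of x z] by (simp add: symY)
  have nZ: "norm Z \<le> 1"
    by (rule LIMSEQ_le_const2[OF tendsto_norm[OF Z]]) (use nY y01 order_trans in blast)
  have "(\<lambda>n. Y (Suc n)) \<longlonglongrightarrow> (1/2) *\<^sub>R (X + (Z o\<^sub>L Z))"
    unfolding Y by (intro tendsto_intros Z bounded_bilinear.tendsto[OF bounded_bilinear_blinfun_compose])
  then have ZZ: "Z = (1/2) *\<^sub>R (X + (Z o\<^sub>L Z))" using LIMSEQ_Suc[OF Z] LIMSEQ_unique by blast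
  define R where "R = id_blinfun - Z"
  have "R o\<^sub>L R = id_blinfun - 2 *\<^sub>R Z + (Z o\<^sub>L Z)"
    by (rule blinfun_eqI) (simp add: R_def blinfun.bilinear_simps scaleR_2)
  also have "2 *\<^sub>R Z = X + (Z o\<^sub>L Z)" by (subst ZZ) simp
  finally have RR: "R o\<^sub>L R = id_blinfun - X" by simp
  have "inner (Z x) x \<le> inner x x" for x
  proof -
    have "inner (Z x) x \<le> norm (Z x) * norm x" by (rule norm_cauchy_schwarz)
    also have "\<dots> \<le> norm Z * norm x * norm x" by (intro mult_right_mono norm_blinfun) auto
    also have "\<dots> \<le> 1 * norm x * norm x" using nZ by (intro mult_right_mono) auto
    finally show ?thesis by (simp add: dot_square_norm power2_eq_square)
  qed
  then have "R \<in> Sigma_pos"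
    by (auto simp: Sigma_pos_def Sigma_sym_def R_def blinfun.bilinear_simps inner_simps symZ)
  moreover have "C o\<^sub>L R = R o\<^sub>L C" if C: "C o\<^sub>L X = X o\<^sub>L C" for C
  proof -
    have CY: "C o\<^sub>L Y n = Y n o\<^sub>L C" for n
    proof (induction n)
      case (Suc n)
      have "C o\<^sub>L (Y n o\<^sub>L Y n) = (Y n o\<^sub>L Y n) o\<^sub>L C"
        using Suc by (metis blinfun_compose_assoc')
      then show ?case using C by (simp add: Y blinfun_compose_simps)
    qed (simp add: Y)
    have "(\<lambda>n. C o\<^sub>L Y n) \<longlonglongrightarrow> (C o\<^sub>L Z)" "(\<lambda>n. Y n o\<^sub>L C) \<longlonglongrightarrow> (Z o\<^sub>L C)"
      by (intro bounded_bilinear.tendsto[OF bounded_bilinear_blinfun_compose] Z tendsto_const)+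
    then have "C o\<^sub>L Z = Z o\<^sub>L C" using CY LIMSEQ_unique by (metis (no_types, lifting) ext)
    then show ?thesis by (simp add: R_def blinfun_compose_simps blinfun_compose_id)
  qed
  ultimately show ?thesis using RR by blast
qed

lemma sqrt_op_exists:
  fixes A :: "'a::{real_inner,banach} \<Rightarrow>\<^sub>L 'a"
  assumes "A \<in> Sigma_pos"
  shows "\<exists>R\<in>Sigma_pos. R o\<^sub>L R = A \<and> (\<forall>C. C o\<^sub>L A = A o\<^sub>L C \<longrightarrow> C o\<^sub>L R = R o\<^sub>L C)"
proof -
  define s where "s = norm A + 1"
  have s: "0 < s" by (simp add: s_def add_pos_nonneg add.commute)
  define X where "X = id_blinfun - (1 / s) *\<^sub>R A"
  have Ax: "inner (A x) x \<le> s * (norm x)\<^sup>2" for x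
  proof -
    have "inner (A x) x \<le> norm (A x) * norm x" by (rule norm_cauchy_schwarz)
    also have "\<dots> \<le> norm A * norm x * norm x" by (intro mult_right_mono norm_blinfun) auto
    also have "\<dots> \<le> s * norm x * norm x" by (intro mult_right_mono) (auto simp: s_def)
    finally show ?thesis by (simp add: power2_eq_square mult.assoc)
  qed
  have iX: "inner (X x) y = inner x y - inner (A x) y / s" for x y
    by (simp add: X_def blinfun.bilinear_simps inner_simps)
  have "inner (X x) y = inner x (X y)" for x y
    by (simp add: X_def blinfun.bilinear_simps inner_simps Sigma_posD(1)[OF assms])
  moreover have "0 \<le> inner (X x) x" for x
    using Ax[of x] s by (simp add: iX dot_square_norm pos_divide_le_eq mult.commute)
  ultimately have Xpos: "X \<in> Sigma_pos" by (simp add: Sigma_pos_def Sigma_sym_def)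
  have "norm X \<le> 1"
    by (rule norm_le_one_pos[OF Xpos])
      (use s Sigma_posD(2)[OF assms] in \<open>simp add: iX dot_square_norm\<close>)
  moreover have "X \<in> Sigma_sym" using Xpos by (simp add: Sigma_pos_def)
  ultimately obtain R where R: "R \<in> Sigma_pos" "R o\<^sub>L R = id_blinfun - X"
      "\<And>C. C o\<^sub>L X = X o\<^sub>L C \<Longrightarrow> C o\<^sub>L R = R o\<^sub>L C"
    using sqrt_exists_normalized[of X] by blast
  have "sqrt s *\<^sub>R R \<in> Sigma_pos"
    using R(1) s by (auto simp: Sigma_pos_def Sigma_sym_def blinfun.bilinear_simps)
  moreover have "(sqrt s *\<^sub>R R) o\<^sub>L (sqrt s *\<^sub>R R) = A"
    using s R(2) by (simp add: blinfun_compose_simps X_def)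
  moreover have "C o\<^sub>L (sqrt s *\<^sub>R R) = (sqrt s *\<^sub>R R) o\<^sub>L C" if "C o\<^sub>L A = A o\<^sub>L C" for C
  proof -
    from that have "C o\<^sub>L X = X o\<^sub>L C" by (simp add: blinfun_compose_simps blinfun_compose_id X_def)
    then show ?thesis using R(3) by (simp add: blinfun_compose_simps)
  qed
  ultimately show ?thesis by blast
qed

lemma sqrt_op_unique:
  fixes A :: "'a::{real_inner,banach} \<Rightarrow>\<^sub>L 'a"
  assumes R: "R \<in> Sigma_pos" "R o\<^sub>L R = A" and R': "R' \<in> Sigma_pos" "R' o\<^sub>L R' = A"
  shows "R = R'"
proof -
  have *: "P = P'" if P: "P \<in> Sigma_pos" "P o\<^sub>L P = A" and P': "P' \<in> Sigma_pos" "P' o\<^sub>L P' = A"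
    and comm: "P o\<^sub>L P' = P' o\<^sub>L P" for P P'
  proof (rule blinfun_eqI)
    fix x
    have c: "P (P' z) = P' (P z)" for z
      by (metis comm blinfun_apply_blinfun_compose)
    have q: "P (P z) = P' (P' z)" for z
      by (metis P(2) P'(2) blinfun_apply_blinfun_compose)
    define u where "u = P x - P' x"
    have "inner (P u) u + inner (P' u) u = 0"
      by (simp add: u_def blinfun.bilinear_simps inner_simps c q flip: inner_add_left)
    then have "inner (P u) u = 0" "inner (P' u) u = 0"
      using Sigma_posD(2)[OF P(1), of u] Sigma_posD(2)[OF P'(1), of u] by linarith+
    then have "P u = 0" "P' u = 0" using pos_inner_eq_0 P(1) P'(1) by blast+
    moreover have "inner u u = inner x (P u) - inner x (P' u)"
      by (simp add: u_def blinfun.bilinear_simps inner_simps Sigma_posD(1)[OF P(1)] Sigma_posD(1)[OF P'(1)])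
    ultimately show "P x = P' x" by (simp add: u_def)
  qed
  have "A \<in> Sigma_pos"
    using R by (auto simp: Sigma_pos_def Sigma_sym_def)
      (metis (no_types) blinfun_apply_blinfun_compose inner_ge_zero)+
  then obtain R0 where R0: "R0 \<in> Sigma_pos" "R0 o\<^sub>L R0 = A" "\<And>C. C o\<^sub>L A = A o\<^sub>L C \<Longrightarrow> C o\<^sub>L R0 = R0 o\<^sub>L C"
    using sqrt_op_exists by blast
  have "R o\<^sub>L A = A o\<^sub>L R" "R' o\<^sub>L A = A o\<^sub>L R'" using R R' by (metis blinfun_compose_assoc')+
  then have "R = R0" "R' = R0" using * R R' R0 by blast+
  then show ?thesis by simp
qed

lemma sqrt_op:
  fixes A :: "'a::{real_inner,banach} \<Rightarrow>\<^sub>L 'a"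
  assumes "A \<in> Sigma_pos"
  shows "sqrt_op A \<in> Sigma_pos" "sqrt_op A o\<^sub>L sqrt_op A = A"
proof -
  have "\<exists>!R. R \<in> Sigma_pos \<and> R o\<^sub>L R = A"
    using sqrt_op_exists[OF assms] sqrt_op_unique by (metis (no_types))
  from theI'[OF this] show "sqrt_op A \<in> Sigma_pos" "sqrt_op A o\<^sub>L sqrt_op A = A"
    by (auto simp: sqrt_op_def)
qed

definition abs_op :: "('a::real_inner \<Rightarrow>\<^sub>L 'a) \<Rightarrow> ('a \<Rightarrow>\<^sub>L 'a)" where
  "abs_op A = sqrt_op (adj A o\<^sub>L A)"

lemma adj_self_pos: "adj A o\<^sub>L A \<in> Sigma_pos"
  for A :: "'a::{real_inner,banach} \<Rightarrow>\<^sub>L 'a"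
  by (auto simp: Sigma_pos_def Sigma_sym_def inner_adj' inner_adj[symmetric])

lemma abs_op:
  fixes A :: "'a::{real_inner,banach} \<Rightarrow>\<^sub>L 'a"
  shows "abs_op A \<in> Sigma_pos" "inner (abs_op A x) (abs_op A y) = inner (A x) (A y)"
    "norm (abs_op A x) = norm (A x)"
proof -
  show 1: "abs_op A \<in> Sigma_pos" unfolding abs_op_def by (rule sqrt_op[OF adj_self_pos])
  show 2: "inner (abs_op A x) (abs_op A y) = inner (A x) (A y)" for x y
  proof -
    have "inner (abs_op A x) (abs_op A y) = inner (abs_op A (abs_op A x)) y"
      by (simp add: Sigma_posD(1)[OF 1])
    also have "\<dots> = inner (adj A (A x)) y"
      by (metis abs_op_def sqrt_op(2)[OF adj_self_pos] blinfun_apply_blinfun_compose)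
    finally show ?thesis by (simp add: inner_adj')
  qed
  show "norm (abs_op A x) = norm (A x)" by (simp add: norm_eq_sqrt_inner 2)
qed

lemma polar_decomposition:
  fixes A :: "'a::{real_inner,banach} \<Rightarrow>\<^sub>L 'a"
  shows "\<exists>V. norm V \<le> 1 \<and> V o\<^sub>L abs_op A = A \<and> adj V o\<^sub>L A = abs_op A"
proof -
  let ?P = "abs_op A"
  define G where "G y z \<longleftrightarrow> (\<exists>x p. (\<lambda>n::nat. ?P (x n)) \<longlonglongrightarrow> p \<and> (\<forall>u. inner (y - p) (?P u) = 0)
      \<and> (\<lambda>n. A (x n)) \<longlonglongrightarrow> z)" for y z
  have lin: "subspace (range ?P)"
    by (simp add: linear_subspace_image blinfun.bounded_linear_right bounded_linear.linear)
  have total: "\<exists>z. G y z" for y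
  proof -
    obtain p where p: "p \<in> closure (range ?P)" "\<And>m. m \<in> closure (range ?P) \<Longrightarrow> inner (y - p) m = 0"
      using hilbert_projection[OF subspace_closure'[OF lin]] by blast
    obtain w where w: "\<And>n. w n \<in> range ?P" "w \<longlonglongrightarrow> p" using p(1) closure_sequential by blast
    from w(1) have "\<forall>n. \<exists>x. w n = ?P x" by (simp add: image_iff)
    from choice[OF this] obtain x where x: "\<And>n. w n = ?P (x n)" by blast
    have wx: "w = (\<lambda>n. ?P (x n))" using x by auto
    have "Cauchy w" using w(2) LIMSEQ_imp_Cauchy by blast
    then have "Cauchy (\<lambda>n. A (x n))"
      by (simp add: Cauchy_def dist_norm wx abs_op(3) flip: blinfun.diff_right)
    then obtain z where "(\<lambda>n. A (x n)) \<longlonglongrightarrow> z" using Cauchy_convergent convergent_def by blast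
    then show ?thesis unfolding G_def using w(2) p(2) closure_subset unfolding wx by blast
  qed
  have Gadd: "G (y + y') (z + z')" if gs: "G y z" "G y' z'" for y y' z z'
  proof -
    from gs(1) obtain x p where 1: "(\<lambda>n. ?P (x n)) \<longlonglongrightarrow> p" "\<And>u. inner (y - p) (?P u) = 0" "(\<lambda>n. A (x n)) \<longlonglongrightarrow> z"
      unfolding G_def by blast
    from gs(2) obtain x' p' where 2: "(\<lambda>n. ?P (x' n)) \<longlonglongrightarrow> p'" "\<And>u. inner (y' - p') (?P u) = 0" "(\<lambda>n. A (x' n)) \<longlonglongrightarrow> z'"
      unfolding G_def by blast
    have "inner (y + y' - (p + p')) (?P u) = 0" for u
      using 1(2)[of u] 2(2)[of u] by (simp add: inner_simps)
    moreover have "(\<lambda>n. ?P (x n + x' n)) \<longlonglongrightarrow> p + p'" "(\<lambda>n. A (x n + x' n)) \<longlonglongrightarrow> z + z'"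
      unfolding blinfun.add_right by (intro tendsto_add 1 2)+
    ultimately show ?thesis unfolding G_def by (intro exI[of _ "\<lambda>n. x n + x' n"] exI[of _ "p + p'"]) blast
  qed
  have Gscale: "G (r *\<^sub>R y) (r *\<^sub>R z)" if gs: "G y z" for y z r
  proof -
    from gs obtain x p where 1: "(\<lambda>n. ?P (x n)) \<longlonglongrightarrow> p" "\<And>u. inner (y - p) (?P u) = 0" "(\<lambda>n. A (x n)) \<longlonglongrightarrow> z"
      unfolding G_def by blast
    have "inner (r *\<^sub>R y - r *\<^sub>R p) (?P u) = 0" for u
      using 1(2)[of u] by (simp add: inner_simps flip: scaleR_diff_right)
    moreover have "(\<lambda>n. ?P (r *\<^sub>R x n)) \<longlonglongrightarrow> r *\<^sub>R p" "(\<lambda>n. A (r *\<^sub>R x n)) \<longlonglongrightarrow> r *\<^sub>R z"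
      unfolding blinfun.scaleR_right by (intro tendsto_intros 1)+
    ultimately show ?thesis unfolding G_def by (intro exI[of _ "\<lambda>n. r *\<^sub>R x n"] exI[of _ "r *\<^sub>R p"]) blast
  qed
  have Gnorm: "norm z \<le> norm y" if gs: "G y z" for y z
  proof -
    from gs obtain x p where 1: "(\<lambda>n. ?P (x n)) \<longlonglongrightarrow> p" "\<And>u. inner (y - p) (?P u) = 0" "(\<lambda>n. A (x n)) \<longlonglongrightarrow> z"
      unfolding G_def by blast
    have "norm z = norm p"
      using tendsto_norm[OF 1(1)] tendsto_norm[OF 1(3)] LIMSEQ_unique by (auto simp: abs_op(3))
    moreover have "(\<lambda>n. inner (y - p) (?P (x n))) \<longlonglongrightarrow> inner (y - p) p" by (intro tendsto_intros 1)
    then have "inner (y - p) p = 0" by (simp add: 1(2) LIMSEQ_const_iff)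
    then have "(norm y)\<^sup>2 = (norm p)\<^sup>2 + (norm (y - p))\<^sup>2"
      by (simp add: power2_norm_eq_inner inner_simps inner_commute)
    then have "norm p \<le> norm y" by (simp add: norm_le_square power2_norm_eq_inner power2_le_imp_le)
    ultimately show ?thesis by simp
  qed
  have Guniq: "z = z'" if "G y z" "G y z'" for y z z'
    using Gnorm[OF Gadd[OF that(1) Gscale[OF that(2), of "-1"]]] by simp
  define v where "v y = (THE z. G y z)" for y
  have Gv: "G y (v y)" for y unfolding v_def by (rule theI') (use total Guniq in blast)
  have "bounded_linear v"
  proof (rule bounded_linear_intro[where K = 1])
    show "v (y + z) = v y + v z" for y z by (rule Guniq[OF Gv Gadd[OF Gv Gv]])
    show "v (r *\<^sub>R y) = r *\<^sub>R v y" for r y by (rule Guniq[OF Gv Gscale[OF Gv]])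
    show "norm (v y) \<le> norm y * 1" for y using Gnorm[OF Gv] by simp
  qed
  then have vV: "blinfun_apply (Blinfun v) = v" by (rule bounded_linear_Blinfun_apply)
  let ?V = "Blinfun v"
  have "norm ?V \<le> 1" by (rule norm_blinfun_bound) (auto simp: vV Gnorm[OF Gv])
  moreover have "?V o\<^sub>L ?P = A"
  proof (rule blinfun_eqI)
    fix u
    have "G (?P u) (A u)" unfolding G_def by (intro exI[of _ "\<lambda>_. u"] exI[of _ "?P u"]) auto
    then show "(?V o\<^sub>L ?P) u = A u" using Guniq Gv by (auto simp: vV)
  qed
  moreover have "adj ?V o\<^sub>L A = ?P"
  proof (rule blinfun_eqI_inner)
    fix u y
    obtain x p where 1: "(\<lambda>n. ?P (x n)) \<longlonglongrightarrow> p" "\<And>u. inner (y - p) (?P u) = 0" "(\<lambda>n. A (x n)) \<longlonglongrightarrow> v y"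
      using Gv[of y] unfolding G_def by blast
    have "(\<lambda>n. inner (A u) (A (x n))) \<longlonglongrightarrow> inner (A u) (v y)" by (intro tendsto_intros 1)
    moreover have "(\<lambda>n. inner (?P u) (?P (x n))) \<longlonglongrightarrow> inner (?P u) p" by (intro tendsto_intros 1)
    ultimately have "inner (A u) (v y) = inner (?P u) p" unfolding abs_op(2) by (rule LIMSEQ_unique)
    also have "\<dots> = inner (?P u) y" using 1(2)[of u] by (simp add: inner_simps inner_commute)
    finally show "inner ((adj ?V o\<^sub>L A) u) y = inner (?P u) y" by (simp add: inner_adj' vV)
  qed
  ultimately show ?thesis by (intro exI[of _ ?V] conjI)
qed

text \<open>
  Orthonormal bases of a Hilbert space given by a carrier \<open>V\<close> and an inner product \<open>ip\<close> on it.
  The explicit carrier is needed for \<open>U\<^sub>0 = Q\<^sup>1\<^sup>/\<^sup>2(U)\<close>, whose inner product is not that of \<open>U\<close>;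
  an ordinary space is the case \<open>V = UNIV\<close>, \<open>ip = inner\<close>. Traces and Hilbert-Schmidt norms do not
  depend on the basis, so they are computed in one arbitrarily chosen basis \<open>onb V ip\<close>.
\<close>

definition is_onb :: "'a::real_vector set \<Rightarrow> ('a \<Rightarrow> 'a \<Rightarrow> real) \<Rightarrow> 'a set \<Rightarrow> bool" where
  "is_onb V ip E \<longleftrightarrow> E \<subseteq> V \<and> (\<forall>e\<in>E. \<forall>f\<in>E. ip e f = (if e = f then 1 else 0)) \<and>
     (\<forall>v\<in>V. (\<forall>e\<in>E. ip v e = 0) \<longrightarrow> v = 0)"

definition onb :: "'a::real_vector set \<Rightarrow> ('a \<Rightarrow> 'a \<Rightarrow> real) \<Rightarrow> 'a set" where
  "onb V ip = (SOME E. is_onb V ip E)"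

lemma onb_UNIV: "is_onb UNIV inner (onb UNIV inner :: 'a::real_inner set)"
proof -
  define OS where "OS = {E :: 'a set. \<forall>e\<in>E. \<forall>f\<in>E. inner e f = (if e = f then 1 else 0)}"
  have "\<exists>M\<in>OS. \<forall>X\<in>OS. M \<subseteq> X \<longrightarrow> X = M"
  proof (rule subset_Zorn')
    fix C assume C: "subset.chain OS C"
    show "\<Union>C \<in> OS"
      unfolding OS_def
    proof (intro CollectI ballI)
      fix e f assume "e \<in> \<Union>C" "f \<in> \<Union>C"
      then obtain X Y where XY: "X \<in> C" "e \<in> X" "Y \<in> C" "f \<in> Y" by blast
      then have "X \<subseteq> Y \<or> Y \<subseteq> X" "X \<in> OS" "Y \<in> OS" using C by (auto simp: subset_chain_def)
      then obtain Z where "Z \<in> OS" "e \<in> Z" "f \<in> Z" using XY by blast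
      then show "inner e f = (if e = f then 1 else 0)" by (simp add: OS_def)
    qed
  qed
  then obtain M where M: "M \<in> OS" "\<And>X. X \<in> OS \<Longrightarrow> M \<subseteq> X \<Longrightarrow> X = M" by blast
  have "v = 0" if v: "\<forall>e\<in>M. inner v e = 0" for v
  proof (rule ccontr)
    assume "v \<noteq> 0"
    then have "inner (sgn v) (sgn v) = 1" by (simp add: dot_square_norm norm_sgn)
    moreover have "inner (sgn v) e = 0" "inner e (sgn v) = 0" if "e \<in> M" for e
      using v that by (simp_all add: sgn_div_norm inner_commute)
    ultimately have "insert (sgn v) M \<in> OS" using M(1) unfolding OS_def by (auto; metis)
    then have "sgn v \<in> M" using M(2) by blast
    then have "inner v (sgn v) = 0" using v by blast
    then show False using \<open>v \<noteq> 0\<close> by (simp add: sgn_div_norm)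
  qed
  then have "is_onb UNIV inner M" using M(1) by (auto simp: is_onb_def OS_def)
  then show ?thesis unfolding onb_def by (rule someI)
qed

abbreviation ob :: "'a::real_inner set" where "ob \<equiv> onb UNIV inner"

lemma ob_inner: "e \<in> ob \<Longrightarrow> f \<in> ob \<Longrightarrow> inner e f = (if e = f then 1 else 0)"
  using onb_UNIV unfolding is_onb_def by blast

lemma ob_total: "(\<And>e. e \<in> ob \<Longrightarrow> inner v e = 0) \<Longrightarrow> v = 0"
  using onb_UNIV unfolding is_onb_def by blast

lemma ob_proj_orth:
  assumes "finite G" "G \<subseteq> ob" "w \<in> span G"
  shows "inner (x - (\<Sum>e\<in>G. inner x e *\<^sub>R e)) w = 0"
proof -
  let ?z = "x - (\<Sum>e\<in>G. inner x e *\<^sub>R e)"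
  have "inner ?z e = 0" if "e \<in> G" for e
  proof -
    have "inner (\<Sum>f\<in>G. inner x f *\<^sub>R f) e = (\<Sum>f\<in>G. if f = e then inner x e else 0)"
      unfolding inner_sum_left by (rule sum.cong) (use that assms(2) in \<open>auto simp: subset_iff ob_inner\<close>)
    then show ?thesis using that assms(1) by (simp add: inner_simps)
  qed
  then have "G \<subseteq> {w. inner ?z w = 0}" by blast
  moreover have "subspace {w. inner ?z w = 0}" by (simp add: subspace_def inner_simps)
  ultimately have "span G \<subseteq> {w. inner ?z w = 0}" by (rule span_minimal)
  then show ?thesis using assms(3) by blast
qed

lemma has_sum_metric:
  fixes f :: "'a \<Rightarrow> 'b::{metric_space,comm_monoid_add}"
  shows "(f has_sum l) A \<longleftrightarrow> (\<forall>r>0. \<exists>X. finite X \<and> X \<subseteq> A \<and>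
    (\<forall>Y. finite Y \<and> X \<subseteq> Y \<and> Y \<subseteq> A \<longrightarrow> dist (sum f Y) l < r))"
  unfolding has_sum_def tendsto_iff eventually_finite_subsets_at_top by blast

lemma ob_expansion:
  fixes x :: "'a::{real_inner,banach}"
  shows "((\<lambda>e. inner x e *\<^sub>R e) has_sum x) ob"
  unfolding has_sum_metric
proof (intro allI impI)
  fix r :: real assume "0 < r"
  obtain p where p: "p \<in> closure (span (ob::'a set))" "\<And>m. m \<in> closure (span ob) \<Longrightarrow> inner (x - p) m = 0"
    using hilbert_projection[OF subspace_closure'[OF subspace_span[of ob]]] by blast
  have "inner (x - p) e = 0" if "e \<in> ob" for e
    by (rule p(2)) (use that closure_subset span_superset in blast)
  then have "x - p = 0" by (rule ob_total)
  then have "x \<in> closure (span ob)" using p(1) by simp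
  then obtain y where y: "y \<in> span ob" "dist y x < r"
    using \<open>0 < r\<close> closure_approachable by blast
  then obtain t c where t: "finite t" "t \<subseteq> ob" "y = (\<Sum>a\<in>t. c a *\<^sub>R a)"
    unfolding span_explicit by blast
  have "dist (\<Sum>e\<in>G. inner x e *\<^sub>R e) x < r" if G: "finite G" "t \<subseteq> G" "G \<subseteq> ob" for G
  proof -
    let ?z = "\<Sum>e\<in>G. inner x e *\<^sub>R e"
    have "y \<in> span G" unfolding t(3) using G(2) by (intro span_sum span_scale span_base) blast
    moreover have "?z \<in> span G" by (intro span_sum span_scale span_base)
    ultimately have "inner (x - ?z) (?z - y) = 0"
      using ob_proj_orth[OF G(1) G(3)] span_diff by blast
    then have "(norm ((x - ?z) + (?z - y)))\<^sup>2 = (norm (x - ?z))\<^sup>2 + (norm (?z - y))\<^sup>2"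
      by (intro norm_add_Pythagorean) (simp add: orthogonal_def)
    then have "(norm (x - ?z))\<^sup>2 \<le> (norm (x - y))\<^sup>2" by simp
    then have "norm (x - ?z) \<le> norm (x - y)" by simp
    then show ?thesis using y(2) by (simp add: dist_norm norm_minus_commute)
  qed
  then show "\<exists>X. finite X \<and> X \<subseteq> ob \<and> (\<forall>Y. finite Y \<and> X \<subseteq> Y \<and> Y \<subseteq> ob \<longrightarrow> dist (\<Sum>e\<in>Y. inner x e *\<^sub>R e) x < r)"
    using t by blast
qed

lemma ob_parseval:
  fixes x :: "'a::{real_inner,banach}"
  shows "((\<lambda>e. (inner x e)\<^sup>2) has_sum (norm x)\<^sup>2) ob"
  using has_sum_bounded_linear[OF bounded_linear_inner_right[of x] ob_expansion[of x]]
  by (simp add: o_def power2_eq_square power2_norm_eq_inner flip: power2_norm_eq_inner)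

lemma ob_bessel:
  fixes x :: "'a::{real_inner,banach}"
  assumes "finite F" "F \<subseteq> ob"
  shows "(\<Sum>e\<in>F. (inner x e)\<^sup>2) \<le> (norm x)\<^sup>2"
  by (rule finite_sum_le_has_sum[OF ob_parseval assms(1)]) (use assms in auto)

lemma has_sum_finite_sum:
  fixes f :: "'i \<Rightarrow> 'a \<Rightarrow> 'b::{topological_comm_monoid_add}"
  assumes "finite I" "\<And>i. i \<in> I \<Longrightarrow> (f i has_sum s i) A"
  shows "((\<lambda>x. \<Sum>i\<in>I. f i x) has_sum (\<Sum>i\<in>I. s i)) A"
  using assms by (induction I) (auto intro: has_sum_add)

lemma hs_adj_le:
  fixes X :: "'a::{real_inner,banach} \<Rightarrow>\<^sub>L 'b::{real_inner,banach}" and W :: "'c::{real_inner,banach} \<Rightarrow>\<^sub>L 'b"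
  assumes X: "((\<lambda>f. (norm (X f))\<^sup>2) has_sum s) ob" and F: "finite F" "F \<subseteq> ob"
  shows "(\<Sum>e\<in>F. (norm (adj X (W e)))\<^sup>2) \<le> (norm W)\<^sup>2 * s"
proof (rule has_sum_mono)
  show "((\<lambda>f. \<Sum>e\<in>F. (inner (adj X (W e)) f)\<^sup>2) has_sum (\<Sum>e\<in>F. (norm (adj X (W e)))\<^sup>2)) ob"
    by (intro has_sum_finite_sum F ob_parseval)
  show "((\<lambda>f. (norm W)\<^sup>2 * (norm (X f))\<^sup>2) has_sum (norm W)\<^sup>2 * s) ob"
    by (intro has_sum_cmult_right X)
  fix f
  have "(\<Sum>e\<in>F. (inner (adj X (W e)) f)\<^sup>2) = (\<Sum>e\<in>F. (inner (adj W (X f)) e)\<^sup>2)"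
    by (simp add: inner_adj') (simp add: inner_commute)
  also have "\<dots> \<le> (norm (adj W (X f)))\<^sup>2" by (rule ob_bessel[OF F])
  also have "\<dots> \<le> (norm W * norm (X f))\<^sup>2"
    using norm_blinfun[of "adj W" "X f"] by (intro power_mono) (simp_all add: norm_adj)
  finally show "(\<Sum>e\<in>F. (inner (adj X (W e)) f)\<^sup>2) \<le> (norm W)\<^sup>2 * (norm (X f))\<^sup>2"
    by (simp add: power_mult_distrib)
qed

lemma has_sum_le_bound:
  fixes f :: "'a \<Rightarrow> real"
  assumes "\<And>x. x \<in> A \<Longrightarrow> 0 \<le> f x" "\<And>F. finite F \<Longrightarrow> F \<subseteq> A \<Longrightarrow> sum f F \<le> s"
  shows "f summable_on A" "infsum f A \<le> s"
proof -
  show 1: "f summable_on A"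
    by (rule nonneg_bdd_above_summable_on) (use assms in \<open>auto intro!: bdd_aboveI[of _ s]\<close>)
  show "infsum f A \<le> s" by (rule infsum_le_finite_sums[OF 1]) (use assms in auto)
qed

lemma hs_adj:
  fixes X :: "'a::{real_inner,banach} \<Rightarrow>\<^sub>L 'b::{real_inner,banach}" and W :: "'c::{real_inner,banach} \<Rightarrow>\<^sub>L 'b"
  assumes X: "((\<lambda>f. (norm (X f))\<^sup>2) has_sum s) ob"
  shows "(\<lambda>e. (norm (adj X (W e)))\<^sup>2) summable_on ob" "infsum (\<lambda>e. (norm (adj X (W e)))\<^sup>2) ob \<le> (norm W)\<^sup>2 * s"
proof -
  show "(\<lambda>e. (norm (adj X (W e)))\<^sup>2) summable_on ob"
    by (rule has_sum_le_bound(1)[OF _ hs_adj_le[OF X]]) simp_all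
  show "infsum (\<lambda>e. (norm (adj X (W e)))\<^sup>2) ob \<le> (norm W)\<^sup>2 * s"
    by (rule has_sum_le_bound(2)[OF _ hs_adj_le[OF X]]) simp_all
qed

lemma norm_le_hs:
  fixes X :: "'a::{real_inner,banach} \<Rightarrow>\<^sub>L 'b::{real_inner,banach}"
  assumes X: "((\<lambda>f. (norm (X f))\<^sup>2) has_sum s) ob"
  shows "norm X \<le> sqrt s"
proof -
  have s: "0 \<le> s" by (rule has_sum_nonneg[OF X]) simp
  have "norm (adj X) \<le> sqrt s"
  proof (rule norm_blinfun_bound)
    fix z
    have "(norm (adj X z))\<^sup>2 \<le> (norm z)\<^sup>2 * s"
    proof (rule has_sum_mono[OF ob_parseval has_sum_cmult_right[OF X]])
      fix e
      have "\<bar>inner (adj X z) e\<bar> \<le> norm z * norm (X e)"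
        unfolding inner_adj' by (rule Cauchy_Schwarz_ineq2)
      then show "(inner (adj X z) e)\<^sup>2 \<le> (norm z)\<^sup>2 * (norm (X e))\<^sup>2"
        by (metis abs_ge_zero power2_abs power_mono power_mult_distrib)
    qed
    then show "norm (adj X z) \<le> sqrt s * norm z"
      by (metis norm_ge_zero real_sqrt_le_mono real_sqrt_mult real_sqrt_abs abs_of_nonneg mult.commute)
  qed (use s in simp)
  then show ?thesis by (simp add: norm_adj)
qed

lemma product_trace_le:
  fixes X :: "'b::{real_inner,banach} \<Rightarrow>\<^sub>L 'a::{real_inner,banach}" and Y :: "'a \<Rightarrow>\<^sub>L 'b"
    and W :: "'a \<Rightarrow>\<^sub>L 'a"
  assumes X: "((\<lambda>f. (norm (X f))\<^sup>2) has_sum s) ob" and Y: "((\<lambda>f. (norm (Y f))\<^sup>2) has_sum r) ob"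
    and W: "norm W \<le> 1" and F: "finite F" "F \<subseteq> ob"
  shows "(\<Sum>e\<in>F. \<bar>inner (W (X (Y e))) e\<bar>) \<le> sqrt s * sqrt r"
proof -
  have s: "0 \<le> s" "0 \<le> r" using has_sum_nonneg[OF X] has_sum_nonneg[OF Y] by auto
  have "\<bar>inner (W (X (Y e))) e\<bar> \<le> \<bar>norm (adj X (adj W e))\<bar> * \<bar>norm (Y e)\<bar>" for e
  proof -
    have "inner (W (X (Y e))) e = inner (adj X (adj W e)) (Y e)"
      by (simp add: inner_adj')  (simp add: inner_commute)
    then show ?thesis using Cauchy_Schwarz_ineq2 by simp
  qed
  then have "(\<Sum>e\<in>F. \<bar>inner (W (X (Y e))) e\<bar>) \<le> (\<Sum>e\<in>F. \<bar>norm (adj X (adj W e))\<bar> * \<bar>norm (Y e)\<bar>)"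
    by (rule sum_mono)
  also have "\<dots> \<le> L2_set (\<lambda>e. norm (adj X (adj W e))) F * L2_set (\<lambda>e. norm (Y e)) F"
    by (rule L2_set_mult_ineq)
  also have "\<dots> \<le> sqrt s * sqrt r"
    unfolding L2_set_def
  proof (intro mult_mono real_sqrt_le_mono)
    have "(norm (adj W))\<^sup>2 \<le> 1" using W by (simp add: norm_adj power_le_one)
    then have "(norm (adj W))\<^sup>2 * s \<le> 1 * s" using s by (intro mult_right_mono)
    then show "(\<Sum>e\<in>F. (norm (adj X (adj W e)))\<^sup>2) \<le> s"
      using hs_adj_le[OF X F, of "adj W"] by linarith
    show "(\<Sum>e\<in>F. (norm (Y e))\<^sup>2) \<le> r"
      by (rule finite_sum_le_has_sum[OF Y F(1)]) (use F in auto)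
  qed (use s in \<open>auto intro: sum_nonneg\<close>)
  finally show ?thesis .
qed

text \<open>\<open>A\<close> is trace class iff \<open>tr |A| < \<infinity>\<close>, where \<open>|A| = (A\<^sup>*A)\<^sup>1\<^sup>/\<^sup>2\<close>; the norm of \<open>L\<^sub>1(H)\<close> is \<open>tr |A|\<close>.\<close>

definition trace_class_op :: "('a::real_inner \<Rightarrow>\<^sub>L 'a) \<Rightarrow> bool" where
  "trace_class_op A \<longleftrightarrow> (\<lambda>e. inner (abs_op A e) e) summable_on onb UNIV inner"

definition trace_norm :: "('a::real_inner \<Rightarrow>\<^sub>L 'a) \<Rightarrow> real" where
  "trace_norm A = (\<Sum>\<^sub>\<infinity>e\<in>onb UNIV inner. inner (abs_op A e) e)"

lemma trace_norm_nonneg: "0 \<le> trace_norm A"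
  for A :: "'a::{real_inner,banach} \<Rightarrow>\<^sub>L 'a"
  unfolding trace_norm_def by (rule infsum_nonneg) (rule Sigma_posD(2)[OF abs_op(1)])

lemma trace_class_boundI:
  fixes A :: "'a::{real_inner,banach} \<Rightarrow>\<^sub>L 'a"
  assumes "\<And>W F. norm W \<le> 1 \<Longrightarrow> finite F \<Longrightarrow> F \<subseteq> ob \<Longrightarrow> (\<Sum>e\<in>F. \<bar>inner (blinfun_apply W (A e)) e\<bar>) \<le> s"
  shows "trace_class_op A" "trace_norm A \<le> s"
proof -
  obtain V where V: "norm V \<le> 1" "adj V o\<^sub>L A = abs_op A" using polar_decomposition by blast
  have eq: "inner (abs_op A e) e = \<bar>inner (adj V (A e)) e\<bar>" for e
    using Sigma_posD(2)[OF abs_op(1)[of A], of e] unfolding V(2)[symmetric] by simp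
  have b: "(\<Sum>e\<in>F. inner (abs_op A e) e) \<le> s" if "finite F" "F \<subseteq> ob" for F
    unfolding eq using assms[OF _ that, of "adj V"] V(1) by (simp add: norm_adj)
  show "trace_class_op A" "trace_norm A \<le> s"
    unfolding trace_class_op_def trace_norm_def
    by (rule has_sum_le_bound[OF Sigma_posD(2)[OF abs_op(1)] b]; simp)+
qed

lemma trace_class_product:
  fixes X :: "'b::{real_inner,banach} \<Rightarrow>\<^sub>L 'a::{real_inner,banach}" and Y :: "'a \<Rightarrow>\<^sub>L 'b"
  assumes X: "((\<lambda>f. (norm (X f))\<^sup>2) has_sum s) ob" and Y: "((\<lambda>f. (norm (Y f))\<^sup>2) has_sum r) ob"
  shows "trace_class_op (X o\<^sub>L Y)" "trace_norm (X o\<^sub>L Y) \<le> sqrt s * sqrt r"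
proof -
  have "(\<Sum>e\<in>F. \<bar>inner (blinfun_apply W ((X o\<^sub>L Y) e)) e\<bar>) \<le> sqrt s * sqrt r"
    if "norm W \<le> 1" "finite F" "F \<subseteq> ob" for W :: "'a \<Rightarrow>\<^sub>L 'a" and F
    using product_trace_le[OF X Y that] by simp
  then show "trace_class_op (X o\<^sub>L Y)" "trace_norm (X o\<^sub>L Y) \<le> sqrt s * sqrt r"
    by (rule trace_class_boundI; blast)+
qed

lemma trace_class_factor:
  fixes A :: "'a::{real_inner,banach} \<Rightarrow>\<^sub>L 'a"
  assumes "trace_class_op A"
  shows "\<exists>X Y s. A = X o\<^sub>L Y \<and> ((\<lambda>f. (norm (blinfun_apply X f))\<^sup>2) has_sum s) ob \<and> s \<le> trace_norm A \<and>
    ((\<lambda>f. (norm (blinfun_apply (Y :: 'a \<Rightarrow>\<^sub>L 'a) f))\<^sup>2) has_sum trace_norm A) ob"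
proof -
  obtain V where V: "norm V \<le> 1" "V o\<^sub>L abs_op A = A" using polar_decomposition by blast
  define R where "R = sqrt_op (abs_op A)"
  have R: "R \<in> Sigma_pos" "R o\<^sub>L R = abs_op A" unfolding R_def by (rule sqrt_op[OF abs_op(1)])+
  have nR: "inner (abs_op A e) e = (norm (R e))\<^sup>2" for e
    by (simp add: R(2)[symmetric] power2_norm_eq_inner Sigma_posD(1)[OF R(1), of "R e"])
  have Y: "((\<lambda>f. (norm (R f))\<^sup>2) has_sum trace_norm A) ob"
    using has_sum_infsum[OF assms[unfolded trace_class_op_def]] unfolding trace_norm_def nR .
  have le: "(norm ((V o\<^sub>L R) e))\<^sup>2 \<le> (norm (R e))\<^sup>2" for e
  proof (rule power_mono)
    have "norm (V (R e)) \<le> norm V * norm (R e)" by (rule norm_blinfun)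
    also have "\<dots> \<le> 1 * norm (R e)" using V by (intro mult_right_mono) auto
    finally show "norm ((V o\<^sub>L R) e) \<le> norm (R e)" by simp
  qed simp
  have "(\<lambda>e. (norm ((V o\<^sub>L R) e))\<^sup>2) summable_on ob"
    by (rule summable_on_comparison_test[OF has_sum_imp_summable[OF Y]]) (use le in auto)
  then have X: "((\<lambda>e. (norm ((V o\<^sub>L R) e))\<^sup>2) has_sum infsum (\<lambda>e. (norm ((V o\<^sub>L R) e))\<^sup>2) ob) ob"
    by (rule has_sum_infsum)
  moreover have "infsum (\<lambda>e. (norm ((V o\<^sub>L R) e))\<^sup>2) ob \<le> trace_norm A"
    by (rule has_sum_mono[OF X Y le])
  moreover have "A = (V o\<^sub>L R) o\<^sub>L R" by (simp add: blinfun_compose_assoc' R V)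
  ultimately show ?thesis using Y by blast
qed

lemma trace_class_sum_le:
  fixes A :: "'a::{real_inner,banach} \<Rightarrow>\<^sub>L 'a"
  assumes "trace_class_op A" "norm W \<le> 1" "finite F" "F \<subseteq> ob"
  shows "(\<Sum>e\<in>F. \<bar>inner (blinfun_apply W (A e)) e\<bar>) \<le> trace_norm A"
proof -
  obtain X Y s where XY: "A = X o\<^sub>L Y" "((\<lambda>f. (norm (blinfun_apply X f))\<^sup>2) has_sum s) ob" "s \<le> trace_norm A"
    "((\<lambda>f. (norm (blinfun_apply (Y :: 'a \<Rightarrow>\<^sub>L 'a) f))\<^sup>2) has_sum trace_norm A) ob"
    using trace_class_factor[OF assms(1)] by blast
  have "(\<Sum>e\<in>F. \<bar>inner (blinfun_apply W (A e)) e\<bar>) \<le> sqrt s * sqrt (trace_norm A)"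
    using product_trace_le[OF XY(2,4) assms(2-4)] by (simp add: XY(1))
  also have "\<dots> \<le> sqrt (trace_norm A) * sqrt (trace_norm A)"
    using XY(3) trace_norm_nonneg by (intro mult_right_mono) auto
  finally show ?thesis using trace_norm_nonneg[of A] by simp
qed

lemma norm_le_trace_norm:
  fixes A :: "'a::{real_inner,banach} \<Rightarrow>\<^sub>L 'a"
  assumes "trace_class_op A"
  shows "norm A \<le> trace_norm A"
proof -
  obtain X Y s where XY: "A = X o\<^sub>L Y" "((\<lambda>f. (norm (blinfun_apply X f))\<^sup>2) has_sum s) ob" "s \<le> trace_norm A"
    "((\<lambda>f. (norm (blinfun_apply (Y :: 'a \<Rightarrow>\<^sub>L 'a) f))\<^sup>2) has_sum trace_norm A) ob"
    using trace_class_factor[OF assms(1)] by blast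
  have "norm A \<le> norm X * norm Y" unfolding XY(1) by (rule norm_blinfun_compose)
  also have "\<dots> \<le> sqrt (trace_norm A) * sqrt (trace_norm A)"
    using norm_le_hs[OF XY(2)] norm_le_hs[OF XY(4)] XY(3)
    by (intro mult_mono) (auto simp: trace_norm_nonneg intro: order_trans real_sqrt_le_mono)
  finally show ?thesis using trace_norm_nonneg[of A] by simp
qed

lemma trace_class_compose:
  fixes A :: "'a::{real_inner,banach} \<Rightarrow>\<^sub>L 'a" and C :: "'a \<Rightarrow>\<^sub>L 'b::{real_inner,banach}" and D :: "'b \<Rightarrow>\<^sub>L 'a"
  assumes "trace_class_op A"
  shows "trace_class_op (C o\<^sub>L A o\<^sub>L D)" "trace_norm (C o\<^sub>L A o\<^sub>L D) \<le> norm C * trace_norm A * norm D"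
proof -
  obtain X Y s where XY: "A = X o\<^sub>L Y" "((\<lambda>f. (norm (blinfun_apply X f))\<^sup>2) has_sum s) ob" "s \<le> trace_norm A"
    "((\<lambda>f. (norm (blinfun_apply (Y :: 'a \<Rightarrow>\<^sub>L 'a) f))\<^sup>2) has_sum trace_norm A) ob"
    using trace_class_factor[OF assms(1)] by blast
  let ?t = "trace_norm A"
  have le: "(norm ((C o\<^sub>L X) e))\<^sup>2 \<le> (norm C)\<^sup>2 * (norm (X e))\<^sup>2" for e
    using norm_blinfun[of C "X e"] by (metis blinfun_apply_blinfun_compose norm_ge_zero power_mono power_mult_distrib)
  have "(\<lambda>e. (norm ((C o\<^sub>L X) e))\<^sup>2) summable_on ob"
    by (rule summable_on_comparison_test[OF has_sum_imp_summable[OF has_sum_cmult_right[OF XY(2), of "(norm C)\<^sup>2"]]])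
      (use le in auto)
  then have CX: "((\<lambda>e. (norm ((C o\<^sub>L X) e))\<^sup>2) has_sum infsum (\<lambda>e. (norm ((C o\<^sub>L X) e))\<^sup>2) ob) ob" (is "(_ has_sum ?s) _")
    by (rule has_sum_infsum)
  have s: "?s \<le> (norm C)\<^sup>2 * s" by (rule has_sum_mono[OF CX has_sum_cmult_right[OF XY(2)] le])
  have "(\<lambda>e. (norm (adj Y (id_blinfun e)))\<^sup>2) summable_on ob" "infsum (\<lambda>e. (norm (adj Y (id_blinfun e)))\<^sup>2) ob \<le> (norm (id_blinfun :: 'a \<Rightarrow>\<^sub>L 'a))\<^sup>2 * ?t"
    by (rule hs_adj[OF XY(4)])+
  then have aY: "((\<lambda>e. (norm (adj Y e))\<^sup>2) has_sum infsum (\<lambda>e. (norm (adj Y e))\<^sup>2) ob) ob"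
    and "infsum (\<lambda>e. (norm (adj Y e))\<^sup>2) ob \<le> (norm (id_blinfun :: 'a \<Rightarrow>\<^sub>L 'a))\<^sup>2 * ?t" by auto
  moreover have "(norm (id_blinfun :: 'a \<Rightarrow>\<^sub>L 'a))\<^sup>2 * ?t \<le> 1 * ?t"
    using trace_norm_nonneg by (intro mult_right_mono power_le_one norm_blinfun_id_le) auto
  ultimately have t: "infsum (\<lambda>e. (norm (adj Y e))\<^sup>2) ob \<le> ?t" by linarith
  have "(\<lambda>e. (norm (adj (adj Y) (D e)))\<^sup>2) summable_on ob"
    "infsum (\<lambda>e. (norm (adj (adj Y) (D e)))\<^sup>2) ob \<le> (norm D)\<^sup>2 * infsum (\<lambda>e. (norm (adj Y e))\<^sup>2) ob"
    by (rule hs_adj[OF aY])+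
  then have YD: "((\<lambda>e. (norm ((Y o\<^sub>L D) e))\<^sup>2) has_sum infsum (\<lambda>e. (norm ((Y o\<^sub>L D) e))\<^sup>2) ob) ob" (is "(_ has_sum ?r) _")
    and r: "infsum (\<lambda>e. (norm ((Y o\<^sub>L D) e))\<^sup>2) ob \<le> (norm D)\<^sup>2 * infsum (\<lambda>e. (norm (adj Y e))\<^sup>2) ob"
    by (auto simp: adj_adj)
  have eq: "C o\<^sub>L A o\<^sub>L D = (C o\<^sub>L X) o\<^sub>L (Y o\<^sub>L D)" by (simp add: XY(1) blinfun_compose_assoc')
  show "trace_class_op (C o\<^sub>L A o\<^sub>L D)" unfolding eq by (rule trace_class_product(1)[OF CX YD])
  have "trace_norm (C o\<^sub>L A o\<^sub>L D) \<le> sqrt ?s * sqrt ?r" unfolding eq by (rule trace_class_product(2)[OF CX YD])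
  also have "\<dots> \<le> sqrt ((norm C)\<^sup>2 * ?t) * sqrt ((norm D)\<^sup>2 * ?t)"
  proof (intro mult_mono real_sqrt_le_mono)
    have "(norm C)\<^sup>2 * s \<le> (norm C)\<^sup>2 * ?t" using XY(3) by (intro mult_left_mono) auto
    then show "?s \<le> (norm C)\<^sup>2 * ?t" using s by linarith
    have "(norm D)\<^sup>2 * infsum (\<lambda>e. (norm (adj Y e))\<^sup>2) ob \<le> (norm D)\<^sup>2 * ?t" using t by (intro mult_left_mono) auto
    then show "?r \<le> (norm D)\<^sup>2 * ?t" using r by linarith
  qed (auto intro!: infsum_nonneg mult_nonneg_nonneg trace_norm_nonneg)
  also have "\<dots> = norm C * ?t * norm D"
    using trace_norm_nonneg[of A] by (simp add: real_sqrt_mult)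
  finally show "trace_norm (C o\<^sub>L A o\<^sub>L D) \<le> norm C * ?t * norm D" .
qed

lemma trace_class_add:
  fixes A B :: "'a::{real_inner,banach} \<Rightarrow>\<^sub>L 'a"
  assumes "trace_class_op A" "trace_class_op B"
  shows "trace_class_op (A + B)" "trace_norm (A + B) \<le> trace_norm A + trace_norm B"
proof -
  have "(\<Sum>e\<in>F. \<bar>inner (blinfun_apply W ((A + B) e)) e\<bar>) \<le> trace_norm A + trace_norm B"
    if "norm W \<le> 1" "finite F" "F \<subseteq> ob" for W :: "'a \<Rightarrow>\<^sub>L 'a" and F
  proof -
    have "(\<Sum>e\<in>F. \<bar>inner (W ((A + B) e)) e\<bar>) \<le> (\<Sum>e\<in>F. \<bar>inner (W (A e)) e\<bar> + \<bar>inner (W (B e)) e\<bar>)"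
      by (rule sum_mono) (simp add: blinfun.bilinear_simps inner_simps)
    then show ?thesis
      using trace_class_sum_le[OF assms(1) that] trace_class_sum_le[OF assms(2) that]
      by (simp add: sum.distrib)
  qed
  then show "trace_class_op (A + B)" "trace_norm (A + B) \<le> trace_norm A + trace_norm B"
    by (rule trace_class_boundI; blast)+
qed

lemma trace_class_0: "trace_class_op (0 :: 'a::{real_inner,banach} \<Rightarrow>\<^sub>L 'a)" "trace_norm (0 :: 'a \<Rightarrow>\<^sub>L 'a) = 0"
proof -
  show "trace_class_op (0 :: 'a \<Rightarrow>\<^sub>L 'a)" by (rule trace_class_boundI(1)[of _ 0]) simp
  have "trace_norm (0 :: 'a \<Rightarrow>\<^sub>L 'a) \<le> 0" by (rule trace_class_boundI(2)) simp
  then show "trace_norm (0 :: 'a \<Rightarrow>\<^sub>L 'a) = 0" using trace_norm_nonneg[of "0 :: 'a \<Rightarrow>\<^sub>L 'a"] by simp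
qed

lemma trace_class_scaleR:
  fixes A :: "'a::{real_inner,banach} \<Rightarrow>\<^sub>L 'a"
  assumes "trace_class_op A"
  shows "trace_class_op (r *\<^sub>R A)" "trace_norm (r *\<^sub>R A) = \<bar>r\<bar> * trace_norm A"
proof -
  have *: "trace_class_op (r *\<^sub>R A)" "trace_norm (r *\<^sub>R A) \<le> \<bar>r\<bar> * trace_norm A"
    if A: "trace_class_op A" for r and A :: "'a \<Rightarrow>\<^sub>L 'a"
  proof -
    have "(\<Sum>e\<in>F. \<bar>inner (blinfun_apply W ((r *\<^sub>R A) e)) e\<bar>) \<le> \<bar>r\<bar> * trace_norm A"
      if "norm W \<le> 1" "finite F" "F \<subseteq> ob" for W :: "'a \<Rightarrow>\<^sub>L 'a" and F
    proof -
      have "(\<Sum>e\<in>F. \<bar>inner (W ((r *\<^sub>R A) e)) e\<bar>) = \<bar>r\<bar> * (\<Sum>e\<in>F. \<bar>inner (W (A e)) e\<bar>)"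
        by (simp add: blinfun.bilinear_simps abs_mult sum_distrib_left)
      then show ?thesis using trace_class_sum_le[OF A that] by (simp add: mult_left_mono)
    qed
    then show "trace_class_op (r *\<^sub>R A)" "trace_norm (r *\<^sub>R A) \<le> \<bar>r\<bar> * trace_norm A"
      by (rule trace_class_boundI; blast)+
  qed
  show t: "trace_class_op (r *\<^sub>R A)" by (rule *(1)[OF assms])
  show "trace_norm (r *\<^sub>R A) = \<bar>r\<bar> * trace_norm A"
  proof (cases "r = 0")
    case True then show ?thesis by (simp add: trace_class_0)
  next
    case False
    have "trace_norm A \<le> \<bar>inverse r\<bar> * trace_norm (r *\<^sub>R A)" using *(2)[OF t, of "inverse r"] False by simp
    then have "\<bar>r\<bar> * trace_norm A \<le> trace_norm (r *\<^sub>R A)" using False by (simp add: field_simps)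
    then show ?thesis using *(2)[OF assms, of r] by simp
  qed
qed

text \<open>
  The space \<open>L\<^sub>1(H)\<close>. With the trace norm it is a separable Banach space, so that the
  library's Bochner integral applies to \<open>L\<^sub>1(H)\<close>-valued functions.
\<close>

typedef (overloaded) 'a trace_class = "{A :: 'a::separable_hilbert \<Rightarrow>\<^sub>L 'a. trace_class_op A}"
  morphisms op_of Trace_class
  by (intro exI[of _ 0]) (simp add: trace_class_0)

setup_lifting type_definition_trace_class

lemma trace_class_op_of: "trace_class_op (op_of A)"
  using op_of[of A] by simp

instantiation trace_class :: (separable_hilbert) real_normed_vector
begin

lift_definition zero_trace_class :: "'a trace_class" is 0 by (rule trace_class_0)

lift_definition plus_trace_class :: "'a trace_class \<Rightarrow> 'a trace_class \<Rightarrow> 'a trace_class" is "(+)"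
  by (rule trace_class_add)

lift_definition scaleR_trace_class :: "real \<Rightarrow> 'a trace_class \<Rightarrow> 'a trace_class" is "(*\<^sub>R)"
  by (rule trace_class_scaleR)

lift_definition uminus_trace_class :: "'a trace_class \<Rightarrow> 'a trace_class" is uminus
  using trace_class_scaleR(1)[of _ "-1"] by simp

lift_definition minus_trace_class :: "'a trace_class \<Rightarrow> 'a trace_class \<Rightarrow> 'a trace_class" is "(-)"
  using trace_class_scaleR(1)[of _ "-1"] trace_class_add(1) by fastforce

lift_definition norm_trace_class :: "'a trace_class \<Rightarrow> real" is trace_norm .

definition dist_trace_class :: "'a trace_class \<Rightarrow> 'a trace_class \<Rightarrow> real" where
  "dist_trace_class A B = norm (A - B)"

definition uniformity_trace_class :: "('a trace_class \<times> 'a trace_class) filter" where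
  "uniformity_trace_class = (INF e\<in>{0 <..}. principal {(x, y). dist x y < e})"

definition open_trace_class :: "'a trace_class set \<Rightarrow> bool" where
  "open_trace_class U = (\<forall>x\<in>U. \<forall>\<^sub>F (x', y) in uniformity. x' = x \<longrightarrow> y \<in> U)"

definition sgn_trace_class :: "'a trace_class \<Rightarrow> 'a trace_class" where
  "sgn_trace_class A = inverse (norm A) *\<^sub>R A"

instance
proof
  fix A B C :: "'a trace_class" and r s :: real
  show "A + B + C = A + (B + C)" "A + B = B + A" "0 + A = A" "- A + A = 0" "A - B = A + - B"
    "r *\<^sub>R (A + B) = r *\<^sub>R A + r *\<^sub>R B" "(r + s) *\<^sub>R A = r *\<^sub>R A + s *\<^sub>R A"
    "r *\<^sub>R s *\<^sub>R A = (r * s) *\<^sub>R A" "1 *\<^sub>R A = A"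
    by (transfer; simp add: algebra_simps)+
  show "norm A = 0 \<longleftrightarrow> A = 0"
    by transfer (use norm_le_trace_norm trace_class_0 in fastforce)
  show "norm (A + B) \<le> norm A + norm B" by transfer (rule trace_class_add)
  show "norm (r *\<^sub>R A) = \<bar>r\<bar> * norm A" by transfer (rule trace_class_scaleR)
qed (simp_all add: dist_trace_class_def uniformity_trace_class_def open_trace_class_def sgn_trace_class_def)

end

instance trace_class :: (separable_hilbert) banach
proof
  fix X :: "nat \<Rightarrow> 'a trace_class"
  assume X: "Cauchy X"
  have le: "norm (op_of A) \<le> norm A" for A :: "'a trace_class"
    by transfer (rule norm_le_trace_norm)
  have "Cauchy (\<lambda>n. op_of (X n))"
    unfolding Cauchy_altdef2 dist_norm
    by (metis (no_types, opaque_lifting) X Cauchy_altdef2 dist_norm le le_less_trans minus_trace_class.rep_eq)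
  then obtain A where A: "(\<lambda>n. op_of (X n)) \<longlonglongrightarrow> A" using Cauchy_convergent convergent_def by blast
  have key: "trace_class_op (op_of (X n) - A) \<and> trace_norm (op_of (X n) - A) \<le> r"
    if r: "\<And>m. m \<ge> N \<Longrightarrow> norm (X n - X m) \<le> r" for n N r
  proof -
    have "(\<Sum>e\<in>F. \<bar>inner (blinfun_apply W ((op_of (X n) - A) e)) e\<bar>) \<le> r"
      if WF: "norm W \<le> 1" "finite F" "F \<subseteq> ob" for W :: "'a \<Rightarrow>\<^sub>L 'a" and F
    proof (rule LIMSEQ_le_const2)
      show "(\<lambda>m. \<Sum>e\<in>F. \<bar>inner (W ((op_of (X n) - op_of (X m)) e)) e\<bar>)
          \<longlonglongrightarrow> (\<Sum>e\<in>F. \<bar>inner (W ((op_of (X n) - A) e)) e\<bar>)"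
        by (intro tendsto_intros A)
      have "(\<Sum>e\<in>F. \<bar>inner (W ((op_of (X n) - op_of (X m)) e)) e\<bar>) \<le> r" if "m \<ge> N" for m
        using trace_class_sum_le[OF trace_class_op_of WF, of "X n - X m"] r[OF that]
        by (simp add: minus_trace_class.rep_eq norm_trace_class.rep_eq)
      then show "\<exists>N. \<forall>m\<ge>N. (\<Sum>e\<in>F. \<bar>inner (W ((op_of (X n) - op_of (X m)) e)) e\<bar>) \<le> r" by blast
    qed
    then show ?thesis using trace_class_boundI by blast
  qed
  have cauchy: "\<exists>N. \<forall>n\<ge>N. \<forall>m\<ge>N. norm (X n - X m) \<le> r" if "0 < r" for r
    using X that unfolding Cauchy_def dist_norm by (meson less_imp_le)
  obtain N where N: "\<forall>n\<ge>N. \<forall>m\<ge>N. norm (X n - X m) \<le> 1" using cauchy[of 1] by auto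
  have "trace_class_op (op_of (X N) - A)" using key[of N N 1] N by blast
  then have "trace_class_op (op_of (X N) + (-1) *\<^sub>R (op_of (X N) - A))"
    by (intro trace_class_add trace_class_scaleR trace_class_op_of)
  then have tA: "trace_class_op A" by simp
  have "X \<longlonglongrightarrow> Trace_class A"
  proof (rule LIMSEQ_I)
    fix r :: real assume "0 < r"
    then obtain N where N: "\<forall>n\<ge>N. \<forall>m\<ge>N. norm (X n - X m) \<le> r / 2" using cauchy[of "r / 2"] by auto
    have "norm (X n - Trace_class A) < r" if "n \<ge> N" for n
    proof -
      have "norm (X n - Trace_class A) = trace_norm (op_of (X n) - A)"
        using tA by (simp add: norm_trace_class.rep_eq minus_trace_class.rep_eq Trace_class_inverse)
      then show ?thesis using key[of N n "r / 2"] N that \<open>0 < r\<close> by fastforce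
    qed
    then show "\<exists>N. \<forall>n\<ge>N. norm (X n - Trace_class A) < r" by blast
  qed
  then show "convergent X" by (auto simp: convergent_def)
qed

text \<open>The trace class operator \<open>A K C\<^sup>*\<close>.\<close>

lift_definition sandwich :: "('a::separable_hilbert \<Rightarrow>\<^sub>L 'b::separable_hilbert) \<Rightarrow> 'a trace_class \<Rightarrow> ('a \<Rightarrow>\<^sub>L 'b) \<Rightarrow> 'b trace_class"
  is "\<lambda>A K C. A o\<^sub>L K o\<^sub>L adj C"
  by (rule trace_class_compose)

lemma rank1_aux:
  fixes a b :: "'a::separable_hilbert"
  shows "trace_class_op (blinfun_scaleR_left b o\<^sub>L blinfun_inner_left a)"
    "trace_norm (blinfun_scaleR_left b o\<^sub>L blinfun_inner_left a) \<le> norm b * norm a"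
proof -
  have "((\<lambda>f::real. (inner 1 f)\<^sup>2 * (norm b)\<^sup>2) has_sum (norm (1::real))\<^sup>2 * (norm b)\<^sup>2) ob"
    by (intro has_sum_cmult_left ob_parseval)
  then have 1: "((\<lambda>f. (norm (blinfun_scaleR_left b f))\<^sup>2) has_sum (norm b)\<^sup>2) ob"
    by (simp add: power_mult_distrib)
  have 2: "((\<lambda>e. (norm (blinfun_inner_left a e))\<^sup>2) has_sum (norm a)\<^sup>2) ob"
    using ob_parseval[of a] by (simp add: inner_commute)
  show "trace_class_op (blinfun_scaleR_left b o\<^sub>L blinfun_inner_left a)"
    "trace_norm (blinfun_scaleR_left b o\<^sub>L blinfun_inner_left a) \<le> norm b * norm a"
    using trace_class_product[OF 1 2] by simp_all
qed

lift_definition rank1 :: "'a::separable_hilbert \<Rightarrow> 'a \<Rightarrow> 'a trace_class"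
  is "\<lambda>a b. blinfun_scaleR_left b o\<^sub>L blinfun_inner_left a"
  by (rule rank1_aux)

lemma rank1_apply: "op_of (rank1 a b) x = inner a x *\<^sub>R b"
  by (simp add: rank1.rep_eq inner_commute)

lemma trace_class_eqI: "(\<And>x. op_of A x = op_of B x) \<Longrightarrow> A = B"
  by (simp add: blinfun_eqI op_of_inject[symmetric])

lemma bounded_bilinear_rank1: "bounded_bilinear (rank1 :: 'a::separable_hilbert \<Rightarrow> _)"
proof
  fix a a' b b' :: 'a and r :: real
  show "rank1 (a + a') b = rank1 a b + rank1 a' b" "rank1 a (b + b') = rank1 a b + rank1 a b'"
    "rank1 (r *\<^sub>R a) b = r *\<^sub>R rank1 a b" "rank1 a (r *\<^sub>R b) = r *\<^sub>R rank1 a b"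
    by (rule trace_class_eqI; simp add: rank1_apply plus_trace_class.rep_eq scaleR_trace_class.rep_eq
        blinfun.bilinear_simps inner_simps algebra_simps)+
  have "norm (rank1 a b) \<le> norm a * norm b * 1" for a b :: 'a
  proof -
    have "norm (rank1 a b) \<le> norm b * norm a" by transfer (rule rank1_aux(2))
    then show ?thesis by (simp add: mult.commute)
  qed
  then show "\<exists>K. \<forall>a b. norm (rank1 a (b::'a)) \<le> norm a * norm b * K" by blast
qed

lemma trace_class_dense:
  fixes D :: "'a::separable_hilbert set"
  assumes D: "closure D = UNIV"
  shows "closure ((\<lambda>xs. \<Sum>(a, b)\<leftarrow>xs. rank1 a b) ` lists (D \<times> D)) = UNIV" (is "closure ?S = UNIV")
proof -
  have S0: "0 \<in> ?S" by (rule image_eqI[of _ _ "[]"]) simp_all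
  have Sadd: "x + y \<in> ?S" if "x \<in> ?S" "y \<in> ?S" for x y
  proof -
    from that obtain xs ys where "xs \<in> lists (D \<times> D)" "x = (\<Sum>(a, b)\<leftarrow>xs. rank1 a b)"
      "ys \<in> lists (D \<times> D)" "y = (\<Sum>(a, b)\<leftarrow>ys. rank1 a b)" by blast
    then show ?thesis by (intro image_eqI[of _ _ "xs @ ys"]) simp_all
  qed
  have Cadd: "x + y \<in> closure ?S" if xy: "x \<in> closure ?S" "y \<in> closure ?S" for x y
  proof -
    obtain f g where fg: "\<And>n. f n \<in> ?S" "f \<longlonglongrightarrow> x" "\<And>n. g n \<in> ?S" "g \<longlonglongrightarrow> y"
      using xy unfolding closure_sequential by blast
    then have "(\<lambda>n. f n + g n) \<longlonglongrightarrow> x + y" "\<And>n. f n + g n \<in> ?S"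
      by (intro tendsto_add Sadd; blast)+
    then show ?thesis unfolding closure_sequential by (intro exI[of _ "\<lambda>n. f n + g n"]) blast
  qed
  have r: "rank1 a b \<in> closure ?S" for a b
  proof -
    have "a \<in> closure D" "b \<in> closure D" using D by auto
    then obtain f g where fg: "\<And>n. f n \<in> D" "f \<longlonglongrightarrow> a" "\<And>n. g n \<in> D" "g \<longlonglongrightarrow> b"
      unfolding closure_sequential by blast
    have "(\<lambda>n. rank1 (f n) (g n)) \<longlonglongrightarrow> rank1 a b"
      by (rule bounded_bilinear.tendsto[OF bounded_bilinear_rank1 fg(2) fg(4)])
    moreover have "rank1 (f n) (g n) \<in> ?S" for n
      by (rule image_eqI[of _ _ "[(f n, g n)]"]) (use fg in simp_all)
    ultimately show ?thesis unfolding closure_sequential by (intro exI[of _ "\<lambda>n. rank1 (f n) (g n)"]) blast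
  qed
  have sums: "(\<Sum>e\<in>F. rank1 (f e) (g e)) \<in> closure ?S" if "finite F" for F :: "'a set" and f g
    using that
  proof (induction F)
    case empty
    have "0 \<in> closure ?S" by (rule subsetD[OF closure_subset S0])
    then show ?case by simp
  next
    case (insert e F)
    then show ?case using Cadd[OF r insert.IH] by simp
  qed
  have "A \<in> closure ?S" for A
  proof -
    obtain X Y s where XY: "op_of A = X o\<^sub>L Y" "((\<lambda>f. (norm (blinfun_apply X f))\<^sup>2) has_sum s) ob"
      "((\<lambda>f. (norm (blinfun_apply (Y :: 'a \<Rightarrow>\<^sub>L 'a) f))\<^sup>2) has_sum trace_norm (op_of A)) ob"
      using trace_class_factor[OF trace_class_op_of] by blast
    let ?t = "trace_norm (op_of A)"
    have "\<exists>B\<in>closure ?S. dist B A < r" if "0 < r" for r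
    proof -
      define d where "d = (r / (sqrt ?t + 1))\<^sup>2"
      have st: "0 < sqrt ?t + 1" using trace_norm_nonneg[of "op_of A"] by (simp add: add_nonneg_pos)
      have "0 < d" using that st by (simp add: d_def)
      then obtain F where F: "finite F" "F \<subseteq> ob" "dist (\<Sum>f\<in>F. (norm (X f))\<^sup>2) s < d"
        using XY(2) unfolding has_sum_metric by blast
      define P where "P = (\<Sum>e\<in>F. blinfun_scaleR_left e o\<^sub>L blinfun_inner_left e)"
      have Px: "P x = (\<Sum>e\<in>F. inner x e *\<^sub>R e)" for x
        by (simp add: P_def blinfun.sum_left)
      define X' where "X' = X o\<^sub>L (id_blinfun - P)"
      have X'e: "X' f = (if f \<in> F then 0 else X f)" if "f \<in> ob" for f
      proof -
        have "P f = (\<Sum>e\<in>F. if e = f then f else 0)"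
          unfolding Px by (rule sum.cong) (use F(2) that ob_inner[of f] in \<open>auto simp: subset_iff\<close>)
        then show ?thesis using F(1) by (simp add: X'_def blinfun.bilinear_simps)
      qed
      have "((\<lambda>f. (norm (X f))\<^sup>2) has_sum s - (\<Sum>f\<in>F. (norm (X f))\<^sup>2)) (ob - F)"
        by (rule has_sum_Diff[OF XY(2)]) (use F in auto)
      then have "((\<lambda>f. (norm (X' f))\<^sup>2) has_sum s - (\<Sum>f\<in>F. (norm (X f))\<^sup>2)) ob"
        by (rule has_sum_cong_neutral[THEN iffD1, rotated -1]) (use X'e in auto)
      note tr = trace_class_product[OF this XY(3)]
      define B where "B = (\<Sum>e\<in>F. rank1 (adj Y e) (X e))"
      have sum_op: "op_of (\<Sum>e\<in>G. f e) x = (\<Sum>e\<in>G. op_of (f e) x)" if "finite G" for f and G :: "'a set" and x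
        using that by (induction G) (simp_all add: zero_trace_class.rep_eq plus_trace_class.rep_eq blinfun.bilinear_simps)
      have "op_of (A - B) = X' o\<^sub>L Y"
      proof (rule blinfun_eqI)
        fix x
        have "op_of B x = (\<Sum>e\<in>F. inner (Y x) e *\<^sub>R X e)"
          using F(1) by (simp add: B_def sum_op rank1_apply inner_adj') (simp add: inner_commute)
        also have "\<dots> = X (P (Y x))" by (simp add: Px blinfun.sum_right blinfun.scaleR_right)
        finally show "op_of (A - B) x = (X' o\<^sub>L Y) x"
          by (simp add: minus_trace_class.rep_eq XY(1) X'_def blinfun.bilinear_simps)
      qed
      moreover have "dist B A = trace_norm (op_of (A - B))"
        by (subst dist_commute) (simp add: dist_norm norm_trace_class.rep_eq)
      ultimately have "dist B A \<le> sqrt (s - (\<Sum>f\<in>F. (norm (X f))\<^sup>2)) * sqrt ?t"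
        using tr(2) by simp
      also have "\<dots> \<le> sqrt d * sqrt ?t"
        using F(3) trace_norm_nonneg by (intro mult_right_mono real_sqrt_le_mono) (auto simp: dist_real_def)
      also have "\<dots> = r * (sqrt ?t / (sqrt ?t + 1))" using that st by (simp add: d_def)
      also have "\<dots> < r * 1" using that st by (intro mult_strict_left_mono) auto
      finally show ?thesis using sums[OF F(1)] unfolding B_def by auto
    qed
    then have "A \<in> closure (closure ?S)" unfolding closure_approachable by blast
    then show ?thesis by simp
  qed
  then show ?thesis by blast
qed

lemma second_countable_if_separable:
  fixes S :: "'a::metric_space set"
  assumes S: "countable S" "closure S = UNIV"
  shows "\<exists>B::'a set set. countable B \<and> open = generate_topology B"
proof -
  let ?B = "(\<lambda>(s, n). ball s (1 / real (Suc n))) ` (S \<times> UNIV)"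
  have "topological_basis ?B"
  proof (rule topological_basisI)
    fix U and x :: 'a assume U: "open U" "x \<in> U"
    then obtain r where r: "0 < r" "ball x r \<subseteq> U" using openE by blast
    then obtain n where n: "1 / real (Suc n) < r / 2" using nat_approx_posE[of "r / 2"] by auto
    have "x \<in> closure S" using S by simp
    then obtain s where s: "s \<in> S" "dist s x < 1 / real (Suc n)"
      using closure_approachable[of x S] by (metis of_nat_0_less_iff zero_less_Suc zero_less_divide_1_iff)
    have "ball s (1 / real (Suc n)) \<subseteq> ball x r"
    proof
      fix y assume "y \<in> ball s (1 / real (Suc n))"
      then have "dist s y < r / 2" using n by simp
      moreover have "dist s x < r / 2" using n s by simp
      ultimately show "y \<in> ball x r" using dist_triangle[of x y s] by (simp add: dist_commute)
    qed
    then show "\<exists>B'\<in>?B. x \<in> B' \<and> B' \<subseteq> U" using r s by (intro bexI[of _ "ball s (1 / real (Suc n))"]) auto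
  qed auto
  then show ?thesis using S(1) topological_basis_imp_subbasis by (intro exI[of _ ?B]) auto
qed

instance trace_class :: (separable_hilbert) second_countable_topology
proof
  obtain D :: "'a set" where D: "countable D" "\<And>X. open X \<Longrightarrow> X \<noteq> {} \<Longrightarrow> \<exists>d\<in>D. d \<in> X"
    by (rule countable_dense_setE) blast
  have "closure D = UNIV"
  proof (rule ccontr)
    assume "closure D \<noteq> UNIV"
    then obtain d where "d \<in> D" "d \<in> - closure D" using D(2)[of "- closure D"] by auto
    then show False using closure_subset by blast
  qed
  from second_countable_if_separable[OF _ trace_class_dense[OF this]] D(1)
  show "\<exists>B::'a trace_class set set. countable B \<and> open = generate_topology B" by (simp add: countable_lists)
qed

text \<open>
  The pseudoinverse on the range of \<open>A\<close>: the preimage of \<open>y\<close> that is orthogonal to the kernel of \<open>A\<close>.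
\<close>

definition pinv :: "('a::real_inner \<Rightarrow>\<^sub>L 'b::real_normed_vector) \<Rightarrow> 'b \<Rightarrow> 'a" where
  "pinv A y = (THE x. A x = y \<and> (\<forall>z. A z = 0 \<longrightarrow> inner x z = 0))"

definition U0 :: "('u::real_inner \<Rightarrow>\<^sub>L 'u) \<Rightarrow> 'u set" where
  "U0 Q = range (blinfun_apply (sqrt_op Q))"

definition inner_U0 :: "('u::real_inner \<Rightarrow>\<^sub>L 'u) \<Rightarrow> 'u \<Rightarrow> 'u \<Rightarrow> real" where
  "inner_U0 Q u v = inner (pinv (sqrt_op Q) u) (pinv (sqrt_op Q) v)"

text \<open>
  Hilbert-Schmidt operators from the Hilbert space \<open>(V, ip)\<close>. Only the values of \<open>A\<close> on \<open>V\<close> matter.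
\<close>

definition hilbert_schmidt ::
    "'a::real_vector set \<Rightarrow> ('a \<Rightarrow> 'a \<Rightarrow> real) \<Rightarrow> ('a \<Rightarrow> 'b::real_normed_vector) \<Rightarrow> bool" where
  "hilbert_schmidt V ip A \<longleftrightarrow>
     (\<forall>u\<in>V. \<forall>v\<in>V. A (u + v) = A u + A v) \<and> (\<forall>r. \<forall>u\<in>V. A (r *\<^sub>R u) = r *\<^sub>R A u) \<and>
     (\<exists>M. \<forall>u\<in>V. norm (A u) \<le> M * sqrt (ip u u)) \<and>
     (\<lambda>e. (norm (A e))\<^sup>2) summable_on onb V ip"

definition hs_norm ::
    "'a::real_vector set \<Rightarrow> ('a \<Rightarrow> 'a \<Rightarrow> real) \<Rightarrow> ('a \<Rightarrow> 'b::real_normed_vector) \<Rightarrow> real" where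
  "hs_norm V ip A = sqrt (\<Sum>\<^sub>\<infinity>e\<in>onb V ip. (norm (A e))\<^sup>2)"

definition hs_norm_U0 ::
    "('u::real_inner \<Rightarrow>\<^sub>L 'u) \<Rightarrow> ('u \<Rightarrow> 'b::real_normed_vector) \<Rightarrow> real" where
  "hs_norm_U0 Q = hs_norm (U0 Q) (inner_U0 Q)"

text \<open>Continuity at \<open>t\<close>, relative to \<open>D\<close>, of an \<open>L\<^sub>2(U\<^sub>0, H)\<close>-valued map.\<close>

definition hs_continuous_within ::
    "('u::real_inner \<Rightarrow>\<^sub>L 'u) \<Rightarrow> real \<Rightarrow> real set \<Rightarrow> (real \<Rightarrow> 'u \<Rightarrow> 'b::real_normed_vector) \<Rightarrow> bool" where
  "hs_continuous_within Q t D X \<longleftrightarrow>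
     ((\<lambda>s. hs_norm_U0 Q (\<lambda>u. X s u - X t u)) \<longlongrightarrow> 0) (at t within D)"

definition adjoint_U0 ::
    "('u::real_inner \<Rightarrow>\<^sub>L 'u) \<Rightarrow> ('u \<Rightarrow> 'b::real_inner) \<Rightarrow> 'b \<Rightarrow> 'u" where
  "adjoint_U0 Q A y = (THE v. v \<in> U0 Q \<and> (\<forall>u\<in>U0 Q. inner_U0 Q u v = inner (A u) y))"

text \<open>
  \<open>X Y\<^sup>*\<close> for \<open>X, Y \<in> L\<^sub>2(U\<^sub>0, H)\<close>, a trace class operator on \<open>H\<close>;
  \<open>Blinfun\<close> and \<open>Trace_class\<close> are only meaningful for such \<open>X\<close> and \<open>Y\<close>.
\<close>

definition hs_times_adj ::
    "('u::real_inner \<Rightarrow>\<^sub>L 'u) \<Rightarrow> ('u \<Rightarrow> 'h) \<Rightarrow> ('u \<Rightarrow> 'h) \<Rightarrow> 'h::separable_hilbert trace_class" where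
  "hs_times_adj Q X Y = Trace_class (Blinfun (\<lambda>x. X (adjoint_U0 Q Y x)))"

text \<open>The norm of \<open>L\<^sub>i(H)\<close>, \<open>i \<in> {1, 2}\<close>, on \<open>L\<^sub>1(H) \<subseteq> L\<^sub>2(H)\<close>.\<close>

definition L_norm :: "nat \<Rightarrow> 'h::separable_hilbert trace_class \<Rightarrow> real" where
  "L_norm i A = (if i = 1 then norm A else hs_norm UNIV inner (blinfun_apply (op_of A)))"

text \<open>
  An operator family \<open>R\<close> is given by two functions: \<open>R t\<close> is the operator in \<open>L(H)\<close>, for \<open>t \<in> [0,T]\<close>, and
  \<open>Rh t\<close> the operator in \<open>L(H^, H)\<close>, for \<open>t \<in> (0,T]\<close> only. The embedding of \<open>H\<close> into \<open>H^\<close> is \<open>j\<close>,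
  so that the restriction of \<open>Rh t\<close> to \<open>H\<close> is \<open>Rh t o\<^sub>L j\<close>.
\<close>

definition operator_family ::
    "real \<Rightarrow> ('h::separable_hilbert \<Rightarrow>\<^sub>L 'g::separable_hilbert) \<Rightarrow> (real \<Rightarrow> 'h \<Rightarrow>\<^sub>L 'h) \<Rightarrow> (real \<Rightarrow> 'g \<Rightarrow>\<^sub>L 'h) \<Rightarrow> bool" where
  "operator_family T j R Rh \<longleftrightarrow> (\<forall>t\<in>{0<..T}. R t = Rh t o\<^sub>L j)"

definition family_bounds ::
    "real \<Rightarrow> ('h::separable_hilbert \<Rightarrow>\<^sub>L 'g::separable_hilbert) \<Rightarrow> ('u::separable_hilbert \<Rightarrow>\<^sub>L 'u) \<Rightarrow> ('u \<Rightarrow> 'g)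
      \<Rightarrow> (real \<Rightarrow> 'h \<Rightarrow>\<^sub>L 'h) \<Rightarrow> (real \<Rightarrow> 'g \<Rightarrow>\<^sub>L 'h) \<Rightarrow> bool" where
  "family_bounds T F Q B R Rh \<longleftrightarrow>
     (\<exists>C a b. integrable (lebesgue_on {0..T}) a \<and>
        b \<in> borel_measurable (lebesgue_on {0..T}) \<and> integrable (lebesgue_on {0..T}) (\<lambda>t. (b t)\<^sup>2) \<and>
        (\<forall>t\<in>{0..T}. norm (R t) \<le> C) \<and>
        (\<forall>t\<in>{0<..T}. norm (Rh t o\<^sub>L F) \<le> a t \<and> hs_norm_U0 Q (\<lambda>u. Rh t (B u)) \<le> b t))"

definition drift_integrand ::
    "('h::separable_hilbert \<Rightarrow>\<^sub>L 'g::separable_hilbert) \<Rightarrow> (real \<Rightarrow> 'h \<Rightarrow>\<^sub>L 'h) \<Rightarrow> (real \<Rightarrow> 'g \<Rightarrow>\<^sub>L 'h)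
      \<Rightarrow> (real \<Rightarrow> 'h trace_class) \<Rightarrow> real \<Rightarrow> real \<Rightarrow> 'h trace_class" where
  "drift_integrand F R Rh G t s =
     sandwich (Rh (t - s) o\<^sub>L F) (G s) (R (t - s)) + sandwich (R (t - s)) (G s) (Rh (t - s) o\<^sub>L F)"

definition noise_integrand ::
    "('u::separable_hilbert \<Rightarrow>\<^sub>L 'u) \<Rightarrow> ('u \<Rightarrow> 'g::separable_hilbert) \<Rightarrow> (real \<Rightarrow> 'g \<Rightarrow>\<^sub>L 'h)
      \<Rightarrow> real \<Rightarrow> real \<Rightarrow> 'h::separable_hilbert trace_class" where
  "noise_integrand Q B Rh t s = hs_times_adj Q (\<lambda>u. Rh (t - s) (B u)) (\<lambda>u. Rh (t - s) (B u))"

text \<open>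
  \<open>X\<close> is the value at \<open>t\<close> of the right-hand side of the mild Lyapunov equation, evaluated at the family \<open>R\<close>
  and at \<open>G\<close> in place of the unknown; both integrals exist as Bochner integrals in \<open>L\<^sub>1(H)\<close>.
  The endpoint \<open>s = t\<close>, where \<open>Rh 0\<close> has no meaning, is a null set.
\<close>

definition lyapunov_rhs ::
    "('h::separable_hilbert \<Rightarrow>\<^sub>L 'g::separable_hilbert) \<Rightarrow> ('u::separable_hilbert \<Rightarrow>\<^sub>L 'u) \<Rightarrow> ('u \<Rightarrow> 'g)
      \<Rightarrow> 'h trace_class \<Rightarrow> (real \<Rightarrow> 'h \<Rightarrow>\<^sub>L 'h) \<Rightarrow> (real \<Rightarrow> 'g \<Rightarrow>\<^sub>L 'h)
      \<Rightarrow> (real \<Rightarrow> 'h trace_class) \<Rightarrow> real \<Rightarrow> 'h trace_class \<Rightarrow> bool" where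
  "lyapunov_rhs F Q B Qxi R Rh G t X \<longleftrightarrow>
     integrable (lebesgue_on {0..t}) (drift_integrand F R Rh G t) \<and>
     integrable (lebesgue_on {0..t}) (noise_integrand Q B Rh t) \<and>
     X = sandwich (R t) Qxi (R t)
       + (LINT s|lebesgue_on {0..t}. drift_integrand F R Rh G t s)
       + (LINT s|lebesgue_on {0..t}. noise_integrand Q B Rh t s)"

end

theory Submission
  imports Defs
begin

text \<open>
  Put \<open>R\<^sub>- = S - St\<close> and \<open>R\<^sub>+ = S + St\<close>. The estimate rests on the identity
  \<open>2 (A N A\<^sup>* - A' N A'\<^sup>*) = (A - A') N (A + A')\<^sup>* + (A + A') N (A - A')\<^sup>*\<close>. For symmetric \<open>N\<close> the two
  terms on the right are adjoint to each other, and the norms of \<open>L\<^sub>1\<close> and \<open>L\<^sub>2\<close> are invariant under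
  adjoints, so that \<open>A N A\<^sup>* - A' N A'\<^sup>*\<close> is bounded in norm by \<open>(A - A') N (A + A')\<^sup>*\<close>. This accounts for the
  initial term (\<open>N\<close> is the initial covariance) and for the noise term.

  In the drift, \<open>K - Khat\<close> is split off first: \<open>S F (K - Khat) S\<^sup>*\<close> and its adjoint give the term with the
  factor 2. What remains is \<open>S F Khat S\<^sup>* - St F Khat St\<^sup>*\<close> plus its adjoint, to which the same identity applies,
  now with different operators on the two sides of \<open>Khat\<close>; it gives the two terms
  \<open>R\<^sub>- F Khat R\<^sub>+\<^sup>*\<close> and \<open>R\<^sub>+ F Khat R\<^sub>-\<^sup>*\<close>.

  Three points need an argument.

  \<^item> The second drift term is the adjoint of the first only if \<open>K\<close> is symmetric. This follows from uniqueness: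
    \<open>K\<^sup>*\<close> solves the same equation (\<open>trace_adjoint_lyapunov_rhs\<close>), and two continuous solutions agree by a
    Gronwall argument with an integrable convolution kernel (\<open>lyapunov_solution_unique\<close>).

  \<^item> The noise term has to be brought into the form \<open>A N A\<^sup>*\<close>. With \<open>D = B Q\<^sup>1\<^sup>/\<^sup>2\<close>, which is a Hilbert-Schmidt
    operator on \<open>U\<close>, one has \<open>(A B) (C B)\<^sup>* = A (D D\<^sup>*) C\<^sup>*\<close>, where the adjoint on the left is that of operators
    on \<open>U\<^sub>0\<close> (\<open>hs_times_adj_eq_sandwich\<close>). So the noise is the trace class operator \<open>D D\<^sup>*\<close> on the larger space.

  \<^item> To add up the upper integrals one needs measurable integrands. Strong measurability of the operator families
    suffices: \<open>A N C\<^sup>*\<close> is explicit for \<open>N\<close> of rank one, and finite rank operators are dense in \<open>L\<^sub>1\<close>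
    (\<open>borel_measurable_sandwich\<close>).
\<close>

section \<open>Adjoints of trace class operators\<close>

lemma hs_adjoint:
  fixes X :: "'a::{real_inner,banach} \<Rightarrow>\<^sub>L 'b::{real_inner,banach}"
  assumes X: "((\<lambda>f. (norm (X f))\<^sup>2) has_sum s) ob"
  shows "\<exists>r\<le>s. ((\<lambda>f. (norm (adj X f))\<^sup>2) has_sum r) ob"
proof -
  have "(norm (id_blinfun :: 'b \<Rightarrow>\<^sub>L 'b))\<^sup>2 * s \<le> 1 * s"
    using has_sum_nonneg[OF X] by (intro mult_right_mono power_le_one norm_blinfun_id_le) auto
  then have "infsum (\<lambda>e. (norm (adj X e))\<^sup>2) ob \<le> s"
    using hs_adj(2)[OF X, of id_blinfun] by simp
  moreover have "((\<lambda>f. (norm (adj X f))\<^sup>2) has_sum infsum (\<lambda>e. (norm (adj X e))\<^sup>2) ob) ob"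
    using hs_adj(1)[OF X, of id_blinfun] by (intro has_sum_infsum) simp
  ultimately show ?thesis by blast
qed

text \<open>
  A trace class operator is a product \<open>X Y\<close> of two Hilbert-Schmidt operators, and so is its adjoint \<open>Y\<^sup>* X\<^sup>*\<close>.
\<close>

lemma trace_class_adj:
  fixes A :: "'a::{real_inner,banach} \<Rightarrow>\<^sub>L 'a"
  assumes "trace_class_op A"
  shows "trace_class_op (adj A)" "trace_norm (adj A) \<le> trace_norm A"
proof -
  obtain X Y s where XY: "A = X o\<^sub>L Y" "((\<lambda>f. (norm (blinfun_apply X f))\<^sup>2) has_sum s) ob" "s \<le> trace_norm A"
    "((\<lambda>f. (norm (blinfun_apply (Y :: 'a \<Rightarrow>\<^sub>L 'a) f))\<^sup>2) has_sum trace_norm A) ob"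
    using trace_class_factor[OF assms(1)] by blast
  obtain r where r: "r \<le> s" "((\<lambda>f. (norm (adj X f))\<^sup>2) has_sum r) ob"
    using hs_adjoint[OF XY(2)] by blast
  obtain q where q: "q \<le> trace_norm A" "((\<lambda>f. (norm (adj Y f))\<^sup>2) has_sum q) ob"
    using hs_adjoint[OF XY(4)] by blast
  have eq: "adj A = adj Y o\<^sub>L adj X" by (simp add: XY(1) adj_compose)
  note t = trace_class_product[OF q(2) r(2), folded eq]
  show "trace_class_op (adj A)" by (rule t)
  have "sqrt q * sqrt r \<le> sqrt (trace_norm A) * sqrt (trace_norm A)"
    using r q XY(3) trace_norm_nonneg[of A] has_sum_nonneg[OF r(2)] by (intro mult_mono) auto
  then show "trace_norm (adj A) \<le> trace_norm A" using t(2) trace_norm_nonneg[of A] by simp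
qed

lift_definition trace_adjoint :: "'a::separable_hilbert trace_class \<Rightarrow> 'a trace_class" is adj
  by (rule trace_class_adj)

lemma trace_adjoint_adjoint: "trace_adjoint (trace_adjoint A) = A"
  by transfer (rule adj_adj)

lemma norm_trace_adjoint: "norm (trace_adjoint A) = norm A"
proof -
  have "norm (trace_adjoint A) \<le> norm A" for A :: "'a trace_class"
    by transfer (rule trace_class_adj)
  then show ?thesis by (metis trace_adjoint_adjoint antisym)
qed

lemma bounded_linear_trace_adjoint: "bounded_linear trace_adjoint"
proof (rule bounded_linear_intro[where K = 1])
  show "trace_adjoint (A + B) = trace_adjoint A + trace_adjoint B" for A B :: "'a trace_class"
    by transfer (rule adj_add)
  show "trace_adjoint (r *\<^sub>R A) = r *\<^sub>R trace_adjoint A" for r and A :: "'a trace_class"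
    by transfer (rule blinfun_eqI_inner, simp add: inner_adj' blinfun.bilinear_simps)
qed (simp add: norm_trace_adjoint)

lemma trace_adjoint_sym: "op_of A \<in> Sigma_sym \<Longrightarrow> trace_adjoint A = A"
  by (rule trace_class_eqI, rule vector_eq_rdot[THEN iffD1])
    (auto simp: trace_adjoint.rep_eq inner_adj' Sigma_sym_def)

lemma sandwich_apply: "op_of (sandwich A K C) x = A (op_of K (adj C x))"
  by (simp add: sandwich.rep_eq)

lemma sandwich_add:
  "sandwich (A + A') K C = sandwich A K C + sandwich A' K C"
  "sandwich A (K + K') C = sandwich A K C + sandwich A K' C"
  "sandwich A K (C + C') = sandwich A K C + sandwich A K C'"
  by (rule trace_class_eqI; simp add: sandwich_apply plus_trace_class.rep_eq blinfun.bilinear_simps adj_add)+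

lemma adj_minus: "adj (- A) = - adj A"
  for A :: "'a::{real_inner,banach} \<Rightarrow>\<^sub>L 'b::real_inner"
  by (rule blinfun_eqI_inner) (simp add: inner_adj' uminus_blinfun.rep_eq)

lemma sandwich_minus:
  "sandwich (- A) K C = - sandwich A K C"
  "sandwich A (- K) C = - sandwich A K C"
  "sandwich A K (- C) = - sandwich A K C"
  by (rule trace_class_eqI; simp add: sandwich_apply uminus_trace_class.rep_eq blinfun.bilinear_simps adj_minus)+

lemma sandwich_diff:
  "sandwich (A - A') K C = sandwich A K C - sandwich A' K C"
  "sandwich A (K - K') C = sandwich A K C - sandwich A K' C"
  "sandwich A K (C - C') = sandwich A K C - sandwich A K C'"
  unfolding diff_conv_add_uminus sandwich_add sandwich_minus by simp_all

lemma norm_sandwich: "norm (sandwich A K C) \<le> norm A * norm K * norm C"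
  by (transfer, rule order_trans[OF trace_class_compose(2)]) (simp_all add: norm_adj)

lemma bounded_linear_sandwich: "bounded_linear (\<lambda>K. sandwich A K C)"
proof (rule bounded_linear_intro[where K = "norm A * norm C"])
  show "sandwich A (r *\<^sub>R K) C = r *\<^sub>R sandwich A K C" for r K
    by (rule trace_class_eqI) (simp add: sandwich_apply scaleR_trace_class.rep_eq blinfun.bilinear_simps)
  show "norm (sandwich A K C) \<le> norm K * (norm A * norm C)" for K
    using norm_sandwich[of A K C] by (simp add: mult_ac)
qed (rule sandwich_add)

lemma trace_adjoint_sandwich: "trace_adjoint (sandwich A K C) = sandwich C (trace_adjoint K) A"
  by transfer (simp add: adj_compose adj_adj blinfun_compose_assoc')

lemma sandwich_rank1: "sandwich A (rank1 a b) C = rank1 (C a) (A b)"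
  by (rule trace_class_eqI) (simp add: sandwich_apply rank1_apply blinfun.bilinear_simps inner_adj)

text \<open>
  The mixed terms \<open>A K C'\<^sup>*\<close> and \<open>A' K C\<^sup>*\<close> cancel on the right.
\<close>

lemma sandwich_diff_symmetrized:
  "2 *\<^sub>R (sandwich A K C - sandwich A' K C')
    = sandwich (A - A') K (C + C') + sandwich (A + A') K (C - C')"
  by (simp add: sandwich_add sandwich_diff scaleR_2)

section \<open>The trace norm and the Hilbert-Schmidt norm on trace class operators\<close>

lemma norm_op_of: "norm (op_of A) \<le> norm A"
  by transfer (rule norm_le_trace_norm)

lemma bounded_linear_op_of_apply: "bounded_linear (\<lambda>A. op_of A x)"
proof (rule bounded_linear_intro[where K = "norm x"])
  show "norm (op_of A x) \<le> norm A * norm x" for A :: "'a trace_class"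
    by (rule order_trans[OF norm_blinfun]) (intro mult_right_mono norm_op_of norm_ge_zero)
qed (simp_all add: plus_trace_class.rep_eq scaleR_trace_class.rep_eq blinfun.bilinear_simps)

text \<open>
  A factorization \<open>A = X Y\<close> into Hilbert-Schmidt operators whose squared norms are at most the trace norm of \<open>A\<close>
  gives \<open>\<parallel>A e\<parallel> \<le> \<parallel>X\<parallel> \<parallel>Y e\<parallel>\<close>, and this is square summable in \<open>e\<close>.
\<close>

lemma hilbert_schmidt_of_trace_class:
  fixes A :: "'a::separable_hilbert trace_class"
  shows "((\<lambda>e. (norm (op_of A e))\<^sup>2) has_sum (L_norm 2 A)\<^sup>2) ob" "L_norm 2 A \<le> norm A" "0 \<le> L_norm 2 A"
proof -
  obtain X Y s where XY: "op_of A = X o\<^sub>L Y" "((\<lambda>f. (norm (blinfun_apply X f))\<^sup>2) has_sum s) ob"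
    "s \<le> trace_norm (op_of A)"
    "((\<lambda>f. (norm (blinfun_apply (Y :: 'a \<Rightarrow>\<^sub>L 'a) f))\<^sup>2) has_sum trace_norm (op_of A)) ob"
    using trace_class_factor[OF trace_class_op_of] by blast
  let ?t = "norm A"
  note XY(3,4)[folded norm_trace_class.rep_eq]
  have X: "(norm X)\<^sup>2 \<le> ?t"
    using norm_le_hs[OF XY(2)] XY(3) has_sum_nonneg[OF XY(2)]
    by (simp add: norm_trace_class.rep_eq real_le_rsqrt sqrt_le_D order_trans
        flip: real_sqrt_le_iff[of "(norm X)\<^sup>2"])
  have Y: "((\<lambda>e. ?t * (norm (Y e))\<^sup>2) has_sum ?t * ?t) ob"
    using has_sum_cmult_right[OF XY(4), of ?t] by (simp add: norm_trace_class.rep_eq)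
  have le: "(norm (op_of A e))\<^sup>2 \<le> ?t * (norm (Y e))\<^sup>2" for e
  proof -
    have "(norm (op_of A e))\<^sup>2 \<le> (norm X * norm (Y e))\<^sup>2"
      using norm_blinfun[of X "Y e"] by (intro power_mono) (simp_all add: XY(1))
    also have "\<dots> \<le> ?t * (norm (Y e))\<^sup>2" 
      using X by (simp add: power_mult_distrib mult_right_mono)
    finally show ?thesis .
  qed
  have sm: "(\<lambda>e. (norm (op_of A e))\<^sup>2) summable_on ob"
    by (rule summable_on_comparison_test[OF has_sum_imp_summable[OF Y]]) (use le in auto)
  have nn: "0 \<le> infsum (\<lambda>e. (norm (op_of A e))\<^sup>2) ob" by (rule infsum_nonneg) simp
  then show hs: "((\<lambda>e. (norm (op_of A e))\<^sup>2) has_sum (L_norm 2 A)\<^sup>2) ob"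
    using has_sum_infsum[OF sm] by (simp add: L_norm_def hs_norm_def)
  show "0 \<le> L_norm 2 A" using nn by (simp add: L_norm_def hs_norm_def)
  have "(L_norm 2 A)\<^sup>2 \<le> ?t\<^sup>2"
    unfolding power2_eq_square[of ?t] by (rule has_sum_mono[OF hs Y le])
  then show "L_norm 2 A \<le> norm A" by (rule power2_le_imp_le) simp
qed

lemma L2_set_le_L_norm:
  assumes "finite F" "F \<subseteq> ob"
  shows "L2_set (\<lambda>e. norm (op_of A e)) F \<le> L_norm 2 A"
proof -
  have "(\<Sum>e\<in>F. (norm (op_of A e))\<^sup>2) \<le> (L_norm 2 A)\<^sup>2"
    by (rule finite_sum_le_has_sum[OF hilbert_schmidt_of_trace_class(1) assms(1)]) (use assms in auto)
  then show ?thesis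
    unfolding L2_set_def by (rule real_le_lsqrt[rotated]) (rule hilbert_schmidt_of_trace_class)
qed

lemma L_norm_2_leI:
  assumes "\<And>F. finite F \<Longrightarrow> F \<subseteq> ob \<Longrightarrow> L2_set (\<lambda>e. norm (op_of A e)) F \<le> c"
  shows "L_norm 2 A \<le> c"
proof -
  have c: "0 \<le> c" using assms[of "{}"] by simp
  have "(L_norm 2 A)\<^sup>2 \<le> c\<^sup>2"
    using hilbert_schmidt_of_trace_class(1)
  proof (rule has_sum_le_finite_sums)
    fix F :: "'a set" assume "finite F" "F \<subseteq> ob"
    from assms[OF this] show "(\<Sum>e\<in>F. (norm (op_of A e))\<^sup>2) \<le> c\<^sup>2"
      unfolding L2_set_def by (rule sqrt_le_D)
  qed
  then show ?thesis using c by (rule power2_le_imp_le)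
qed

text \<open>
  The trace norm and the Hilbert-Schmidt norm have the same formal properties; this rule proves each of
  them for both at once.
\<close>

lemma L_norm_cases:
  fixes P :: "('a::separable_hilbert trace_class \<Rightarrow> real) \<Rightarrow> bool"
  assumes "i \<in> {1, 2}" "P norm" "P (L_norm 2)"
  shows "P (L_norm i)"
proof (cases "i = 1")
  case True
  then have "L_norm i = (norm :: 'a trace_class \<Rightarrow> real)" by (auto simp: L_norm_def)
  with assms show ?thesis by simp
qed (use assms in auto)

context
  fixes i :: nat
  assumes i: "i \<in> {1, 2}"
begin

lemma L_norm_nonneg: "0 \<le> L_norm i A"
  by (rule L_norm_cases[OF i]) (simp_all add: hilbert_schmidt_of_trace_class)

lemma L_norm_le_norm: "L_norm i A \<le> norm A"
  by (rule L_norm_cases[OF i]) (simp_all add: hilbert_schmidt_of_trace_class)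

lemma L_norm_triangle: "L_norm i (A + B) \<le> L_norm i A + L_norm i B"
proof (rule L_norm_cases[OF i])
  show "L_norm 2 (A + B) \<le> L_norm 2 A + L_norm 2 B"
  proof (rule L_norm_2_leI)
    fix F :: "'a set" assume F: "finite F" "F \<subseteq> ob"
    have "L2_set (\<lambda>e. norm (op_of (A + B) e)) F \<le> L2_set (\<lambda>e. norm (op_of A e) + norm (op_of B e)) F"
      by (rule L2_set_mono) (auto simp: plus_trace_class.rep_eq blinfun.bilinear_simps norm_triangle_ineq)
    also have "\<dots> \<le> L2_set (\<lambda>e. norm (op_of A e)) F + L2_set (\<lambda>e. norm (op_of B e)) F"
      by (rule L2_set_triangle_ineq)
    also have "\<dots> \<le> L_norm 2 A + L_norm 2 B" by (intro add_mono L2_set_le_L_norm F)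
    finally show "L2_set (\<lambda>e. norm (op_of (A + B) e)) F \<le> L_norm 2 A + L_norm 2 B" .
  qed
qed (rule norm_triangle_ineq)

lemma L_norm_scaleR: "L_norm i (r *\<^sub>R A) = \<bar>r\<bar> * L_norm i A"
proof (rule L_norm_cases[OF i])
  have "infsum (\<lambda>e. (norm (op_of (r *\<^sub>R A) e))\<^sup>2) ob = infsum (\<lambda>e. r\<^sup>2 * (norm (op_of A e))\<^sup>2) ob"
    by (rule infsum_cong) (simp add: scaleR_trace_class.rep_eq blinfun.bilinear_simps power_mult_distrib)
  also have "\<dots> = r\<^sup>2 * infsum (\<lambda>e. (norm (op_of A e))\<^sup>2) ob"
    by (rule infsum_cmult_right')
  finally show "L_norm 2 (r *\<^sub>R A) = \<bar>r\<bar> * L_norm 2 A"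
    by (simp add: L_norm_def hs_norm_def real_sqrt_mult)
qed simp

lemma L_norm_trace_adjoint: "L_norm i (trace_adjoint A) = L_norm i A"
proof (rule L_norm_cases[OF i])
  have "L_norm 2 (trace_adjoint A) \<le> L_norm 2 A" for A :: "'a trace_class"
  proof -
    obtain r where "r \<le> (L_norm 2 A)\<^sup>2" "((\<lambda>f. (norm (adj (op_of A) f))\<^sup>2) has_sum r) ob"
      using hs_adjoint[OF hilbert_schmidt_of_trace_class(1)] by blast
    moreover from this(2) have "(L_norm 2 (trace_adjoint A))\<^sup>2 = r"
      using hilbert_schmidt_of_trace_class(1)[of "trace_adjoint A"]
      by (simp add: trace_adjoint.rep_eq has_sum_unique)
    ultimately have "(L_norm 2 (trace_adjoint A))\<^sup>2 \<le> (L_norm 2 A)\<^sup>2" by simp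
    then show ?thesis by (rule power2_le_imp_le) (rule hilbert_schmidt_of_trace_class)
  qed
  then show "L_norm 2 (trace_adjoint A) = L_norm 2 A" by (metis trace_adjoint_adjoint antisym)
qed (rule norm_trace_adjoint)

text \<open>
  A seminorm dominated by the trace norm is Lipschitz continuous.
\<close>

lemma continuous_on_L_norm: "continuous_on UNIV (L_norm i :: 'a::separable_hilbert trace_class \<Rightarrow> real)"
proof (rule continuous_at_imp_continuous_on, rule ballI)
  have le: "L_norm i A - L_norm i B \<le> norm (A - B)" for A B :: "'a trace_class"
    using L_norm_triangle[of "A - B" B] L_norm_le_norm[of "A - B"] by simp
  fix A :: "'a trace_class"
  show "isCont (L_norm i) A"
    unfolding continuous_at_eps_delta dist_norm
  proof (intro allI impI exI conjI)
    fix r :: real and B assume "0 < r" "norm (B - A) < r"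
    then show "norm (L_norm i B - L_norm i A) < r"
      using le[of A B] le[of B A] by (simp add: norm_minus_commute)
  qed
qed

lemma measurable_L_norm:
  assumes "f \<in> borel_measurable M"
  shows "(\<lambda>x. L_norm i (f x :: 'a::separable_hilbert trace_class)) \<in> borel_measurable M"
  by (rule borel_measurable_continuous_on[OF continuous_on_L_norm assms])

lemma integrable_L_norm:
  fixes f :: "'b \<Rightarrow> 'a::separable_hilbert trace_class"
  assumes f: "integrable M f"
  shows "integrable M (\<lambda>x. L_norm i (f x))"
  by (rule Bochner_Integration.integrable_bound[OF f])
    (auto simp: L_norm_nonneg L_norm_le_norm measurable_L_norm[OF borel_measurable_integrable[OF f]])

end

text \<open>
  For the Hilbert-Schmidt norm this is a duality argument. Pairing \<open>A = \<integral> f\<close> with itself over finitely many basis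
  vectors commutes with the integral, and the Cauchy-Schwarz inequality bounds the result by
  \<open>\<integral> \<parallel>f x\<parallel>\<close> times the norm of \<open>A\<close> over these vectors, by which one divides.
\<close>

lemma L_norm_integral:
  fixes f :: "'b \<Rightarrow> 'a::separable_hilbert trace_class"
  assumes i: "i \<in> {1, 2}" and f: "integrable M f"
  shows "L_norm i (LINT x|M. f x) \<le> (LINT x|M. L_norm i (f x))"
proof (cases "i = 1")
  case True
  then show ?thesis using integral_norm_bound[of M f] by (simp add: L_norm_def)
next
  case False
  with i have i2: "i = 2" by simp
  have 2: "(2::nat) \<in> {1, 2}" by simp
  let ?A = "LINT x|M. f x"
  note p = integrable_L_norm[OF 2 f]
  show ?thesis
    unfolding i2
  proof (rule L_norm_2_leI)
    fix F :: "'a set" assume F: "finite F" "F \<subseteq> ob"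
    let ?L = "L2_set (\<lambda>e. norm (op_of ?A e)) F"
    define g where "g B = (\<Sum>e\<in>F. inner (op_of B e) (op_of ?A e))" for B
    have g: "bounded_linear g"
      unfolding g_def[abs_def]
      by (intro bounded_linear_sum bounded_linear_compose[OF bounded_linear_inner_left]
          bounded_linear_op_of_apply)
    have gle: "g (f x) \<le> L_norm 2 (f x) * ?L" for x
    proof -
      have "g (f x) \<le> (\<Sum>e\<in>F. \<bar>norm (op_of (f x) e)\<bar> * \<bar>norm (op_of ?A e)\<bar>)"
        unfolding g_def by (rule sum_mono) (simp add: norm_cauchy_schwarz)
      also have "\<dots> \<le> L2_set (\<lambda>e. norm (op_of (f x) e)) F * ?L" by (rule L2_set_mult_ineq)
      also have "\<dots> \<le> L_norm 2 (f x) * ?L" by (intro mult_right_mono L2_set_le_L_norm F) simp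
      finally show ?thesis .
    qed
    have "?L * ?L = g ?A"
      by (simp add: g_def L2_set_def power2_norm_eq_inner sum_nonneg flip: power2_eq_square)
    also have "\<dots> = (LINT x|M. g (f x))" by (rule integral_bounded_linear[OF g f, symmetric])
    also have "\<dots> \<le> (LINT x|M. L_norm 2 (f x) * ?L)"
      by (intro integral_mono gle integrable_bounded_linear[OF g f] integrable_mult_left p)
    also have "\<dots> = (LINT x|M. L_norm 2 (f x)) * ?L" by simp
    finally have *: "?L * ?L \<le> (LINT x|M. L_norm 2 (f x)) * ?L" .
    show "?L \<le> (LINT x|M. L_norm 2 (f x))"
    proof (cases "?L = 0")
      case True
      then show ?thesis by (simp add: Bochner_Integration.integral_nonneg L_norm_nonneg[OF 2])
    next
      case False
      then have "0 < ?L" by (simp add: less_le)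
      with * show ?thesis by simp
    qed
  qed
qed

section \<open>Measurability of operator-valued integrands\<close>

lemma AE_lebesgue_on_E:
  assumes "S \<in> sets lebesgue" "AE x in lebesgue_on S. P x"
  obtains N where "negligible N" "\<And>x. x \<in> S \<Longrightarrow> x \<notin> N \<Longrightarrow> P x"
proof -
  have "AE x in lebesgue. x \<in> S \<longrightarrow> P x"
    using assms by (simp add: AE_restrict_space_iff)
  then obtain N where "\<And>x. x \<in> space lebesgue - N \<Longrightarrow> x \<in> S \<longrightarrow> P x" "N \<in> null_sets lebesgue"
    by (rule AE_E3) blast
  then show thesis using that[of N] by (auto simp: negligible_iff_null_sets)
qed

text \<open>
  Lebesgue measure is complete, so whatever happens on \<open>N\<close> does not affect measurability.
\<close>

lemma borel_measurable_continuous_except_negligible: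
  fixes f :: "real \<Rightarrow> 'a::topological_space"
  assumes N: "negligible N" and S: "S \<in> sets lebesgue" and f: "continuous_on (S - N) f"
  shows "f \<in> borel_measurable (lebesgue_on S)"
proof (rule borel_measurableI)
  fix U :: "'a set" assume "open U"
  with f obtain V where V: "open V" "f -` U \<inter> (S - N) = V \<inter> (S - N)"
    by (metis continuous_on_open_invariant)
  have "f -` U \<inter> S = (V \<inter> (S - N)) \<union> (f -` U \<inter> S \<inter> N)" using V(2) by blast
  moreover have "V \<inter> (S - N) \<in> sets lebesgue"
    using V(1) S N by (intro sets.Int sets.Diff) (auto simp: negligible_imp_sets)
  moreover have "f -` U \<inter> S \<inter> N \<in> sets lebesgue"
    by (rule negligible_imp_sets, rule negligible_subset[OF N]) blast
  ultimately have "f -` U \<inter> S \<in> sets lebesgue" by (metis sets.Un)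
  then show "f -` U \<inter> space (lebesgue_on S) \<in> sets (lebesgue_on S)"
    using S by (auto simp: space_lebesgue_on sets_restrict_space_iff)
qed

lemma borel_measurable_AE_continuous:
  fixes f :: "real \<Rightarrow> 'a::topological_space"
  assumes f: "AE r in lebesgue_on {0..T}. continuous (at r within {0..T}) f" and t: "t \<in> {0..T}"
  shows "f \<in> borel_measurable (lebesgue_on {0..t})"
proof -
  obtain N where N: "negligible N" "\<And>r. r \<in> {0..T} \<Longrightarrow> r \<notin> N \<Longrightarrow> continuous (at r within {0..T}) f"
    by (rule AE_lebesgue_on_E[OF _ f]) auto
  have "continuous_on ({0..t} - N) f"
    unfolding continuous_on_eq_continuous_within
    using N(2) t by (auto intro: continuous_within_subset[of _ "{0..T}"])
  then show ?thesis by (intro borel_measurable_continuous_except_negligible[OF N(1)]) auto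
qed

lemma negligible_reflect:
  fixes N :: "real set"
  assumes "negligible N"
  shows "negligible ((\<lambda>x. t - x) ` N)"
  by (rule negligible_differentiable_image_negligible[OF _ assms]) (auto intro!: derivative_intros)

text \<open>
  The integrands depend on \<open>t - s\<close>. The variant \<open>g\<close>, which may differ from \<open>f\<close> at \<open>0\<close>, serves for families
  whose value at time \<open>0\<close> is arbitrary.
\<close>

lemma borel_measurable_AE_continuous_reflect:
  fixes f g :: "real \<Rightarrow> 'a::topological_space"
  assumes f: "AE r in lebesgue_on {0..T}. continuous (at r within {0..T}) f" and t: "t \<in> {0..T}"
    and g: "\<And>r. r \<in> {0<..T} \<Longrightarrow> g r = f r"
  shows "(\<lambda>s. g (t - s)) \<in> borel_measurable (lebesgue_on {0..t})"
proof -
  obtain N where N: "negligible N" "\<And>r. r \<in> {0..T} \<Longrightarrow> r \<notin> N \<Longrightarrow> continuous (at r within {0..T}) f"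
    by (rule AE_lebesgue_on_E[OF _ f]) auto
  \<comment> \<open>the reflected exceptional set; \<open>s = t\<close> is added because \<open>g 0\<close> is arbitrary\<close>
  define N' where "N' = insert t ((\<lambda>x. t - x) ` N)"
  have N': "t - s \<in> {0<..T} - N" if "s \<in> {0..t} - N'" for s
    using that t by (auto simp: N'_def image_iff)
  have "continuous_on ({0<..T} - N) f"
    unfolding continuous_on_eq_continuous_within
    using N(2) by (auto intro: continuous_within_subset[of _ "{0..T}"])
  then have "continuous_on ({0..t} - N') (\<lambda>s. f (t - s))"
    by (rule continuous_on_compose2) (use N' in \<open>auto intro: continuous_intros\<close>)
  then have "continuous_on ({0..t} - N') (\<lambda>s. g (t - s))"
    by (rule continuous_on_cong[THEN iffD1, rotated -1]) (use N' g in auto)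
  moreover have "negligible N'" unfolding N'_def by (simp add: negligible_reflect N(1))
  ultimately show ?thesis by (intro borel_measurable_continuous_except_negligible) auto
qed

text \<open>
  For constant \<open>G\<close> of rank one, \<open>A (a \<otimes> b) C\<^sup>* = C a \<otimes> A b\<close> is a continuous function of the measurable
  maps \<open>C a\<close> and \<open>A b\<close>. Density of the finite rank operators extends this to constant \<open>G\<close>, and approximation
  by simple functions to measurable \<open>G\<close>.
\<close>

lemma borel_measurable_sandwich:
  fixes A C :: "'x \<Rightarrow> 'a::separable_hilbert \<Rightarrow>\<^sub>L 'b::separable_hilbert"
  assumes G: "G \<in> borel_measurable M"
    and A: "\<And>v. (\<lambda>x. A x v) \<in> borel_measurable M" and C: "\<And>v. (\<lambda>x. C x v) \<in> borel_measurable M"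
  shows "(\<lambda>x. sandwich (A x) (G x) (C x)) \<in> borel_measurable M"
proof -
  have r1: "(\<lambda>x. sandwich (A x) (\<Sum>(a, b)\<leftarrow>xs. rank1 a b) (C x)) \<in> borel_measurable M" for xs
  proof (induction xs)
    case Nil
    have "sandwich (A x) 0 (C x) = 0" for x
      by (rule linear_0[OF bounded_linear.linear[OF bounded_linear_sandwich]])
    then show ?case by simp
  next
    case (Cons ab xs)
    obtain a b where ab: "ab = (a, b)" by force
    have "continuous_on UNIV (\<lambda>p. rank1 (fst p) (snd p :: 'b))"
      by (intro bounded_bilinear.continuous_on[OF bounded_bilinear_rank1] continuous_intros)
    then have "(\<lambda>x. rank1 (C x a) (A x b)) \<in> borel_measurable M"
      using borel_measurable_continuous_on[of "\<lambda>p. rank1 (fst p) (snd p :: 'b)" "\<lambda>x. (C x a, A x b)" M] A C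
      by simp
    then show ?case using Cons by (simp add: ab sandwich_add sandwich_rank1)
  qed
  have const: "(\<lambda>x. sandwich (A x) K (C x)) \<in> borel_measurable M" for K
  proof -
    have "K \<in> closure ((\<lambda>xs. \<Sum>(a, b)\<leftarrow>xs. rank1 a b) ` lists (UNIV \<times> UNIV))"
      using trace_class_dense[of "UNIV :: 'a set"] by simp
    then obtain f where f: "\<And>n. f n \<in> (\<lambda>xs. \<Sum>(a, b)\<leftarrow>xs. rank1 a b) ` lists (UNIV \<times> UNIV)" "f \<longlonglongrightarrow> K"
      unfolding closure_sequential by blast
    show ?thesis
    proof (rule borel_measurable_LIMSEQ_metric)
      show "(\<lambda>x. sandwich (A x) (f n) (C x)) \<in> borel_measurable M" for n
        using f(1)[of n] r1 by auto
      show "(\<lambda>n. sandwich (A x) (f n) (C x)) \<longlonglongrightarrow> sandwich (A x) K (C x)" for x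
        by (rule bounded_linear.tendsto[OF bounded_linear_sandwich f(2)])
    qed
  qed
  obtain F where F: "\<And>n. simple_function M (F n)" "\<And>x. x \<in> space M \<Longrightarrow> (\<lambda>n. F n x) \<longlonglongrightarrow> G x"
    using borel_measurable_implies_sequence_metric[OF G, of 0] by blast
  show ?thesis
  proof (rule borel_measurable_LIMSEQ_metric)
    show "(\<lambda>n. sandwich (A x) (F n x) (C x)) \<longlonglongrightarrow> sandwich (A x) (G x) (C x)" if "x \<in> space M" for x
      by (rule bounded_linear.tendsto[OF bounded_linear_sandwich F(2)[OF that]])
    show "(\<lambda>x. sandwich (A x) (F n x) (C x)) \<in> borel_measurable M" for n
    proof (rule measurable_compose_countable'[where I = "F n ` space M" and g = "F n"])
      show "F n \<in> measurable M (count_space (F n ` space M))"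
        using F(1)[of n] by (auto simp: simple_function_def measurable_count_space_eq2)
      show "countable (F n ` space M)"
        using simple_functionD(1)[OF F(1)] by (rule countable_finite)
    qed (rule const)
  qed
qed

lemma borel_measurable_dense_range:
  fixes A :: "'x \<Rightarrow> 'a::real_normed_vector \<Rightarrow>\<^sub>L 'b::real_normed_vector"
  assumes D: "closure D = UNIV" and A: "\<And>v. v \<in> D \<Longrightarrow> (\<lambda>x. A x v) \<in> borel_measurable M"
  shows "(\<lambda>x. A x v) \<in> borel_measurable M"
proof -
  have "v \<in> closure D" using D by simp
  then obtain f where f: "\<And>n. f n \<in> D" "f \<longlonglongrightarrow> v" unfolding closure_sequential by blast
  show ?thesis
  proof (rule borel_measurable_LIMSEQ_metric)
    show "(\<lambda>n. A x (f n)) \<longlonglongrightarrow> A x v" for x by (intro tendsto_intros f)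
  qed (use f A in auto)
qed

text \<open>
  On the dense range of the embedding \<open>j\<close> the extended operators \<open>Rh r\<close> agree with \<open>R r\<close> for \<open>r > 0\<close>; hence
  strong measurability of \<open>R\<close> passes to \<open>Rh\<close> on all of the larger space.
\<close>

lemma borel_measurable_operator_family:
  assumes fam: "operator_family T j R Rh" and dense: "closure (range (blinfun_apply j)) = UNIV"
    and cont: "\<And>v. AE r in lebesgue_on {0..T}. continuous (at r within {0..T}) (\<lambda>r. R r v)"
    and t: "t \<in> {0..T}"
  shows "(\<lambda>s. R (t - s) v) \<in> borel_measurable (lebesgue_on {0..t})"
    and "(\<lambda>s. Rh (t - s) g) \<in> borel_measurable (lebesgue_on {0..t})"
proof -
  show "(\<lambda>s. R (t - s) v) \<in> borel_measurable (lebesgue_on {0..t})"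
    by (rule borel_measurable_AE_continuous_reflect[OF cont t]) simp
  show "(\<lambda>s. Rh (t - s) g) \<in> borel_measurable (lebesgue_on {0..t})"
  proof (rule borel_measurable_dense_range[OF dense])
    fix u assume "u \<in> range j"
    then obtain v where u: "u = j v" by blast
    show "(\<lambda>s. Rh (t - s) u) \<in> borel_measurable (lebesgue_on {0..t})"
      by (rule borel_measurable_AE_continuous_reflect[OF cont[of v] t, of "\<lambda>r. Rh r u"])
        (use fam in \<open>auto simp: operator_family_def u\<close>)
  qed
qed

section \<open>The covariance of the noise\<close>

text \<open>
  By Zorn's lemma there is a maximal orthonormal set; a vector orthogonal to it would, once normalized, enlarge it.
\<close>

lemma is_onb_onb:
  fixes ip :: "'a::real_vector \<Rightarrow> 'a \<Rightarrow> real"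
  assumes V: "subspace V"
    and sym: "\<And>u v. u \<in> V \<Longrightarrow> v \<in> V \<Longrightarrow> ip u v = ip v u"
    and scale: "\<And>r u v. u \<in> V \<Longrightarrow> v \<in> V \<Longrightarrow> ip (r *\<^sub>R u) v = r * ip u v"
    and pos: "\<And>v. v \<in> V \<Longrightarrow> v \<noteq> 0 \<Longrightarrow> 0 < ip v v"
  shows "is_onb V ip (onb V ip)"
proof -
  define OS where "OS = {E. E \<subseteq> V \<and> (\<forall>e\<in>E. \<forall>f\<in>E. ip e f = (if e = f then 1 else 0))}"
  have "\<exists>M\<in>OS. \<forall>X\<in>OS. M \<subseteq> X \<longrightarrow> X = M"
  proof (rule subset_Zorn')
    fix C assume C: "subset.chain OS C"
    have "ip e f = (if e = f then 1 else 0)" if ef: "e \<in> \<Union>C" "f \<in> \<Union>C" for e f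
    proof -
      obtain X Y where XY: "X \<in> C" "e \<in> X" "Y \<in> C" "f \<in> Y" using ef by blast
      then have "X \<subseteq> Y \<or> Y \<subseteq> X" "X \<in> OS" "Y \<in> OS" using C by (auto simp: subset_chain_def)
      then obtain Z where "Z \<in> OS" "e \<in> Z" "f \<in> Z" using XY by blast
      then show ?thesis by (simp add: OS_def)
    qed
    moreover have "\<Union>C \<subseteq> V" using C by (auto simp: subset_chain_def OS_def)
    ultimately show "\<Union>C \<in> OS" by (simp add: OS_def)
  qed
  then obtain M where M: "M \<in> OS" "\<And>X. X \<in> OS \<Longrightarrow> M \<subseteq> X \<Longrightarrow> X = M" by blast
  have "v = 0" if v: "v \<in> V" "\<forall>e\<in>M. ip v e = 0" for v
  proof (rule ccontr)
    assume "v \<noteq> 0"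
    define n where "n = (1 / sqrt (ip v v)) *\<^sub>R v"
    have p: "0 < ip v v" by (rule pos[OF v(1) \<open>v \<noteq> 0\<close>])
    have nV: "n \<in> V" unfolding n_def using V v(1) by (rule subspace_scale)
    have MV: "e \<in> V" if "e \<in> M" for e using M(1) that by (auto simp: OS_def)
    have nn: "ip n n = 1"
    proof -
      have "ip n n = (1 / sqrt (ip v v)) * ip v n"
        using scale[OF v(1) nV, of "1 / sqrt (ip v v)"] by (simp add: n_def)
      also have "ip v n = ip n v" by (rule sym[OF v(1) nV])
      also have "ip n v = (1 / sqrt (ip v v)) * ip v v"
        unfolding n_def by (rule scale[OF v(1) v(1)])
      finally show ?thesis using p by (simp add: real_div_sqrt)
    qed
    have "ip n e = 0" "ip e n = 0" if "e \<in> M" for e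
    proof -
      show "ip n e = 0" unfolding n_def using scale[OF v(1) MV[OF that]] v(2) that by simp
      then show "ip e n = 0" using sym[OF nV MV[OF that]] by simp
    qed
    then have "insert n M \<in> OS" using M(1) nn nV unfolding OS_def by auto
    then have "n \<in> M" using M(2) by blast
    then have "ip v n = 0" using v by blast
    then have "ip n v = 0" using sym[OF v(1) nV] by simp
    then show False using scale[OF v(1) v(1), of "1 / sqrt (ip v v)"] p by (simp add: n_def)
  qed
  then have "is_onb V ip M" using M(1) by (auto simp: is_onb_def OS_def)
  then show ?thesis unfolding onb_def by (rule someI)
qed

text \<open>
  The finite partial sums of the expansion of \<open>x\<close> are best approximations of \<open>x\<close> in the span of their basis vectors.
\<close>

lemma parseval_closure_span:
  fixes x :: "'a::{real_inner,banach}"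
  assumes E: "\<And>e f. e \<in> E \<Longrightarrow> f \<in> E \<Longrightarrow> inner e f = (if e = f then 1 else 0)"
    and x: "x \<in> closure (span E)"
  shows "((\<lambda>e. (inner x e)\<^sup>2) has_sum (norm x)\<^sup>2) E"
proof -
  have orth: "inner (x - (\<Sum>e\<in>G. inner x e *\<^sub>R e)) w = 0" if G: "finite G" "G \<subseteq> E" "w \<in> span G" for G w
  proof -
    let ?z = "x - (\<Sum>e\<in>G. inner x e *\<^sub>R e)"
    have "inner ?z e = 0" if "e \<in> G" for e
    proof -
      have "inner (\<Sum>f\<in>G. inner x f *\<^sub>R f) e = (\<Sum>f\<in>G. if f = e then inner x e else 0)"
        unfolding inner_sum_left by (rule sum.cong) (use that G(2) in \<open>auto simp: subset_iff E\<close>)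
      then show ?thesis using that G(1) by (simp add: inner_simps)
    qed
    then have "G \<subseteq> {w. inner ?z w = 0}" by blast
    moreover have "subspace {w. inner ?z w = 0}" by (simp add: subspace_def inner_simps)
    ultimately have "span G \<subseteq> {w. inner ?z w = 0}" by (rule span_minimal)
    then show ?thesis using G(3) by blast
  qed
  have "((\<lambda>e. inner x e *\<^sub>R e) has_sum x) E"
    unfolding has_sum_metric
  proof (intro allI impI)
    fix r :: real assume "0 < r"
    then obtain y where y: "y \<in> span E" "dist y x < r" using x closure_approachable by blast
    then obtain t c where t: "finite t" "t \<subseteq> E" "y = (\<Sum>a\<in>t. c a *\<^sub>R a)"
      unfolding span_explicit by blast
    have "dist (\<Sum>e\<in>G. inner x e *\<^sub>R e) x < r" if G: "finite G" "t \<subseteq> G" "G \<subseteq> E" for G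
    proof -
      let ?z = "\<Sum>e\<in>G. inner x e *\<^sub>R e"
      have "y \<in> span G" unfolding t(3) using G(2) by (intro span_sum span_scale span_base) blast
      moreover have "?z \<in> span G" by (intro span_sum span_scale span_base)
      ultimately have "inner (x - ?z) (?z - y) = 0" using orth[OF G(1,3)] span_diff by blast
      then have "(norm ((x - ?z) + (?z - y)))\<^sup>2 = (norm (x - ?z))\<^sup>2 + (norm (?z - y))\<^sup>2"
        by (intro norm_add_Pythagorean) (simp add: orthogonal_def)
      then have "(norm (x - ?z))\<^sup>2 \<le> (norm (x - y))\<^sup>2" by simp
      then have "norm (x - ?z) \<le> norm (x - y)" by simp
      then show ?thesis using y(2) by (simp add: dist_norm norm_minus_commute)
    qed
    then show "\<exists>X. finite X \<and> X \<subseteq> E \<and> (\<forall>Y. finite Y \<and> X \<subseteq> Y \<and> Y \<subseteq> E \<longrightarrow> dist (\<Sum>e\<in>Y. inner x e *\<^sub>R e) x < r)"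
      using t by blast
  qed
  from has_sum_bounded_linear[OF bounded_linear_inner_right[of x] this] show ?thesis
    by (simp add: o_def power2_eq_square power2_norm_eq_inner flip: power2_norm_eq_inner)
qed

definition orth_kernel :: "('a::real_inner \<Rightarrow>\<^sub>L 'b::real_normed_vector) \<Rightarrow> 'a set" where
  "orth_kernel A = {x. \<forall>z. A z = 0 \<longrightarrow> inner x z = 0}"

lemma pinv_eqI:
  fixes A :: "'a::real_inner \<Rightarrow>\<^sub>L 'b::real_normed_vector"
  assumes "A x = y" "x \<in> orth_kernel A"
  shows "pinv A y = x"
  unfolding pinv_def
proof (rule the_equality)
  fix x' assume x': "A x' = y \<and> (\<forall>z. A z = 0 \<longrightarrow> inner x' z = 0)"
  then have "A (x' - x) = 0" using assms(1) by (simp add: blinfun.bilinear_simps)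
  then have "inner x' (x' - x) = 0" "inner x (x' - x) = 0" using x' assms(2) by (auto simp: orth_kernel_def)
  then have "inner (x' - x) (x' - x) = 0" by (simp add: inner_diff_left)
  then show "x' = x" by simp
qed (use assms in \<open>auto simp: orth_kernel_def\<close>)

lemma pinv:
  fixes A :: "'a::{real_inner,banach} \<Rightarrow>\<^sub>L 'b::real_normed_vector"
  shows "A (pinv A (A x)) = A x" "pinv A (A x) \<in> orth_kernel A"
proof -
  have "subspace {z. A z = 0}" by (simp add: subspace_def blinfun.bilinear_simps)
  moreover have "closed {z. A z = 0}" by (intro closed_Collect_eq continuous_intros)
  ultimately obtain p where p: "A p = 0" "\<And>z. A z = 0 \<Longrightarrow> inner (x - p) z = 0"
    using hilbert_projection[of "{z. A z = 0}" x] by auto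
  have "pinv A (A x) = x - p"
    by (rule pinv_eqI) (use p in \<open>auto simp: orth_kernel_def blinfun.bilinear_simps\<close>)
  then show "A (pinv A (A x)) = A x" "pinv A (A x) \<in> orth_kernel A"
    using p by (auto simp: orth_kernel_def blinfun.bilinear_simps)
qed

lemma inner_pinv:
  fixes A :: "'a::{real_inner,banach} \<Rightarrow>\<^sub>L 'b::real_normed_vector"
  assumes "x \<in> orth_kernel A"
  shows "inner (pinv A (A w)) x = inner w x"
proof -
  have "A (w - pinv A (A w)) = 0" by (simp add: blinfun.bilinear_simps pinv)
  then have "inner x (w - pinv A (A w)) = 0" using assms by (auto simp: orth_kernel_def)
  then show ?thesis by (simp add: inner_simps inner_commute)
qed

lemma norm_pinv_le:
  fixes A :: "'a::{real_inner,banach} \<Rightarrow>\<^sub>L 'b::real_normed_vector"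
  shows "norm (pinv A (A w)) \<le> norm w"
proof -
  have "(norm (pinv A (A w)))\<^sup>2 = inner w (pinv A (A w))"
    using inner_pinv[OF pinv(2)] by (metis power2_norm_eq_inner)
  also have "\<dots> \<le> norm w * norm (pinv A (A w))" by (rule norm_cauchy_schwarz)
  finally show ?thesis
    by (cases "norm (pinv A (A w)) = 0") (auto simp: power2_eq_square dest: mult_right_le_imp_le)
qed

lemma is_onb_U0: "is_onb (U0 Q) (inner_U0 Q) (onb (U0 Q) (inner_U0 Q))"
  for Q :: "'u::{real_inner,banach} \<Rightarrow>\<^sub>L 'u"
proof (rule is_onb_onb)
  let ?R = "sqrt_op Q"
  show "subspace (U0 Q)" unfolding U0_def
    by (simp add: linear_subspace_image blinfun.bounded_linear_right bounded_linear.linear)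
  show "inner_U0 Q u v = inner_U0 Q v u" for u v by (simp add: inner_U0_def inner_commute)
  fix u v :: 'u assume u: "u \<in> U0 Q"
  have scale: "pinv ?R (r *\<^sub>R u) = r *\<^sub>R pinv ?R u" for r
    by (rule pinv_eqI)
      (use u pinv[of ?R] in \<open>auto simp: U0_def orth_kernel_def blinfun.bilinear_simps\<close>)
  then show "inner_U0 Q (r *\<^sub>R u) v = r * inner_U0 Q u v" for r by (simp add: inner_U0_def)
  show "0 < inner_U0 Q u u" if "u \<noteq> 0"
  proof -
    have "pinv ?R u \<noteq> 0"
    proof
      assume "pinv ?R u = 0"
      moreover have "?R (pinv ?R u) = u" using u pinv(1)[of ?R] by (auto simp: U0_def)
      ultimately show False using that by simp
    qed
    then show ?thesis by (simp add: inner_U0_def)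
  qed
qed

text \<open>
  The pseudoinverse of \<open>Q\<^sup>1\<^sup>/\<^sup>2\<close> maps \<open>U\<^sub>0\<close> isometrically onto the orthogonal complement of the kernel of \<open>Q\<^sup>1\<^sup>/\<^sup>2\<close>,
  and hence an orthonormal basis of the one to an orthonormal basis of the other.
\<close>

lemma parseval_U0:
  fixes Q :: "'u::{real_inner,banach} \<Rightarrow>\<^sub>L 'u"
  assumes w: "w \<in> orth_kernel (sqrt_op Q)"
  shows "((\<lambda>e. (inner w (pinv (sqrt_op Q) e))\<^sup>2) has_sum (norm w)\<^sup>2) (onb (U0 Q) (inner_U0 Q))"
proof -
  let ?R = "sqrt_op Q"
  define E where "E = onb (U0 Q) (inner_U0 Q)"
  have onb: "E \<subseteq> U0 Q" "\<And>e f. e \<in> E \<Longrightarrow> f \<in> E \<Longrightarrow> inner_U0 Q e f = (if e = f then 1 else 0)"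
    "\<And>v. v \<in> U0 Q \<Longrightarrow> (\<And>e. e \<in> E \<Longrightarrow> inner_U0 Q v e = 0) \<Longrightarrow> v = 0"
    using is_onb_U0[of Q, folded E_def] unfolding is_onb_def by (simp_all add: subset_iff)
  have R: "?R (pinv ?R e) = e" "pinv ?R e \<in> orth_kernel ?R" if "e \<in> E" for e
    using onb(1) that pinv[of ?R] by (auto simp: U0_def)
  have inj: "inj_on (pinv ?R) E" by (rule inj_on_inverseI[of _ "?R"]) (rule R)
  have on: "inner e f = (if e = f then 1 else 0)" if ef: "e \<in> pinv ?R ` E" "f \<in> pinv ?R ` E" for e f
  proof -
    obtain e' f' where "e' \<in> E" "e = pinv ?R e'" "f' \<in> E" "f = pinv ?R f'" using ef by blast
    then show ?thesis using onb(2)[of e' f'] inj_on_eq_iff[OF inj, of e' f'] by (simp add: inner_U0_def)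
  qed
  have "w \<in> closure (span (pinv ?R ` E))"
  proof -
    obtain p where p: "p \<in> closure (span (pinv ?R ` E))"
      "\<And>m. m \<in> closure (span (pinv ?R ` E)) \<Longrightarrow> inner (w - p) m = 0"
      using hilbert_projection[OF subspace_closure'[OF subspace_span[of "pinv ?R ` E"]]] by blast
    have "orth_kernel ?R = (\<Inter>z\<in>{z. ?R z = 0}. {x. inner x z = 0})"
      by (auto simp: orth_kernel_def)
    then have "closed (orth_kernel ?R)"
      by (auto intro!: closed_INT closed_Collect_eq continuous_intros)
    moreover have sub: "subspace (orth_kernel ?R)" by (simp add: subspace_def orth_kernel_def inner_simps)
    moreover have "pinv ?R ` E \<subseteq> orth_kernel ?R" using R by blast
    ultimately have "closure (span (pinv ?R ` E)) \<subseteq> orth_kernel ?R"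
      by (intro closure_minimal span_minimal)
    then have wp: "w - p \<in> orth_kernel ?R" using p(1) by (intro subspace_diff[OF sub w]) (rule subsetD)
    have "?R (w - p) = 0"
    proof (rule onb(3))
      show "?R (w - p) \<in> U0 Q" by (simp add: U0_def)
      fix e assume e: "e \<in> E"
      have "inner (w - p) (pinv ?R e) = 0"
        by (rule p(2)) (intro subsetD[OF closure_subset] span_base imageI e)
      then show "inner_U0 Q (?R (w - p)) e = 0" by (simp add: inner_U0_def inner_pinv[OF R(2)[OF e]])
    qed
    then have "inner (w - p) (w - p) = 0" using wp by (auto simp: orth_kernel_def)
    then show ?thesis using p(1) by simp
  qed
  from parseval_closure_span[OF on this] show ?thesis
    unfolding E_def[symmetric] has_sum_reindex[OF inj] by (simp add: o_def)
qed

text \<open>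
  The operator \<open>N\<close> is \<open>D D\<^sup>*\<close> for \<open>D = B Q\<^sup>1\<^sup>/\<^sup>2\<close>. The adjoint of \<open>C B\<close> as an operator on \<open>U\<^sub>0\<close> is
  \<open>Q\<^sup>1\<^sup>/\<^sup>2 (C D)\<^sup>*\<close>, because the inner product of \<open>U\<^sub>0\<close> becomes that of \<open>U\<close> on the orthogonal complement of the
  kernel of \<open>Q\<^sup>1\<^sup>/\<^sup>2\<close>, where \<open>(C D)\<^sup>*\<close> takes its values.
\<close>

lemma hs_times_adj_eq_sandwich:
  fixes Q :: "'u::separable_hilbert \<Rightarrow>\<^sub>L 'u" and B :: "'u \<Rightarrow> 'g::separable_hilbert"
  assumes B: "hilbert_schmidt (U0 Q) (inner_U0 Q) B"
  obtains N where "trace_adjoint N = N"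
    "\<And>A C. hs_times_adj Q (\<lambda>u. blinfun_apply A (B u) :: 'h::separable_hilbert) (\<lambda>u. blinfun_apply C (B u)) = sandwich A N C"
proof -
  let ?R = "sqrt_op Q"
  define E where "E = onb (U0 Q) (inner_U0 Q)"
  have RU: "?R w \<in> U0 Q" for w by (simp add: U0_def)
  have add: "B (u + v) = B u + B v" and scale: "B (r *\<^sub>R u) = r *\<^sub>R B u" if "u \<in> U0 Q" "v \<in> U0 Q" for u v r
    using B that unfolding hilbert_schmidt_def by blast+
  obtain c where c: "\<And>u. u \<in> U0 Q \<Longrightarrow> norm (B u) \<le> c * sqrt (inner_U0 Q u u)"
    using B unfolding hilbert_schmidt_def by blast
  have B0: "B 0 = 0" using scale[OF RU[of 0] RU[of 0], of 0] by simp
  define D where "D = Blinfun (\<lambda>w. B (?R w))"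
  have "bounded_linear (\<lambda>w. B (?R w))"
  proof (rule bounded_linear_intro[where K = "\<bar>c\<bar>"])
    fix w
    have "norm (B (?R w)) \<le> c * norm (pinv ?R (?R w))"
      using c[OF RU[of w]] by (simp add: inner_U0_def norm_eq_sqrt_inner)
    also have "\<dots> \<le> \<bar>c\<bar> * norm w" by (intro mult_mono norm_pinv_le) auto
    finally show "norm (B (?R w)) \<le> norm w * \<bar>c\<bar>" by (simp add: mult.commute)
  qed (simp_all add: blinfun.bilinear_simps add[OF RU RU] scale[OF RU RU])
  then have D: "D w = B (?R w)" for w by (simp add: D_def bounded_linear_Blinfun_apply)
  have adjD: "adj (C o\<^sub>L D) f \<in> orth_kernel ?R" for f and C :: "'g \<Rightarrow>\<^sub>L 'k::separable_hilbert"
    by (auto simp: orth_kernel_def inner_adj' D B0)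
  have E: "E \<subseteq> U0 Q" using is_onb_U0[of Q] by (auto simp: is_onb_def E_def)
  have summ: "(\<lambda>e. (norm (B e))\<^sup>2) summable_on E" using B by (simp add: hilbert_schmidt_def E_def)
  \<comment> \<open>\<open>D\<^sup>*\<close> is Hilbert-Schmidt: its values are expanded in the image of the basis of \<open>U\<^sub>0\<close>, on which \<open>D\<close> acts as \<open>B\<close>\<close>
  have le: "(\<Sum>f\<in>F. (norm (adj D f))\<^sup>2) \<le> infsum (\<lambda>e. (norm (B e))\<^sup>2) E" if F: "finite F" "F \<subseteq> ob" for F
  proof (rule has_sum_mono[OF _ has_sum_infsum[OF summ]])
    show "((\<lambda>e. \<Sum>f\<in>F. (inner (adj D f) (pinv ?R e))\<^sup>2) has_sum (\<Sum>f\<in>F. (norm (adj D f))\<^sup>2)) E"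
      unfolding E_def using adjD[of id_blinfun]
      by (intro has_sum_finite_sum F parseval_U0) (simp add: blinfun_compose_id)
    fix e assume "e \<in> E"
    then have "?R (pinv ?R e) = e" using E pinv(1)[of ?R] by (auto simp: U0_def)
    then have "(\<Sum>f\<in>F. (inner (adj D f) (pinv ?R e))\<^sup>2) = (\<Sum>f\<in>F. (inner (B e) f)\<^sup>2)"
      by (simp add: inner_adj' D inner_commute)
    also have "\<dots> \<le> (norm (B e))\<^sup>2" by (rule ob_bessel[OF F])
    finally show "(\<Sum>f\<in>F. (inner (adj D f) (pinv ?R e))\<^sup>2) \<le> (norm (B e))\<^sup>2" .
  qed
  have "(\<lambda>f. (norm (adj D f))\<^sup>2) summable_on ob" by (rule has_sum_le_bound(1)[OF _ le]) simp_all
  then have aD: "((\<lambda>f. (norm (adj D f))\<^sup>2) has_sum infsum (\<lambda>f. (norm (adj D f))\<^sup>2) ob) ob"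
    by (rule has_sum_infsum)
  then obtain r where "((\<lambda>f. (norm (adj (adj D) f))\<^sup>2) has_sum r) ob" using hs_adjoint by blast
  then have "((\<lambda>f. (norm (D f))\<^sup>2) has_sum r) ob" by (simp add: adj_adj)
  from trace_class_product(1)[OF this aD] have tc: "trace_class_op (D o\<^sub>L adj D)" .
  define N where "N = Trace_class (D o\<^sub>L adj D)"
  have N: "op_of N = D o\<^sub>L adj D" by (simp add: N_def Trace_class_inverse tc)
  show thesis
  proof
    have "op_of (trace_adjoint N) = op_of N" by (simp add: trace_adjoint.rep_eq N adj_compose adj_adj)
    then show "trace_adjoint N = N" by (simp add: op_of_inject)
    fix A C :: "'g \<Rightarrow>\<^sub>L 'h"
    have "adjoint_U0 Q (\<lambda>u. C (B u)) y = ?R (adj (C o\<^sub>L D) y)" for y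
      unfolding adjoint_U0_def
    proof (rule the_equality)
      let ?x = "adj (C o\<^sub>L D) y"
      have px: "pinv ?R (?R ?x) = ?x" by (rule pinv_eqI[OF refl adjD])
      have "inner_U0 Q (?R w) (?R ?x) = inner (C (B (?R w))) y" for w
        by (simp add: inner_U0_def px inner_pinv[OF adjD]) (simp add: D flip: inner_adj)
      then show "?R ?x \<in> U0 Q \<and> (\<forall>u\<in>U0 Q. inner_U0 Q u (?R ?x) = inner (C (B u)) y)"
        by (auto simp: U0_def)
      fix v assume v: "v \<in> U0 Q \<and> (\<forall>u\<in>U0 Q. inner_U0 Q u v = inner (C (B u)) y)"
      then obtain z where z: "v = ?R z" by (auto simp: U0_def)
      have "inner w (pinv ?R v) = inner w ?x" for w
      proof -
        have "inner w (pinv ?R v) = inner_U0 Q (?R w) v"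
          unfolding inner_U0_def z by (rule inner_pinv[OF pinv(2), symmetric])
        also have "\<dots> = inner ((C o\<^sub>L D) w) y" using v RU by (simp add: D)
        finally show ?thesis by (simp only: inner_adj)
      qed
      then have "pinv ?R v = ?x" by (metis vector_eq_ldot)
      then show "v = ?R ?x" using pinv(1)[of ?R z] by (simp add: z)
    qed
    then have "(\<lambda>x. A (B (adjoint_U0 Q (\<lambda>u. C (B u)) x))) = blinfun_apply (A o\<^sub>L (D o\<^sub>L adj D) o\<^sub>L adj C)"
      by (simp add: fun_eq_iff D adj_compose)
    then have "hs_times_adj Q (\<lambda>u. A (B u)) (\<lambda>u. C (B u)) = Trace_class (A o\<^sub>L (D o\<^sub>L adj D) o\<^sub>L adj C)"
      by (simp add: hs_times_adj_def blinfun_apply_inverse)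
    also have "A o\<^sub>L (D o\<^sub>L adj D) o\<^sub>L adj C = op_of (sandwich A N C)" by (simp add: sandwich.rep_eq N)
    finally show "hs_times_adj Q (\<lambda>u. A (B u)) (\<lambda>u. C (B u)) = sandwich A N C"
      by (simp add: op_of_inverse)
  qed
qed

section \<open>Symmetry of the solution of the Lyapunov equation\<close>

lemma AE_lebesgue_on_Icc_pos: "AE s in lebesgue_on {0..t}. t - s \<in> {0<..t::real}"
proof -
  have "{t} \<in> null_sets lebesgue" by (simp flip: negligible_iff_null_sets)
  from AE_not_in[OF this] have "AE s in lebesgue. s \<in> {0..t} \<longrightarrow> t - s \<in> {0<..t}"
    by eventually_elim auto
  then show ?thesis by (simp add: AE_restrict_space_iff)
qed

lemma nn_integral_reflect_le:
  fixes b :: "real \<Rightarrow> real"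
  assumes b: "b \<in> borel_measurable (lebesgue_on {0..T})" and t: "t \<in> {0..T}"
  shows "(\<integral>\<^sup>+s. ennreal (b (t - s)) \<partial>lebesgue_on {0..t}) \<le> (\<integral>\<^sup>+s. ennreal (b s) \<partial>lebesgue_on {0..T})"
proof -
  let ?h = "\<lambda>s. ennreal (b s) * indicator {0..T} s"
  have h: "?h \<in> borel_measurable lebesgue"
    using b by (subst borel_measurable_restrict_space_iff_ennreal[symmetric]) auto
  have "(\<integral>\<^sup>+s. ennreal (b (t - s)) \<partial>lebesgue_on {0..t}) = (\<integral>\<^sup>+s. ennreal (b (t - s)) * indicator {0..t} s \<partial>lebesgue)"
    by (rule nn_integral_restrict_space) simp
  also have "\<dots> \<le> (\<integral>\<^sup>+s. ?h (t + (-1) * s) \<partial>lebesgue)"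
    by (rule nn_integral_mono) (use t in \<open>auto simp: indicator_def\<close>)
  also have "\<dots> = (\<integral>\<^sup>+s. ?h s \<partial>lebesgue)"
    using nn_integral_real_affine_lebesgue[OF h, of "-1" t] by simp
  also have "\<dots> = (\<integral>\<^sup>+s. ennreal (b s) \<partial>lebesgue_on {0..T})"
    by (rule nn_integral_restrict_space[symmetric]) simp
  finally show ?thesis .
qed

text \<open>
  The Laplace transform of an integrable function tends to \<open>0\<close> at infinity, by dominated convergence.
\<close>

lemma laplace_weight_small:
  fixes a :: "real \<Rightarrow> real"
  assumes a: "integrable (lebesgue_on {0..T}) a"
  obtains c :: real where "integrable (lebesgue_on {0..T}) (\<lambda>s. a s * exp (- c * s))"
    "(LINT s|lebesgue_on {0..T}. a s * exp (- c * s)) < 1"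
proof -
  let ?f = "\<lambda>n s. a s * exp (- real n * s)"
  have m: "?f n \<in> borel_measurable (lebesgue_on {0..T})" for n
    by (intro borel_measurable_times borel_measurable_integrable[OF a]
        continuous_imp_measurable_on_sets_lebesgue continuous_intros) simp
  have b: "AE s in lebesgue_on {0..T}. norm (?f n s) \<le> norm (a s)" for n
  proof (rule AE_I2)
    fix s assume "s \<in> space (lebesgue_on {0..T})"
    then have "exp (- real n * s) \<le> 1" by (simp add: space_lebesgue_on)
    then show "norm (?f n s) \<le> norm (a s)" by (simp add: abs_mult mult_left_le)
  qed
  have lim: "AE s in lebesgue_on {0..T}. (\<lambda>n. ?f n s) \<longlonglongrightarrow> 0"
  proof -
    have "{0::real} \<in> null_sets lebesgue" by (simp flip: negligible_iff_null_sets)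
    from AE_not_in[OF this] have "AE s in lebesgue. s \<in> {0..T} \<longrightarrow> (\<lambda>n. ?f n s) \<longlonglongrightarrow> 0"
    proof eventually_elim
      fix s :: real assume "s \<notin> {0}"
      show "s \<in> {0..T} \<longrightarrow> (\<lambda>n. ?f n s) \<longlonglongrightarrow> 0"
      proof
        assume "s \<in> {0..T}"
        with \<open>s \<notin> {0}\<close> have "exp (- s) < 1" by simp
        then have "(\<lambda>n. exp (- s) ^ n) \<longlonglongrightarrow> 0" by (intro LIMSEQ_power_zero) simp
        then have "(\<lambda>n. a s * exp (- s) ^ n) \<longlonglongrightarrow> a s * 0" by (rule tendsto_mult_left)
        then show "(\<lambda>n. ?f n s) \<longlonglongrightarrow> 0" by (simp add: exp_of_nat_mult[symmetric])
      qed
    qed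
    then show ?thesis by (simp add: AE_restrict_space_iff)
  qed
  have "(\<lambda>n. LINT s|lebesgue_on {0..T}. ?f n s) \<longlonglongrightarrow> (LINT s|lebesgue_on {0..T}. 0)"
    by (rule integral_dominated_convergence[where w = "\<lambda>s. norm (a s)"])
      (use m b lim a in auto)
  then have "\<forall>\<^sub>F n in sequentially. (LINT s|lebesgue_on {0..T}. ?f n s) < 1"
    by (intro order_tendstoD(2)) auto
  then obtain n where "(LINT s|lebesgue_on {0..T}. ?f n s) < 1"
    by (auto simp: eventually_sequentially)
  moreover have "integrable (lebesgue_on {0..T}) (?f n)"
    by (rule Bochner_Integration.integrable_bound[OF a m b])
  ultimately show thesis using that by blast
qed

text \<open>
  In the weighted supremum norm \<open>sup d(s) exp(-c s)\<close> the convolution with \<open>a\<close> is bounded by the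
  factor \<open>\<integral> a(s) exp(-c s) ds\<close>, which is less than 1 for large \<open>c\<close>.
\<close>

lemma gronwall_convolution:
  fixes d a :: "real \<Rightarrow> real"
  assumes a: "integrable (lebesgue_on {0..T}) a" "\<And>r. r \<in> {0<..T} \<Longrightarrow> 0 \<le> a r"
    and d: "continuous_on {0..T} d" "\<And>r. 0 \<le> d r"
    and le: "\<And>t. t \<in> {0..T} \<Longrightarrow> ennreal (d t) \<le> (\<integral>\<^sup>+s. ennreal (a (t - s) * d s) \<partial>lebesgue_on {0..t})"
    and t: "t \<in> {0..T}"
  shows "d t = 0"
proof -
  obtain c where c: "integrable (lebesgue_on {0..T}) (\<lambda>s. a s * exp (- c * s))"
    "(LINT s|lebesgue_on {0..T}. a s * exp (- c * s)) < 1"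
    using laplace_weight_small[OF a(1)] by blast
  let ?b = "\<lambda>s. a s * exp (- c * s)"
  let ?q = "LINT s|lebesgue_on {0..T}. ?b s"
  have "{0} \<in> null_sets lebesgue" by (simp flip: negligible_iff_null_sets)
  from AE_not_in[OF this] have "AE s in lebesgue. s \<in> {0..T} \<longrightarrow> 0 \<le> ?b s"
    by eventually_elim (auto simp: a(2))
  then have b0: "AE s in lebesgue_on {0..T}. 0 \<le> ?b s" by (simp add: AE_restrict_space_iff)
  have "\<exists>m\<in>{0..T}. \<forall>s\<in>{0..T}. d s * exp (- c * s) \<le> d m * exp (- c * m)"
    by (rule continuous_attains_sup) (use t d in \<open>auto intro!: continuous_intros\<close>)
  then obtain m where m: "m \<in> {0..T}" "\<And>s. s \<in> {0..T} \<Longrightarrow> d s * exp (- c * s) \<le> d m * exp (- c * m)"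
    by blast
  let ?M = "d m * exp (- c * m)"
  have "ennreal (d m) \<le> (\<integral>\<^sup>+s. ennreal (a (m - s) * d s) \<partial>lebesgue_on {0..m})" by (rule le[OF m(1)])
  also have "\<dots> \<le> (\<integral>\<^sup>+s. ennreal (d m * ?b (m - s)) \<partial>lebesgue_on {0..m})"
  proof (rule nn_integral_mono_AE)
    show "AE s in lebesgue_on {0..m}. ennreal (a (m - s) * d s) \<le> ennreal (d m * ?b (m - s))"
      using AE_lebesgue_on_Icc_pos[of m] AE_space
    proof eventually_elim
      fix s assume s: "m - s \<in> {0<..m}" "s \<in> space (lebesgue_on {0..m})"
      then have "d s * exp (- c * s) \<le> ?M" using m by (intro m(2)) (auto simp: space_lebesgue_on)
      then have "d s * exp (- c * s) * exp (c * s) \<le> ?M * exp (c * s)" by (intro mult_right_mono) auto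
      then have "d s \<le> d m * exp (- c * (m - s))" by (simp add: mult.assoc right_diff_distrib flip: exp_add)
      then have "a (m - s) * d s \<le> a (m - s) * (d m * exp (- c * (m - s)))"
        using s m(1) by (intro mult_left_mono a(2)) auto
      then show "ennreal (a (m - s) * d s) \<le> ennreal (d m * ?b (m - s))"
        by (intro ennreal_leI) (simp add: mult_ac)
    qed
  qed
  also have "\<dots> \<le> (\<integral>\<^sup>+s. ennreal (d m * ?b s) \<partial>lebesgue_on {0..T})"
    by (rule nn_integral_reflect_le[OF _ m(1)])
      (rule borel_measurable_times[OF borel_measurable_const borel_measurable_integrable[OF c(1)]])
  also have "\<dots> = ennreal (LINT s|lebesgue_on {0..T}. d m * ?b s)"
    by (rule nn_integral_eq_integral) (use c(1) b0 d(2) in auto)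
  also have "(LINT s|lebesgue_on {0..T}. d m * ?b s) = d m * ?q" by (rule integral_mult_right_zero)
  finally have "d m \<le> d m * ?q" using d(2) Bochner_Integration.integral_nonneg_AE[OF b0] by simp
  then have "d m * (1 - ?q) \<le> 0" by (simp add: algebra_simps)
  then have "d m \<le> 0" using c(2) by (simp add: mult_le_0_iff)
  then have "d t * exp (- c * t) \<le> 0" using m(2)[OF t] d(2)[of m] by simp
  then show ?thesis using d(2)[of t] by (simp add: mult_le_0_iff)
qed


lemma trace_adjoint_drift_integrand:
  "trace_adjoint (drift_integrand F R Rh G t s) = drift_integrand F R Rh (\<lambda>s. trace_adjoint (G s)) t s"
  unfolding drift_integrand_def linear_add[OF bounded_linear.linear[OF bounded_linear_trace_adjoint]]
    trace_adjoint_sandwich by (rule add.commute)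

lemma drift_integrand_diff:
  "drift_integrand F R Rh (\<lambda>s. G s - G' s) t s = drift_integrand F R Rh G t s - drift_integrand F R Rh G' t s"
  by (simp add: drift_integrand_def sandwich_diff)

lemma norm_drift_integrand:
  "norm (drift_integrand F R Rh G t s) \<le> 2 * norm (R (t - s)) * norm (Rh (t - s) o\<^sub>L F) * norm (G s)"
  using norm_triangle_ineq[of "sandwich (Rh (t - s) o\<^sub>L F) (G s) (R (t - s))" "sandwich (R (t - s)) (G s) (Rh (t - s) o\<^sub>L F)"]
    norm_sandwich[of "Rh (t - s) o\<^sub>L F" "G s" "R (t - s)"] norm_sandwich[of "R (t - s)" "G s" "Rh (t - s) o\<^sub>L F"]
  by (simp add: drift_integrand_def mult_ac)

text \<open>
  Taking adjoints swaps the two drift terms and leaves the initial term and the noise unchanged.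
\<close>

lemma trace_adjoint_lyapunov_rhs:
  fixes Rh :: "real \<Rightarrow> 'g::separable_hilbert \<Rightarrow>\<^sub>L 'h::separable_hilbert"
  assumes B: "hilbert_schmidt (U0 Q) (inner_U0 Q) B" and Qxi: "trace_adjoint Qxi = Qxi"
    and X: "lyapunov_rhs F Q B Qxi R Rh G t X"
  shows "lyapunov_rhs F Q B Qxi R Rh (\<lambda>s. trace_adjoint (G s)) t (trace_adjoint X)"
proof -
  obtain N where N: "trace_adjoint N = N"
    "\<And>A C. hs_times_adj Q (\<lambda>u. blinfun_apply A (B u) :: 'h) (\<lambda>u. blinfun_apply C (B u)) = sandwich A N C"
    by (rule hs_times_adj_eq_sandwich[OF B]) blast
  have noise: "trace_adjoint (noise_integrand Q B Rh t s) = noise_integrand Q B Rh t s" for s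
    by (simp add: noise_integrand_def N trace_adjoint_sandwich)
  note lin = bounded_linear_trace_adjoint
  have drift: "integrable (lebesgue_on {0..t}) (drift_integrand F R Rh G t)"
    "integrable (lebesgue_on {0..t}) (noise_integrand Q B Rh t)"
    and eq: "X = sandwich (R t) Qxi (R t)
       + (LINT s|lebesgue_on {0..t}. drift_integrand F R Rh G t s)
       + (LINT s|lebesgue_on {0..t}. noise_integrand Q B Rh t s)"
    using X by (auto simp: lyapunov_rhs_def)
  have "trace_adjoint X = sandwich (R t) Qxi (R t)
       + (LINT s|lebesgue_on {0..t}. trace_adjoint (drift_integrand F R Rh G t s))
       + (LINT s|lebesgue_on {0..t}. trace_adjoint (noise_integrand Q B Rh t s))"
    unfolding eq linear_add[OF bounded_linear.linear[OF lin]] trace_adjoint_sandwich Qxi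
      integral_bounded_linear[OF lin drift(1)] integral_bounded_linear[OF lin drift(2)] ..
  then show ?thesis
    using integrable_bounded_linear[OF lin drift(1)] drift(2)
    by (simp add: lyapunov_rhs_def trace_adjoint_drift_integrand noise)
qed

text \<open>
  The difference \<open>D\<close> of two solutions satisfies \<open>\<parallel>D(r)\<parallel> \<le> \<integral> 2 C a(r - s) \<parallel>D(s)\<parallel> ds\<close>, where \<open>C\<close> bounds \<open>\<parallel>R\<parallel>\<close> and
  \<open>a\<close> bounds \<open>\<parallel>R F\<parallel>\<close>.
\<close>

lemma lyapunov_solution_unique:
  assumes T: "0 \<le> T" and R: "family_bounds T F Q B R Rh"
    and K: "continuous_on {0..T} K" "\<And>r. r \<in> {0..T} \<Longrightarrow> lyapunov_rhs F Q B Qxi R Rh K r (K r)"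
    and K': "continuous_on {0..T} K'" "\<And>r. r \<in> {0..T} \<Longrightarrow> lyapunov_rhs F Q B Qxi R Rh K' r (K' r)"
    and t: "t \<in> {0..T}"
  shows "K t = K' t"
proof -
  obtain C a where a: "integrable (lebesgue_on {0..T}) a"
    and C: "\<And>r. r \<in> {0..T} \<Longrightarrow> norm (R r) \<le> C"
    and aF: "\<And>r. r \<in> {0<..T} \<Longrightarrow> norm (Rh r o\<^sub>L F) \<le> a r"
    using R unfolding family_bounds_def by blast
  have C0: "0 \<le> C" using C[of 0] T by (auto intro: order_trans[OF norm_ge_zero])
  have a0: "0 \<le> a r" if "r \<in> {0<..T}" for r using aF[OF that] by (rule order_trans[OF norm_ge_zero])
  let ?D = "\<lambda>s. K s - K' s"
  have "norm (?D t) = 0"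
  proof (rule gronwall_convolution[where a = "\<lambda>r. 2 * C * a r", OF _ _ _ _ _ t])
    show "integrable (lebesgue_on {0..T}) (\<lambda>r. 2 * C * a r)" using a by simp
    show "0 \<le> 2 * C * a r" if "r \<in> {0<..T}" for r using C0 a0[OF that] by simp
    show "continuous_on {0..T} (\<lambda>s. norm (?D s))" by (intro continuous_intros K K')
    fix r assume r: "r \<in> {0..T}"
    have i: "integrable (lebesgue_on {0..r}) (drift_integrand F R Rh K r)"
      "integrable (lebesgue_on {0..r}) (drift_integrand F R Rh K' r)"
      using K(2)[OF r] K'(2)[OF r] by (auto simp: lyapunov_rhs_def)
    have "?D r = (LINT s|lebesgue_on {0..r}. drift_integrand F R Rh K r s)
        - (LINT s|lebesgue_on {0..r}. drift_integrand F R Rh K' r s)"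
      using K(2)[OF r] K'(2)[OF r] unfolding lyapunov_rhs_def by (metis add_diff_cancel_left add_diff_cancel_right)
    also have "\<dots> = (LINT s|lebesgue_on {0..r}. drift_integrand F R Rh ?D r s)"
      unfolding drift_integrand_diff by (rule Bochner_Integration.integral_diff[OF i, symmetric])
    finally have "ennreal (norm (?D r)) = ennreal (norm (LINT s|lebesgue_on {0..r}. drift_integrand F R Rh ?D r s))"
      by simp
    also have "\<dots> \<le> (\<integral>\<^sup>+s. ennreal (norm (drift_integrand F R Rh ?D r s)) \<partial>lebesgue_on {0..r})"
      unfolding drift_integrand_diff
      by (rule integral_norm_bound_ennreal) (rule Bochner_Integration.integrable_diff[OF i])
    also have "\<dots> \<le> (\<integral>\<^sup>+s. ennreal (2 * C * a (r - s) * norm (?D s)) \<partial>lebesgue_on {0..r})"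
    proof (rule nn_integral_mono_AE)
      show "AE s in lebesgue_on {0..r}. ennreal (norm (drift_integrand F R Rh ?D r s))
          \<le> ennreal (2 * C * a (r - s) * norm (?D s))"
        using AE_lebesgue_on_Icc_pos[of r]
      proof eventually_elim
        fix s assume "r - s \<in> {0<..r}"
        then have rs: "r - s \<in> {0<..T}" "r - s \<in> {0..T}" using r by auto
        have "norm (drift_integrand F R Rh ?D r s)
            \<le> 2 * norm (R (r - s)) * norm (Rh (r - s) o\<^sub>L F) * norm (?D s)"
          by (rule norm_drift_integrand)
        also have "\<dots> \<le> 2 * C * a (r - s) * norm (?D s)"
          using C[OF rs(2)] aF[OF rs(1)] C0 by (intro mult_right_mono mult_mono) auto
        finally show "ennreal (norm (drift_integrand F R Rh ?D r s)) \<le> ennreal (2 * C * a (r - s) * norm (?D s))"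
          by (rule ennreal_leI)
      qed
    qed
    finally show "ennreal (norm (?D r)) \<le> (\<integral>\<^sup>+s. ennreal (2 * C * a (r - s) * norm (?D s)) \<partial>lebesgue_on {0..r})" .
  qed simp
  then show ?thesis by simp
qed

section \<open>The error estimate\<close>

context
  fixes i :: nat
  assumes i: "i \<in> {1, 2}"
begin

lemma L_norm_add_trace_adjoint:
  assumes "2 *\<^sub>R Z = W + trace_adjoint W"
  shows "L_norm i Z \<le> L_norm i W"
proof -
  have "2 * L_norm i Z = L_norm i (W + trace_adjoint W)"
    unfolding assms[symmetric] by (simp add: L_norm_scaleR[OF i])
  also have "\<dots> \<le> 2 * L_norm i W"
    using L_norm_triangle[OF i, of W "trace_adjoint W"] by (simp add: L_norm_trace_adjoint[OF i])
  finally show ?thesis by simp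
qed

lemma L_norm_sandwich_diff:
  assumes N: "trace_adjoint N = N"
  shows "L_norm i (sandwich A N A - sandwich A' N A') \<le> L_norm i (sandwich (A - A') N (A + A'))"
  by (rule L_norm_add_trace_adjoint) (simp add: sandwich_diff_symmetrized trace_adjoint_sandwich N)

lemma L_norm_sandwich_sym:
  assumes "trace_adjoint K = K"
  shows "L_norm i (sandwich A K C + sandwich C K A) \<le> 2 * L_norm i (sandwich A K C)"
  using L_norm_triangle[OF i, of "sandwich A K C" "sandwich C K A"]
    L_norm_trace_adjoint[OF i, of "sandwich A K C"]
  by (simp add: trace_adjoint_sandwich assms)

text \<open>
  Twice the difference is \<open>W + W\<^sup>*\<close>, where \<open>W\<close> is the sum of the two operators on the right.
\<close>

lemma L_norm_sandwich_sym_diff: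
  assumes K: "trace_adjoint K = K"
  shows "L_norm i ((sandwich A K C + sandwich C K A) - (sandwich A' K C' + sandwich C' K A'))
    \<le> L_norm i (sandwich (A - A') K (C + C')) + L_norm i (sandwich (A + A') K (C - C'))"
    (is "L_norm i ?Z \<le> L_norm i ?X + L_norm i ?Y")
proof -
  have "2 *\<^sub>R ?Z = 2 *\<^sub>R (sandwich A K C - sandwich A' K C') + 2 *\<^sub>R (sandwich C K A - sandwich C' K A')"
    by (simp add: algebra_simps)
  also have "\<dots> = (?X + ?Y) + trace_adjoint (?X + ?Y)"
    unfolding sandwich_diff_symmetrized linear_add[OF bounded_linear.linear[OF bounded_linear_trace_adjoint]]
      trace_adjoint_sandwich K by simp
  finally have "L_norm i ?Z \<le> L_norm i (?X + ?Y)" by (rule L_norm_add_trace_adjoint)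
  also have "\<dots> \<le> L_norm i ?X + L_norm i ?Y" by (rule L_norm_triangle[OF i])
  finally show ?thesis .
qed

text \<open>
  Inserting the drift of \<open>S\<close> at \<open>Khat\<close> separates the error of \<open>Khat\<close> from the error of the operators.
\<close>

lemma L_norm_drift_integrand_diff:
  assumes K: "trace_adjoint (K s) = K s" and Khat: "trace_adjoint (Khat s) = Khat s"
  shows "L_norm i (drift_integrand F S Sh K t s - drift_integrand F St Sth Khat t s)
    \<le> 2 * L_norm i (sandwich (Sh (t - s) o\<^sub>L F) (K s - Khat s) (S (t - s)))
      + L_norm i (sandwich ((Sh (t - s) - Sth (t - s)) o\<^sub>L F) (Khat s) (S (t - s) + St (t - s)))
      + L_norm i (sandwich ((Sh (t - s) + Sth (t - s)) o\<^sub>L F) (Khat s) (S (t - s) - St (t - s)))"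
proof -
  have "drift_integrand F S Sh K t s - drift_integrand F St Sth Khat t s
    = drift_integrand F S Sh (\<lambda>s. K s - Khat s) t s
      + (drift_integrand F S Sh Khat t s - drift_integrand F St Sth Khat t s)"
    by (simp add: drift_integrand_diff)
  also have "L_norm i \<dots> \<le> L_norm i (drift_integrand F S Sh (\<lambda>s. K s - Khat s) t s)
      + L_norm i (drift_integrand F S Sh Khat t s - drift_integrand F St Sth Khat t s)"
    by (rule L_norm_triangle[OF i])
  finally show ?thesis
    using L_norm_sandwich_sym[of "K s - Khat s" "Sh (t - s) o\<^sub>L F" "S (t - s)"]
      L_norm_sandwich_sym_diff[OF Khat, of "Sh (t - s) o\<^sub>L F" "S (t - s)" "Sth (t - s) o\<^sub>L F" "St (t - s)"]
    by (simp add: drift_integrand_def K Khat linear_diff[OF bounded_linear.linear[OF bounded_linear_trace_adjoint]]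
        blinfun_compose_simps)
qed

end

lemma nn_integral_weighted_sum:
  fixes p x y z :: "'a \<Rightarrow> ennreal"
  assumes [measurable]: "p \<in> borel_measurable M" "x \<in> borel_measurable M" "y \<in> borel_measurable M"
    "z \<in> borel_measurable M"
  shows "(\<integral>\<^sup>+s. c * p s + x s + y s + z s \<partial>M)
    = c * (\<integral>\<^sup>+s. p s \<partial>M) + (\<integral>\<^sup>+s. x s \<partial>M) + (\<integral>\<^sup>+s. y s \<partial>M) + (\<integral>\<^sup>+s. z s \<partial>M)"
  by (simp add: nn_integral_add nn_integral_cmult)

theorem proposition2p7:
  fixes T t :: real and i :: nat
    and j F :: "'h::separable_hilbert \<Rightarrow>\<^sub>L 'g::separable_hilbert"
    and Q :: "'u::separable_hilbert \<Rightarrow>\<^sub>L 'u"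
    and B :: "'u \<Rightarrow> 'g"
    and Qxi :: "'h trace_class"
    and S St :: "real \<Rightarrow> 'h \<Rightarrow>\<^sub>L 'h"
    and Sh Sth :: "real \<Rightarrow> 'g \<Rightarrow>\<^sub>L 'h"
    and K Khat Kt :: "real \<Rightarrow> 'h trace_class"
  assumes "0 \<le> T"
    and embedding: "inj (blinfun_apply j)" "closure (range (blinfun_apply j)) = UNIV"
    and Q: "Q \<in> Sigma_pos"
    and B: "hilbert_schmidt (U0 Q) (inner_U0 Q) B"
    and Qxi: "op_of Qxi \<in> Sigma_pos"
    and S: "operator_family T j S Sh" "family_bounds T F Q B S Sh"
    and St: "operator_family T j St Sth" "family_bounds T F Q B St Sth"
    and S_cont:
      "\<And>v. continuous_on {0..T} (\<lambda>r. S r v)"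
      "\<And>v. continuous_on {0<..T} (\<lambda>r. Sh r (F v))"
      "\<And>r. r \<in> {0<..T} \<Longrightarrow> hs_continuous_within Q r {0<..T} (\<lambda>r u. Sh r (B u))"
    and St_cont:
      "\<And>v. AE r in lebesgue_on {0..T}. continuous (at r within {0..T}) (\<lambda>r. St r v)"
      "\<And>v. AE r in lebesgue_on {0..T}. continuous (at r within {0..T}) (\<lambda>r. Sth r (F v))"
      "AE r in lebesgue_on {0..T}. hs_continuous_within Q r {0..T} (\<lambda>r u. Sth r (B u))"
    and Khat:
      "\<And>r. r \<in> {0..T} \<Longrightarrow> op_of (Khat r) \<in> Sigma_sym"
      "AE r in lebesgue_on {0..T}. continuous (at r within {0..T}) Khat"
    and K: "continuous_on {0..T} K" "\<And>r. r \<in> {0..T} \<Longrightarrow> lyapunov_rhs F Q B Qxi S Sh K r (K r)"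
    and Kt: "\<And>r. r \<in> {0..T} \<Longrightarrow> lyapunov_rhs F Q B Qxi St Sth Khat r (Kt r)"
    and t: "t \<in> {0..T}" and i: "i \<in> {1, 2}"
  shows "ennreal (L_norm i (K t - Kt t)) \<le>
      ennreal (L_norm i (sandwich (S t - St t) Qxi (S t + St t)))
    + 2 * (\<integral>\<^sup>+s. ennreal (L_norm i (sandwich (Sh (t - s) o\<^sub>L F) (K s - Khat s) (S (t - s)))) \<partial>lebesgue_on {0..t})
    + (\<integral>\<^sup>+s. ennreal (L_norm i (sandwich ((Sh (t - s) - Sth (t - s)) o\<^sub>L F) (Khat s) (S (t - s) + St (t - s)))) \<partial>lebesgue_on {0..t})
    + (\<integral>\<^sup>+s. ennreal (L_norm i (sandwich ((Sh (t - s) + Sth (t - s)) o\<^sub>L F) (Khat s) (S (t - s) - St (t - s)))) \<partial>lebesgue_on {0..t})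
    + (\<integral>\<^sup>+s. ennreal (L_norm i (hs_times_adj Q (\<lambda>u. (Sh (t - s) - Sth (t - s)) (B u)) (\<lambda>u. (Sh (t - s) + Sth (t - s)) (B u)))) \<partial>lebesgue_on {0..t})"
proof -
  let ?M = "lebesgue_on {0..t}"
  have tT: "t \<le> T" using t by simp
  obtain N where N: "trace_adjoint N = N"
    and noise: "\<And>A C. hs_times_adj Q (\<lambda>u. blinfun_apply A (B u) :: 'h) (\<lambda>u. blinfun_apply C (B u)) = sandwich A N C"
    by (rule hs_times_adj_eq_sandwich[OF B]) blast
  have Qxi_sym: "trace_adjoint Qxi = Qxi" using Qxi by (intro trace_adjoint_sym) (simp add: Sigma_pos_def)
  \<comment> \<open>\<open>K\<^sup>*\<close> is a second continuous solution\<close>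
  have K_sym: "trace_adjoint (K s) = K s" if s: "s \<in> {0..T}" for s
  proof (rule lyapunov_solution_unique[OF \<open>0 \<le> T\<close> S(2) _ _ K s])
    show "continuous_on {0..T} (\<lambda>r. trace_adjoint (K r))"
      by (rule bounded_linear.continuous_on[OF bounded_linear_trace_adjoint K(1)])
    show "lyapunov_rhs F Q B Qxi S Sh (\<lambda>r. trace_adjoint (K r)) r (trace_adjoint (K r))" if "r \<in> {0..T}" for r
      by (rule trace_adjoint_lyapunov_rhs[OF B Qxi_sym K(2)[OF that]])
  qed
  have Khat_sym: "trace_adjoint (Khat s) = Khat s" if "s \<in> {0..T}" for s
    by (rule trace_adjoint_sym[OF Khat(1)[OF that]])

  have "AE r in lebesgue_on {0..T}. continuous (at r within {0..T}) (\<lambda>r. S r v)" for v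
    using S_cont(1)[of v] by (auto simp: continuous_on_eq_continuous_within space_lebesgue_on intro!: AE_I2)
  note meas_S = borel_measurable_operator_family[OF S(1) embedding(2) this t]
  note meas_St = borel_measurable_operator_family[OF St(1) embedding(2) St_cont(1) t]
  have meas_K: "K \<in> borel_measurable ?M"
    by (rule continuous_imp_measurable_on_sets_lebesgue[OF continuous_on_subset[OF K(1)]]) (use tT in auto)
  have meas_Khat: "Khat \<in> borel_measurable ?M"
    by (rule borel_measurable_AE_continuous[OF Khat(2) t])

  let ?P = "\<lambda>s. sandwich (Sh (t - s) o\<^sub>L F) (K s - Khat s) (S (t - s))"
  let ?X = "\<lambda>s. sandwich ((Sh (t - s) - Sth (t - s)) o\<^sub>L F) (Khat s) (S (t - s) + St (t - s))"
  let ?Y = "\<lambda>s. sandwich ((Sh (t - s) + Sth (t - s)) o\<^sub>L F) (Khat s) (S (t - s) - St (t - s))"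
  let ?Z = "\<lambda>s. hs_times_adj Q (\<lambda>u. (Sh (t - s) - Sth (t - s)) (B u)) (\<lambda>u. (Sh (t - s) + Sth (t - s)) (B u))"
  have meas_ops: "(\<lambda>s. (Sh (t - s) - Sth (t - s)) g) \<in> borel_measurable ?M"
    "(\<lambda>s. (Sh (t - s) + Sth (t - s)) g) \<in> borel_measurable ?M"
    "(\<lambda>s. (S (t - s) - St (t - s)) v) \<in> borel_measurable ?M"
    "(\<lambda>s. (S (t - s) + St (t - s)) v) \<in> borel_measurable ?M" for g v
    unfolding blinfun.diff_left blinfun.add_left
    by (rule borel_measurable_diff borel_measurable_add meas_S meas_St)+
  have meas: "?P \<in> borel_measurable ?M" "?X \<in> borel_measurable ?M" "?Y \<in> borel_measurable ?M"
    "?Z \<in> borel_measurable ?M"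
    unfolding noise
    by (rule borel_measurable_sandwich,
        (unfold blinfun_apply_blinfun_compose)?,
        rule borel_measurable_diff[OF meas_K meas_Khat] meas_Khat borel_measurable_const,
        (rule meas_ops meas_S)+)+
  note meas_L = meas[THEN measurable_L_norm[OF i], THEN measurable_compose[OF _ measurable_ennreal]]

  let ?f = "\<lambda>s. drift_integrand F S Sh K t s - drift_integrand F St Sth Khat t s"
  let ?g = "\<lambda>s. noise_integrand Q B Sh t s - noise_integrand Q B Sth t s"
  have int: "integrable ?M (drift_integrand F S Sh K t)" "integrable ?M (drift_integrand F St Sth Khat t)"
    "integrable ?M (noise_integrand Q B Sh t)" "integrable ?M (noise_integrand Q B Sth t)"
    using K(2)[OF t] Kt[OF t] by (auto simp: lyapunov_rhs_def)
  then have fg: "integrable ?M (\<lambda>s. ?f s + ?g s)" by simp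
  let ?I = "sandwich (S t) Qxi (S t) - sandwich (St t) Qxi (St t)"
  have eq: "K t - Kt t = ?I + (LINT s|?M. ?f s + ?g s)"
    using K(2)[OF t] Kt[OF t] int by (simp add: lyapunov_rhs_def)
  have bound: "L_norm i (?f s + ?g s)
      \<le> 2 * L_norm i (?P s) + L_norm i (?X s) + L_norm i (?Y s) + L_norm i (?Z s)"
    if s: "s \<in> {0..t}" for s
  proof -
    have sT: "s \<in> {0..T}" using s tT by simp
    have "L_norm i (?g s) \<le> L_norm i (?Z s)"
      unfolding noise_integrand_def noise by (rule L_norm_sandwich_diff[OF i N])
    then show ?thesis
      using L_norm_triangle[OF i, of "?f s" "?g s"]
        L_norm_drift_integrand_diff[where K = K and Khat = Khat, OF i K_sym[OF sT] Khat_sym[OF sT], of F S Sh t St Sth]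
      by linarith
  qed

  have "L_norm i (K t - Kt t) \<le> L_norm i ?I + L_norm i (LINT s|?M. ?f s + ?g s)"
    unfolding eq by (rule L_norm_triangle[OF i])
  also have "\<dots> \<le> L_norm i (sandwich (S t - St t) Qxi (S t + St t)) + (LINT s|?M. L_norm i (?f s + ?g s))"
    by (intro add_mono L_norm_sandwich_diff[OF i Qxi_sym] L_norm_integral[OF i fg])
  finally have error: "L_norm i (K t - Kt t) \<le> L_norm i (sandwich (S t - St t) Qxi (S t + St t))
      + (LINT s|?M. L_norm i (?f s + ?g s))" .
  have "ennreal (LINT s|?M. L_norm i (?f s + ?g s)) = (\<integral>\<^sup>+s. ennreal (L_norm i (?f s + ?g s)) \<partial>?M)"
    by (rule nn_integral_eq_integral[symmetric]) (simp_all add: integrable_L_norm[OF i fg] L_norm_nonneg[OF i])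
  also have "\<dots> \<le> (\<integral>\<^sup>+s. 2 * ennreal (L_norm i (?P s)) + ennreal (L_norm i (?X s))
      + ennreal (L_norm i (?Y s)) + ennreal (L_norm i (?Z s)) \<partial>?M)"
  proof (rule nn_integral_mono)
    fix s assume "s \<in> space ?M"
    then have "s \<in> {0..t}" by (simp add: space_lebesgue_on)
    from ennreal_leI[OF bound[OF this]]
    show "ennreal (L_norm i (?f s + ?g s)) \<le> 2 * ennreal (L_norm i (?P s)) + ennreal (L_norm i (?X s))
      + ennreal (L_norm i (?Y s)) + ennreal (L_norm i (?Z s))"
      by (simp add: L_norm_nonneg[OF i] ennreal_plus ennreal_mult)
  qed
  also have "\<dots> = 2 * (\<integral>\<^sup>+s. ennreal (L_norm i (?P s)) \<partial>?M) + (\<integral>\<^sup>+s. ennreal (L_norm i (?X s)) \<partial>?M)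
      + (\<integral>\<^sup>+s. ennreal (L_norm i (?Y s)) \<partial>?M) + (\<integral>\<^sup>+s. ennreal (L_norm i (?Z s)) \<partial>?M)"
    by (rule nn_integral_weighted_sum[OF meas_L])
  finally have integral: "ennreal (LINT s|?M. L_norm i (?f s + ?g s)) \<le> \<dots>" .
  have "ennreal (L_norm i (K t - Kt t)) \<le> ennreal (L_norm i (sandwich (S t - St t) Qxi (S t + St t)))
      + ennreal (LINT s|?M. L_norm i (?f s + ?g s))"
    using ennreal_leI[OF error]
    by (simp only: ennreal_plus[OF L_norm_nonneg[OF i] Bochner_Integration.integral_nonneg[OF L_norm_nonneg[OF i]]])
  also have "\<dots> \<le> ennreal (L_norm i (sandwich (S t - St t) Qxi (S t + St t)))
      + (2 * (\<integral>\<^sup>+s. ennreal (L_norm i (?P s)) \<partial>?M) + (\<integral>\<^sup>+s. ennreal (L_norm i (?X s)) \<partial>?M)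
        + (\<integral>\<^sup>+s. ennreal (L_norm i (?Y s)) \<partial>?M) + (\<integral>\<^sup>+s. ennreal (L_norm i (?Z s)) \<partial>?M))"
    by (rule add_left_mono[OF integral])
  finally show ?thesis unfolding add.assoc .
qed

end
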